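(* Let $(G,g)$ be a connected nonabelian cyclic metric Lie group. Then: (i) If $G$ is solvable, then $(G,g)$ has strictly negative scalar curvature. (ii) If $G$ is unimodular, then there exist positive sectional curvatures (i.e. some tangent plane has positive sectional curvature). If moreover $G$ is solvable, then $(G,g)$ has both positive and negative sectional curvatures. (iii) If $G$ is not unimodular, then there exist negative sectional curvatures.
   Context: A metric Lie group $(G,g)$ is a real Lie group $G$ with a left-invariant Riemannian metric $g$; $\mathfrak{g}$ is its Lie algebra and $\langle\cdot,\cdot\rangle$ is the inner product on $\mathfrak{g}$ induced by $g$. $(G,g)$ is called cyclic if $\langle [X,Y],Z\rangle+\langle [Y,Z],X\rangle+\langle [Z,X],Y\rangle=0$ for all $X,Y,Z\in\mathfrak{g}$. The connected Lie group $G$ is unimodular if and only if $\operatorname{tr}\operatorname{ad}_X=0$ for all $X\in\mathfrak{g}$. *)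

theory Defs
  imports
    "HOL-Analysis.Analysis"
    "HOL-Algebra.Solvable_Groups"
    "HOL-Library.Function_Algebras"
begin

section \<open>Functions form a real vector space\<close>

text \<open>
  Together with \<^theory>\<open>HOL-Library.Function_Algebras\<close> this makes the pointwise operations, and the
  library notions of \<^const>\<open>span\<close>, \<^const>\<open>independent\<close> and \<^const>\<open>representation\<close>, available for tangent
  vectors and vector fields, which are functionals and operators on real functions.
\<close>

instantiation "fun" :: (type, real_vector) real_vector
begin

definition scaleR_fun :: "real \<Rightarrow> ('a \<Rightarrow> 'b) \<Rightarrow> 'a \<Rightarrow> 'b"
  where "scaleR_fun c f = (\<lambda>x. c *\<^sub>R f x)"

instance
  by standard (simp_all add: scaleR_fun_def fun_eq_iff scaleR_add_right scaleR_add_left)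

end


section \<open>Smooth maps between Euclidean spaces\<close>

text \<open>
  Only meant for open \<open>S\<close> in finite dimension. There, continuity of \<open>x \<mapsto> f'(x) v\<close> for every fixed
  \<open>v\<close> is the same as continuity of \<open>f'\<close> in operator norm, and likewise for the higher derivatives.
\<close>

primrec k_smooth_on ::
  "nat \<Rightarrow> 'a::real_normed_vector set \<Rightarrow> ('a \<Rightarrow> 'b::real_normed_vector) \<Rightarrow> bool"
where
  "k_smooth_on 0 S f \<longleftrightarrow> continuous_on S f"
| "k_smooth_on (Suc k) S f \<longleftrightarrow>
     (\<forall>x\<in>S. f differentiable (at x)) \<and>
     (\<forall>v. k_smooth_on k S (\<lambda>x. frechet_derivative f (at x) v))"

definition smooth_on :: "'a::real_normed_vector set \<Rightarrow> ('a \<Rightarrow> 'b::real_normed_vector) \<Rightarrow> bool"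
  where "smooth_on S f \<longleftrightarrow> (\<forall>k. k_smooth_on k S f)"


section \<open>Smooth manifolds\<close>

text \<open>
  A smooth manifold is a Hausdorff second countable type with a smooth atlas, modelled on a Euclidean
  space \<open>'e\<close>, so of dimension \<open>DIM('e) \<ge> 1\<close>. A chart is an open set with a coordinate map on it.
  The atlas need not be maximal.
\<close>

type_synonym ('m, 'e) chart = "'m set \<times> ('m \<Rightarrow> 'e)"

definition smooth_atlas :: "('m::topological_space, 'e::euclidean_space) chart set \<Rightarrow> bool" where
  "smooth_atlas A \<longleftrightarrow>
     (\<Union>(U, \<phi>)\<in>A. U) = UNIV \<and>
     (\<forall>(U, \<phi>)\<in>A. open U \<and> open (\<phi> ` U) \<and> homeomorphism U (\<phi> ` U) \<phi> (inv_into U \<phi>)) \<and>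
     (\<forall>(U, \<phi>)\<in>A. \<forall>(V, \<psi>)\<in>A. smooth_on (\<phi> ` (U \<inter> V)) (\<psi> \<circ> inv_into U \<phi>))"

definition smooth_map ::
  "('m::topological_space, 'e::euclidean_space) chart set \<Rightarrow>
   ('n::topological_space, 'f::euclidean_space) chart set \<Rightarrow> ('m \<Rightarrow> 'n) \<Rightarrow> bool" where
  "smooth_map A B f \<longleftrightarrow>
     continuous_on UNIV f \<and>
     (\<forall>(U, \<phi>)\<in>A. \<forall>(V, \<psi>)\<in>B. smooth_on (\<phi> ` (U \<inter> f -` V)) (\<psi> \<circ> f \<circ> inv_into U \<phi>))"

definition product_atlas ::
  "('m, 'e) chart set \<Rightarrow> ('n, 'f) chart set \<Rightarrow> ('m \<times> 'n, 'e \<times> 'f) chart set" where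
  "product_atlas A B = {(U \<times> V, map_prod \<phi> \<psi>) | U \<phi> V \<psi>. (U, \<phi>) \<in> A \<and> (V, \<psi>) \<in> B}"

definition real_atlas :: "(real, real) chart set" where
  "real_atlas = {(UNIV, id)}"

definition smooth_functions ::
  "('m::topological_space, 'e::euclidean_space) chart set \<Rightarrow> ('m \<Rightarrow> real) set" where
  "smooth_functions A = {f. smooth_map A real_atlas f}"

text \<open>
  Tangent vectors at \<open>p\<close> are the derivations at \<open>p\<close> of the algebra of smooth functions. In HOL they
  are total functionals, so they are normalised to vanish on nonsmooth functions; this makes
  equality of functionals equality of tangent vectors. The same convention is used for vector fields.
\<close>

type_synonym 'm tangent = "('m \<Rightarrow> real) \<Rightarrow> real"
type_synonym 'm vfield = "('m \<Rightarrow> real) \<Rightarrow> ('m \<Rightarrow> real)"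

definition tangent_space ::
  "('m::topological_space, 'e::euclidean_space) chart set \<Rightarrow> 'm \<Rightarrow> 'm tangent set" where
  "tangent_space A p = {v.
     (\<forall>f. f \<notin> smooth_functions A \<longrightarrow> v f = 0) \<and>
     (\<forall>f\<in>smooth_functions A. \<forall>h\<in>smooth_functions A. v (f + h) = v f + v h) \<and>
     (\<forall>f\<in>smooth_functions A. \<forall>c. v (c *\<^sub>R f) = c * v f) \<and>
     (\<forall>f\<in>smooth_functions A. \<forall>h\<in>smooth_functions A. v (f * h) = f p * v h + h p * v f)}"

definition value_at :: "'m vfield \<Rightarrow> 'm \<Rightarrow> 'm tangent" where
  "value_at X p = (\<lambda>f. X f p)"

definition vector_fields ::
  "('m::topological_space, 'e::euclidean_space) chart set \<Rightarrow> 'm vfield set" where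
  "vector_fields A = {X.
     (\<forall>p. value_at X p \<in> tangent_space A p) \<and>
     (\<forall>f\<in>smooth_functions A. X f \<in> smooth_functions A)}"

definition lie_bracket :: "'m vfield \<Rightarrow> 'm vfield \<Rightarrow> 'm vfield" where
  "lie_bracket X Y = (\<lambda>f. X (Y f) - Y (X f))"

definition fun_times_vf :: "('m \<Rightarrow> real) \<Rightarrow> 'm vfield \<Rightarrow> 'm vfield" where
  "fun_times_vf f X = (\<lambda>h. f * X h)"

text \<open>The differential of a smooth self-map \<open>F\<close>.\<close>

definition pushforward ::
  "('m::topological_space, 'e::euclidean_space) chart set \<Rightarrow> ('m \<Rightarrow> 'm) \<Rightarrow> 'm tangent \<Rightarrow> 'm tangent"
where
  "pushforward A F v = (\<lambda>f. if f \<in> smooth_functions A then v (f \<circ> F) else 0)"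


section \<open>Riemannian metrics and curvature\<close>

definition metric_fun ::
  "('m \<Rightarrow> 'm tangent \<Rightarrow> 'm tangent \<Rightarrow> real) \<Rightarrow> 'm vfield \<Rightarrow> 'm vfield \<Rightarrow> 'm \<Rightarrow> real" where
  "metric_fun g X Y = (\<lambda>p. g p (value_at X p) (value_at Y p))"

definition riemannian_metric ::
  "('m::topological_space, 'e::euclidean_space) chart set \<Rightarrow>
   ('m \<Rightarrow> 'm tangent \<Rightarrow> 'm tangent \<Rightarrow> real) \<Rightarrow> bool" where
  "riemannian_metric A g \<longleftrightarrow>
     (\<forall>p. \<forall>u\<in>tangent_space A p. \<forall>v\<in>tangent_space A p.
        g p u v = g p v u \<and>
        (\<forall>w\<in>tangent_space A p. g p (u + v) w = g p u w + g p v w) \<and>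
        (\<forall>c. g p (c *\<^sub>R u) v = c * g p u v) \<and>
        (u \<noteq> 0 \<longrightarrow> g p u u > 0)) \<and>
     (\<forall>X\<in>vector_fields A. \<forall>Y\<in>vector_fields A.
        metric_fun g X Y \<in> smooth_functions A)"

definition affine_connection ::
  "('m::topological_space, 'e::euclidean_space) chart set \<Rightarrow>
   ('m vfield \<Rightarrow> 'm vfield \<Rightarrow> 'm vfield) \<Rightarrow> bool" where
  "affine_connection A D \<longleftrightarrow>
     (\<forall>X\<in>vector_fields A. \<forall>Y\<in>vector_fields A. D X Y \<in> vector_fields A) \<and>
     (\<forall>X\<in>vector_fields A. \<forall>X'\<in>vector_fields A. \<forall>Y\<in>vector_fields A.
        D (X + X') Y = D X Y + D X' Y) \<and>
     (\<forall>X\<in>vector_fields A. \<forall>Y\<in>vector_fields A. \<forall>Y'\<in>vector_fields A.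
        D X (Y + Y') = D X Y + D X Y') \<and>
     (\<forall>X\<in>vector_fields A. \<forall>Y\<in>vector_fields A. \<forall>f\<in>smooth_functions A.
        D (fun_times_vf f X) Y = fun_times_vf f (D X Y) \<and>
        D X (fun_times_vf f Y) = fun_times_vf (X f) Y + fun_times_vf f (D X Y))"

definition levi_civita_connection ::
  "('m::topological_space, 'e::euclidean_space) chart set \<Rightarrow>
   ('m \<Rightarrow> 'm tangent \<Rightarrow> 'm tangent \<Rightarrow> real) \<Rightarrow>
   ('m vfield \<Rightarrow> 'm vfield \<Rightarrow> 'm vfield) \<Rightarrow> bool" where
  "levi_civita_connection A g D \<longleftrightarrow>
     affine_connection A D \<and>
     (\<forall>X\<in>vector_fields A. \<forall>Y\<in>vector_fields A. D X Y - D Y X = lie_bracket X Y) \<and>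
     (\<forall>X\<in>vector_fields A. \<forall>Y\<in>vector_fields A. \<forall>Z\<in>vector_fields A.
        X (metric_fun g Y Z) = metric_fun g (D X Y) Z + metric_fun g Y (D X Z))"

text \<open>
  The conditions above say nothing outside the vector fields; the value 0 there makes the
  Levi-Civita connection unique as a HOL function, as required by the description operator.
\<close>

definition levi_civita ::
  "('m::topological_space, 'e::euclidean_space) chart set \<Rightarrow>
   ('m \<Rightarrow> 'm tangent \<Rightarrow> 'm tangent \<Rightarrow> real) \<Rightarrow> 'm vfield \<Rightarrow> 'm vfield \<Rightarrow> 'm vfield" where
  "levi_civita A g = (THE D. levi_civita_connection A g D \<and>
     (\<forall>X Y. X \<notin> vector_fields A \<or> Y \<notin> vector_fields A \<longrightarrow> D X Y = 0))"

definition curvature ::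
  "('m::topological_space, 'e::euclidean_space) chart set \<Rightarrow>
   ('m \<Rightarrow> 'm tangent \<Rightarrow> 'm tangent \<Rightarrow> real) \<Rightarrow> 'm vfield \<Rightarrow> 'm vfield \<Rightarrow> 'm vfield \<Rightarrow> 'm vfield"
where
  "curvature A g X Y Z =
     (let D = levi_civita A g in D X (D Y Z) - D Y (D X Z) - D (lie_bracket X Y) Z)"

text \<open>
  \<^const>\<open>curvature\<close> is tensorial, so its value at \<open>p\<close> is computed from arbitrary vector fields extending
  the given tangent vectors.
\<close>

definition extension ::
  "('m::topological_space, 'e::euclidean_space) chart set \<Rightarrow> 'm \<Rightarrow> 'm tangent \<Rightarrow> 'm vfield" where
  "extension A p u = (SOME X. X \<in> vector_fields A \<and> value_at X p = u)"

definition curvature_at ::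
  "('m::topological_space, 'e::euclidean_space) chart set \<Rightarrow>
   ('m \<Rightarrow> 'm tangent \<Rightarrow> 'm tangent \<Rightarrow> real) \<Rightarrow>
   'm \<Rightarrow> 'm tangent \<Rightarrow> 'm tangent \<Rightarrow> 'm tangent \<Rightarrow> 'm tangent" where
  "curvature_at A g p u v w =
     value_at (curvature A g (extension A p u) (extension A p v) (extension A p w)) p"

text \<open>The tangent plane at \<open>p\<close> spanned by \<open>u\<close> and \<open>v\<close> enters through this basis.\<close>

definition plane_basis ::
  "('m::topological_space, 'e::euclidean_space) chart set \<Rightarrow> 'm \<Rightarrow> 'm tangent \<Rightarrow> 'm tangent \<Rightarrow> bool"
where
  "plane_basis A p u v \<longleftrightarrow>
     u \<in> tangent_space A p \<and> v \<in> tangent_space A p \<and> u \<noteq> v \<and> independent {u, v}"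

definition sectional_curvature ::
  "('m::topological_space, 'e::euclidean_space) chart set \<Rightarrow>
   ('m \<Rightarrow> 'm tangent \<Rightarrow> 'm tangent \<Rightarrow> real) \<Rightarrow> 'm \<Rightarrow> 'm tangent \<Rightarrow> 'm tangent \<Rightarrow> real" where
  "sectional_curvature A g p u v =
     g p (curvature_at A g p u v v) u / (g p u u * g p v v - (g p u v)\<^sup>2)"

text \<open>
  The trace of a linear endomorphism \<open>L\<close> of a finite-dimensional subspace \<open>V\<close>: the sum of the
  diagonal matrix coefficients in any basis of \<open>V\<close>.
\<close>

definition trace_on :: "'a::real_vector set \<Rightarrow> ('a \<Rightarrow> 'a) \<Rightarrow> real" where
  "trace_on V L =
     (let B = (SOME B. independent B \<and> span B = V) in \<Sum>b\<in>B. representation B (L b) b)"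

definition ricci_curvature ::
  "('m::topological_space, 'e::euclidean_space) chart set \<Rightarrow>
   ('m \<Rightarrow> 'm tangent \<Rightarrow> 'm tangent \<Rightarrow> real) \<Rightarrow> 'm \<Rightarrow> 'm tangent \<Rightarrow> 'm tangent \<Rightarrow> real" where
  "ricci_curvature A g p v w = trace_on (tangent_space A p) (\<lambda>u. curvature_at A g p u v w)"

definition orthonormal_basis ::
  "('m::topological_space, 'e::euclidean_space) chart set \<Rightarrow>
   ('m \<Rightarrow> 'm tangent \<Rightarrow> 'm tangent \<Rightarrow> real) \<Rightarrow> 'm \<Rightarrow> 'm tangent set \<Rightarrow> bool" where
  "orthonormal_basis A g p B \<longleftrightarrow>
     span B = tangent_space A p \<and> (\<forall>u\<in>B. \<forall>v\<in>B. g p u v = (if u = v then 1 else 0))"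

definition scalar_curvature ::
  "('m::topological_space, 'e::euclidean_space) chart set \<Rightarrow>
   ('m \<Rightarrow> 'm tangent \<Rightarrow> 'm tangent \<Rightarrow> real) \<Rightarrow> 'm \<Rightarrow> real" where
  "scalar_curvature A g p =
     (let B = (SOME B. orthonormal_basis A g p B) in \<Sum>e\<in>B. ricci_curvature A g p e e)"


section \<open>Metric Lie groups\<close>

text \<open>The group is carried by the whole topological type, on which \<open>A\<close> is the smooth structure.\<close>

definition lie_group ::
  "('g::{t2_space, second_countable_topology}) monoid \<Rightarrow> ('g, 'e::euclidean_space) chart set \<Rightarrow> bool"
where
  "lie_group G A \<longleftrightarrow>
     group G \<and> carrier G = UNIV \<and> smooth_atlas A \<and>
     smooth_map (product_atlas A A) A (\<lambda>(x, y). x \<otimes>\<^bsub>G\<^esub> y) \<and>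
     smooth_map A A (\<lambda>x. inv\<^bsub>G\<^esub> x)"

definition lie_algebra ::
  "('g::topological_space) monoid \<Rightarrow> ('g, 'e::euclidean_space) chart set \<Rightarrow> 'g vfield set" where
  "lie_algebra G A = {X \<in> vector_fields A.
     \<forall>a p. value_at X (a \<otimes>\<^bsub>G\<^esub> p) = pushforward A (\<lambda>x. a \<otimes>\<^bsub>G\<^esub> x) (value_at X p)}"

definition left_invariant_metric ::
  "('g::topological_space) monoid \<Rightarrow> ('g, 'e::euclidean_space) chart set \<Rightarrow>
   ('g \<Rightarrow> 'g tangent \<Rightarrow> 'g tangent \<Rightarrow> real) \<Rightarrow> bool" where
  "left_invariant_metric G A g \<longleftrightarrow>
     (\<forall>a p. \<forall>u\<in>tangent_space A p. \<forall>v\<in>tangent_space A p.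
        g (a \<otimes>\<^bsub>G\<^esub> p) (pushforward A (\<lambda>x. a \<otimes>\<^bsub>G\<^esub> x) u) (pushforward A (\<lambda>x. a \<otimes>\<^bsub>G\<^esub> x) v)
        = g p u v)"

definition metric_lie_group ::
  "('g::{t2_space, second_countable_topology}) monoid \<Rightarrow> ('g, 'e::euclidean_space) chart set \<Rightarrow>
   ('g \<Rightarrow> 'g tangent \<Rightarrow> 'g tangent \<Rightarrow> real) \<Rightarrow> bool" where
  "metric_lie_group G A g \<longleftrightarrow>
     lie_group G A \<and> riemannian_metric A g \<and> left_invariant_metric G A g"

definition lie_inner ::
  "('g::topological_space) monoid \<Rightarrow> ('g \<Rightarrow> 'g tangent \<Rightarrow> 'g tangent \<Rightarrow> real) \<Rightarrow>
   'g vfield \<Rightarrow> 'g vfield \<Rightarrow> real" where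
  "lie_inner G g X Y = g \<one>\<^bsub>G\<^esub> (value_at X \<one>\<^bsub>G\<^esub>) (value_at Y \<one>\<^bsub>G\<^esub>)"

definition cyclic_metric ::
  "('g::topological_space) monoid \<Rightarrow> ('g, 'e::euclidean_space) chart set \<Rightarrow>
   ('g \<Rightarrow> 'g tangent \<Rightarrow> 'g tangent \<Rightarrow> real) \<Rightarrow> bool" where
  "cyclic_metric G A g \<longleftrightarrow>
     (\<forall>X\<in>lie_algebra G A. \<forall>Y\<in>lie_algebra G A. \<forall>Z\<in>lie_algebra G A.
        lie_inner G g (lie_bracket X Y) Z + lie_inner G g (lie_bracket Y Z) X
        + lie_inner G g (lie_bracket Z X) Y = 0)"

text \<open>
  For connected \<open>G\<close>, unimodularity (bi-invariance of the Haar measure) is the vanishing of all traces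
  \<open>tr ad\<^sub>X\<close>. Haar measure is not available in the library, and this is the form used here; it is
  meant for connected groups only.
\<close>

definition unimodular ::
  "('g::topological_space) monoid \<Rightarrow> ('g, 'e::euclidean_space) chart set \<Rightarrow> bool" where
  "unimodular G A \<longleftrightarrow> (\<forall>X\<in>lie_algebra G A. trace_on (lie_algebra G A) (lie_bracket X) = 0)"

end

theory Submission
  imports Defs
begin

text \<open>
  Fix a basis \<open>e\<^sub>i\<close> of the Lie algebra, orthonormal for the given inner product, and let
  \<open>c\<^sub>i\<^sub>j\<^sub>k = \<langle>[e\<^sub>i, e\<^sub>j], e\<^sub>k\<rangle>\<close>. The cyclic condition collapses the Koszul formula to
  \<open>\<langle>\<nabla>\<^sub>X Y, Z\<rangle> = \<langle>[Z, Y], X\<rangle>\<close>, so the curvature tensor is an explicit quadratic expression in \<open>c\<close>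
  (\<open>cyclic_structure_constants.R\<close>, \<open>coef_curvature\<close>), and the theorem becomes algebra in \<open>c\<close>.

  Negative curvature. Write \<open>|c|\<^sup>2\<close> for the sum of the squares of the structure constants and \<open>H\<close> for
  the vector with \<open>\<langle>H, X\<rangle> = tr ad\<^sub>X\<close>. The scalar curvature is \<open>- |c|\<^sup>2 / 2 - |H|\<^sup>2\<close>
  (\<open>scalar_curvature_sum\<close>), hence negative as soon as the bracket does not vanish. It is the sum of
  the sectional curvatures of the coordinate planes, so at least one of them is negative.

  Positive curvature in the unimodular case (\<open>nonpositive_curvature_imp_abelian\<close>). Here \<open>H = 0\<close> and
  the Ricci form is \<open>- B\<close>, where \<open>B\<close> is the Killing form, and \<open>tr B = |c|\<^sup>2 / 2\<close>. Suppose that no plane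
  has positive curvature. Then \<open>B\<close> is positive semidefinite. The trilinear form \<open>B([X, Y], Z)\<close> is
  invariant under cyclic rotation; pairing it with the cyclic identity for \<open>c\<close> gives
  \<open>\<Sum>\<^sub>i\<^sub>j B([e\<^sub>i, e\<^sub>j], [e\<^sub>i, e\<^sub>j]) = 0\<close>, so the derived algebra lies in the kernel of \<open>B\<close>. A vector \<open>N\<close>
  of the derived algebra therefore has zero Ricci curvature, and since no plane is positively
  curved every plane containing \<open>N\<close> is flat. But for \<open>X\<close> orthogonal to the derived algebra the
  plane of \<open>X\<close> and \<open>N\<close>, for unit vectors, has curvature \<open>- |[X, N]|\<^sup>2\<close>. It follows that \<open>X\<close> is central, that \<open>B = 0\<close>,
  and that \<open>|c|\<^sup>2 = 2 tr B = 0\<close>.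

  It remains to see that the bracket of a connected nonabelian group does not vanish
  (\<open>zero_bracket_imp_commutative\<close>). Left and right invariant fields always commute
  (\<open>left_right_commute\<close>), so if the bracket vanishes then the components of a right invariant field
  in a left invariant frame are constant, and left and right invariant fields coincide. For fixed
  \<open>a\<close> the two maps \<open>p \<mapsto> p a\<close> and \<open>p \<mapsto> a p\<close> then satisfy the same first order differential equation.
  They agree at the unit, hence, by a Gronwall estimate, on a set that is open and closed.

  The geometric facts behind this are developed from the definition of tangent vectors as
  derivations: every derivation is a directional derivative in a chart (\<open>tangent_eq_chart_tangent\<close>),
  a left invariant frame trivialises the tangent bundle, and in such a frame the Levi-Civita
  connection can be written down (\<open>nabla_levi_civita\<close>) and is unique (\<open>levi_civita_unique\<close>).
\<close>

section \<open>Calculus of smooth maps\<close>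

lemma k_smooth_on_subset:
  "k_smooth_on k S f \<Longrightarrow> T \<subseteq> S \<Longrightarrow> k_smooth_on k T f"
  by (induction k arbitrary: f) (auto intro: continuous_on_subset)

lemma k_smooth_on_SucD: "k_smooth_on (Suc k) S f \<Longrightarrow> k_smooth_on k S f"
proof (induction k arbitrary: f)
  case 0
  then show ?case
    by (simp add: continuous_at_imp_continuous_on differentiable_imp_continuous_within)
next
  case (Suc k)
  then show ?case by (metis k_smooth_on.simps(2))
qed

lemma k_smooth_on_continuous_on: "k_smooth_on k S f \<Longrightarrow> continuous_on S f"
proof (induction k)
  case (Suc k)
  then show ?case using k_smooth_on_SucD by blast
qed simp

lemma k_smooth_on_cong:
  assumes "open S" "\<And>x. x \<in> S \<Longrightarrow> f x = g x" "k_smooth_on k S f"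
  shows "k_smooth_on k S g"
  using assms
proof (induction k arbitrary: f g)
  case 0
  then show ?case by (metis continuous_on_cong k_smooth_on.simps(1))
next
  case (Suc k)
  have d: "f differentiable (at x)" if "x \<in> S" for x
    using Suc.prems that by auto
  have 1: "g differentiable (at x)" if "x \<in> S" for x
    using d[OF that] Suc.prems(1,2) that unfolding differentiable_def
    by (metis has_derivative_transform_within_open)
  have 2: "frechet_derivative f (at x) = frechet_derivative g (at x)" if "x \<in> S" for x
    by (rule frechet_derivative_transform_within_open[OF d[OF that] Suc.prems(1) that Suc.prems(2)])
  have "k_smooth_on k S (\<lambda>x. frechet_derivative g (at x) v)" for v
    by (rule Suc.IH[OF Suc.prems(1), where f = "\<lambda>x. frechet_derivative f (at x) v"])
       (use 2 Suc.prems(3) in auto)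
  with 1 show ?case by simp
qed

text \<open>
  Replaces the chosen \<open>frechet_derivative\<close> by any explicit formula for the derivative; all closure
  properties below go through this rule.
\<close>

lemma k_smooth_on_SucI:
  assumes "open S" "\<And>x. x \<in> S \<Longrightarrow> (f has_derivative f' x) (at x)"
    and "\<And>v. k_smooth_on k S (\<lambda>x. f' x v)"
  shows "k_smooth_on (Suc k) S f"
proof -
  have "k_smooth_on k S (\<lambda>x. frechet_derivative f (at x) v)" for v
    by (rule k_smooth_on_cong[OF assms(1) _ assms(3)[of v]])
       (metis assms(2) frechet_derivative_at)
  then show ?thesis using assms(2) by (auto simp: differentiable_def)
qed

lemma k_smooth_on_has_derivative:
  assumes "k_smooth_on (Suc k) S f" "x \<in> S"
  shows "(f has_derivative frechet_derivative f (at x)) (at x)"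
  using assms frechet_derivative_works by auto

lemma k_smooth_on_local:
  assumes "open S" "\<And>x. x \<in> S \<Longrightarrow> \<exists>T. open T \<and> x \<in> T \<and> k_smooth_on k (S \<inter> T) f"
  shows "k_smooth_on k S f"
  using assms(2)
proof (induction k arbitrary: f)
  case 0
  have "continuous (at x) f" if x: "x \<in> S" for x
  proof -
    obtain T where T: "open T" "x \<in> T" "continuous_on (S \<inter> T) f" using 0[OF x] by auto
    then show ?thesis using assms(1) x by (meson IntI continuous_on_eq_continuous_at open_Int)
  qed
  then show ?case by (simp add: continuous_at_imp_continuous_on)
next
  case (Suc k)
  have "k_smooth_on k S (\<lambda>x. frechet_derivative f (at x) v)" for v
    by (rule Suc.IH) (metis Suc.prems k_smooth_on.simps(2))
  moreover have "f differentiable (at x)" if "x \<in> S" for x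
    using Suc.prems[OF that] that by auto
  ultimately show ?case by simp
qed

lemma k_smooth_on_const: "k_smooth_on k S (\<lambda>x. c)"
  by (induction k arbitrary: c) auto

lemma k_smooth_on_add:
  assumes "open S" "k_smooth_on k S f" "k_smooth_on k S g"
  shows "k_smooth_on k S (\<lambda>x. f x + g x)"
  using assms(2,3)
proof (induction k arbitrary: f g)
  case 0 then show ?case by (simp add: continuous_on_add)
next
  case (Suc k)
  show ?case
    by (rule k_smooth_on_SucI[OF assms(1) has_derivative_add[OF k_smooth_on_has_derivative[OF Suc.prems(1)]
          k_smooth_on_has_derivative[OF Suc.prems(2)]]])
       (use Suc in auto)
qed

lemma k_smooth_on_bilinear:
  assumes B: "bounded_bilinear B" and S: "open S"
    and "k_smooth_on k S f" "k_smooth_on k S g"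
  shows "k_smooth_on k S (\<lambda>x. B (f x) (g x))"
  using assms(3,4)
proof (induction k arbitrary: f g)
  case 0 then show ?case by (simp add: bounded_bilinear.continuous_on[OF B])
next
  case (Suc k)
  have f: "k_smooth_on k S f" and g: "k_smooth_on k S g"
    using Suc.prems k_smooth_on_SucD by blast+
  show ?case
  proof (rule k_smooth_on_SucI[OF S bounded_bilinear.FDERIV[OF B k_smooth_on_has_derivative[OF Suc.prems(1)]
          k_smooth_on_has_derivative[OF Suc.prems(2)]]])
    fix v
    show "k_smooth_on k S (\<lambda>x. B (f x) (frechet_derivative g (at x) v)
            + B (frechet_derivative f (at x) v) (g x))"
      by (rule k_smooth_on_add[OF S Suc.IH[OF f] Suc.IH[OF _ g]]) (use Suc.prems in auto)
  qed
qed

lemma k_smooth_on_linear: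
  assumes "bounded_linear L" "open S" "k_smooth_on k S f"
  shows "k_smooth_on k S (\<lambda>x. L (f x))"
  using assms(3)
proof (induction k arbitrary: f)
  case 0 then show ?case by (simp add: bounded_linear.continuous_on[OF assms(1)])
next
  case (Suc k)
  show ?case
    by (rule k_smooth_on_SucI[OF assms(2) bounded_linear.has_derivative[OF assms(1)
          k_smooth_on_has_derivative[OF Suc.prems]]]) (use Suc in auto)
qed

lemma k_smooth_on_ident: "open S \<Longrightarrow> k_smooth_on k S (\<lambda>x. x)"
  by (cases k) (auto simp: k_smooth_on_const)

lemma k_smooth_on_sum:
  assumes "open S" "finite I" "\<And>i. i \<in> I \<Longrightarrow> k_smooth_on k S (f i)"
  shows "k_smooth_on k S (\<lambda>x. \<Sum>i\<in>I. f i x)"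
  using assms(2,3)
  by (induction I) (auto simp: k_smooth_on_const intro!: k_smooth_on_add[OF assms(1)])

text \<open>
  The second order chain rule involves the derivative of \<open>g\<close> in a direction that varies with the point.
  Expanding that direction in a basis turns it into finitely many fixed directions, to which the
  induction hypothesis applies.
\<close>

lemma k_smooth_on_compose:
  fixes f :: "'a::real_normed_vector \<Rightarrow> 'b::euclidean_space" and g :: "'b \<Rightarrow> 'c::real_normed_vector"
  assumes S: "open S" and T: "open T" and fS: "f ` S \<subseteq> T"
    and "k_smooth_on k S f" "k_smooth_on k T g"
  shows "k_smooth_on k S (\<lambda>x. g (f x))"
  using assms(4,5)
proof (induction k arbitrary: g)
  case 0 then show ?case using fS by (auto intro: continuous_on_compose2)
next
  case (Suc k)
  let ?Df = "\<lambda>x. frechet_derivative f (at x)" and ?Dg = "\<lambda>y. frechet_derivative g (at y)"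
  show ?case
  proof (rule k_smooth_on_SucI[OF S])
    fix x assume x: "x \<in> S"
    have gd: "(g has_derivative ?Dg (f x)) (at (f x))"
      using k_smooth_on_has_derivative[OF Suc.prems(2)] x fS by auto
    have "((\<lambda>x. g (f x)) has_derivative (\<lambda>v. ?Dg (f x) (?Df x v))) (at x)"
      using diff_chain_at[OF k_smooth_on_has_derivative[OF Suc.prems(1) x] gd] by (simp add: o_def)
    moreover have "?Dg (f x) w = (\<Sum>i\<in>Basis. (w \<bullet> i) *\<^sub>R ?Dg (f x) i)" for w
    proof -
      have l: "linear (?Dg (f x))" using gd by (rule has_derivative_linear)
      have "?Dg (f x) w = ?Dg (f x) (\<Sum>i\<in>Basis. (w \<bullet> i) *\<^sub>R i)" by (simp add: euclidean_representation)
      also have "\<dots> = (\<Sum>i\<in>Basis. (w \<bullet> i) *\<^sub>R ?Dg (f x) i)"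
        by (simp add: linear_sum[OF l] linear_scale[OF l])
      finally show ?thesis .
    qed
    ultimately show "((\<lambda>x. g (f x)) has_derivative
        (\<lambda>v. \<Sum>i\<in>Basis. (?Df x v \<bullet> i) *\<^sub>R ?Dg (f x) i)) (at x)"
      by (rule has_derivative_eq_rhs[OF _ ext])
  next
    fix v
    show "k_smooth_on k S (\<lambda>x. \<Sum>i\<in>Basis. (?Df x v \<bullet> i) *\<^sub>R ?Dg (f x) i)"
    proof (rule k_smooth_on_sum[OF S finite_Basis], rule k_smooth_on_bilinear[OF bounded_bilinear_scaleR S])
      fix i :: 'b
      show "k_smooth_on k S (\<lambda>x. ?Df x v \<bullet> i)"
        by (rule k_smooth_on_linear[OF bounded_linear_inner_left S]) (use Suc.prems in auto)
      show "k_smooth_on k S (\<lambda>x. ?Dg (f x) i)"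
        by (rule Suc.IH) (use Suc.prems k_smooth_on_SucD in auto)
    qed
  qed
qed

lemma smooth_onI: "(\<And>k. k_smooth_on k S f) \<Longrightarrow> smooth_on S f"
  and smooth_onD: "smooth_on S f \<Longrightarrow> k_smooth_on k S f"
  by (auto simp: smooth_on_def)

lemma smooth_on_subset: "smooth_on S f \<Longrightarrow> T \<subseteq> S \<Longrightarrow> smooth_on T f"
  unfolding smooth_on_def using k_smooth_on_subset by blast

lemma smooth_on_cong: "open S \<Longrightarrow> (\<And>x. x \<in> S \<Longrightarrow> f x = g x) \<Longrightarrow> smooth_on S f \<Longrightarrow> smooth_on S g"
  unfolding smooth_on_def using k_smooth_on_cong by blast

lemma smooth_on_local:
  assumes "open S" "\<And>x. x \<in> S \<Longrightarrow> \<exists>T. open T \<and> x \<in> T \<and> smooth_on (S \<inter> T) f"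
  shows "smooth_on S f"
  by (rule smooth_onI, rule k_smooth_on_local[OF assms(1)]) (use assms(2) smooth_onD in blast)

lemma smooth_on_const [simp]: "smooth_on S (\<lambda>x. c)"
  by (simp add: smooth_on_def k_smooth_on_const)

lemma smooth_on_ident: "open S \<Longrightarrow> smooth_on S (\<lambda>x. x)"
  by (simp add: smooth_on_def k_smooth_on_ident)

lemma smooth_on_add: "open S \<Longrightarrow> smooth_on S f \<Longrightarrow> smooth_on S g \<Longrightarrow> smooth_on S (\<lambda>x. f x + g x)"
  unfolding smooth_on_def by (intro allI k_smooth_on_add) auto

lemma smooth_on_bilinear:
  "bounded_bilinear B \<Longrightarrow> open S \<Longrightarrow> smooth_on S f \<Longrightarrow> smooth_on S g \<Longrightarrow> smooth_on S (\<lambda>x. B (f x) (g x))"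
  unfolding smooth_on_def by (rule allI, rule k_smooth_on_bilinear) auto

lemmas smooth_on_scaleR = smooth_on_bilinear[OF bounded_bilinear_scaleR]
  and smooth_on_mult = smooth_on_bilinear[OF bounded_bilinear_mult]
  and smooth_on_inner = smooth_on_bilinear[OF bounded_bilinear_inner]

lemma smooth_on_linear:
  "bounded_linear L \<Longrightarrow> open S \<Longrightarrow> smooth_on S f \<Longrightarrow> smooth_on S (\<lambda>x. L (f x))"
  unfolding smooth_on_def by (rule allI, rule k_smooth_on_linear) auto

lemma smooth_on_uminus:
  assumes "open S" "smooth_on S f"
  shows "smooth_on S (\<lambda>x. - f x)"
  by (rule smooth_on_linear[OF bounded_linear_minus[OF bounded_linear_ident] assms])

lemma smooth_on_diff:
  assumes "open S" "smooth_on S f" "smooth_on S g"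
  shows "smooth_on S (\<lambda>x. f x - g x)"
  unfolding diff_conv_add_uminus
  by (rule smooth_on_add[OF assms(1,2) smooth_on_uminus[OF assms(1,3)]])

lemma smooth_on_Pair:
  assumes "open S" "smooth_on S f" "smooth_on S g"
  shows "smooth_on S (\<lambda>x. (f x, g x))"
proof -
  have 1: "bounded_linear (\<lambda>a. (a, 0))" 
    by (rule bounded_linear_Pair[OF bounded_linear_ident bounded_linear_zero])
  have 2: "bounded_linear (\<lambda>b. (0, b))"
    by (rule bounded_linear_Pair[OF bounded_linear_zero bounded_linear_ident])
  have "smooth_on S (\<lambda>x. (f x, 0) + (0, g x))"
    by (rule smooth_on_add[OF assms(1) smooth_on_linear[OF 1 assms(1,2)] smooth_on_linear[OF 2 assms(1,3)]])
  then show ?thesis by simp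
qed

lemma smooth_on_fst: "open S \<Longrightarrow> smooth_on S fst"
  by (rule smooth_on_linear[OF bounded_linear_fst _ smooth_on_ident])

lemma smooth_on_snd: "open S \<Longrightarrow> smooth_on S snd"
  by (rule smooth_on_linear[OF bounded_linear_snd _ smooth_on_ident])

lemma smooth_on_compose:
  fixes f :: "'a::real_normed_vector \<Rightarrow> 'b::euclidean_space" and g :: "'b \<Rightarrow> 'c::real_normed_vector"
  assumes "open S" "open T" "smooth_on S f" "smooth_on T g" "f ` S \<subseteq> T"
  shows "smooth_on S (\<lambda>x. g (f x))"
  by (rule smooth_onI, rule k_smooth_on_compose[OF assms(1,2,5)]) (rule smooth_onD[OF assms(3)] smooth_onD[OF assms(4)])+

lemma smooth_on_has_derivative:
  "smooth_on S f \<Longrightarrow> x \<in> S \<Longrightarrow> (f has_derivative frechet_derivative f (at x)) (at x)"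
  by (rule k_smooth_on_has_derivative[OF smooth_onD])

lemma smooth_on_differentiable: "smooth_on S f \<Longrightarrow> x \<in> S \<Longrightarrow> f differentiable (at x)"
  by (rule differentiableI[OF smooth_on_has_derivative])

lemma smooth_on_frechet_derivative:
  "smooth_on S f \<Longrightarrow> smooth_on S (\<lambda>x. frechet_derivative f (at x) v)"
  by (rule smooth_onI, drule_tac k = "Suc k" in smooth_onD) simp

lemma smooth_on_continuous_on: "smooth_on S f \<Longrightarrow> continuous_on S f"
  using smooth_onD[of S f 0] by simp

lemma frechet_derivative_expand:
  fixes f :: "'a::euclidean_space \<Rightarrow> 'b::real_normed_vector"
  assumes "f differentiable (at x)"
  shows "frechet_derivative f (at x) w = (\<Sum>i\<in>Basis. (w \<bullet> i) *\<^sub>R frechet_derivative f (at x) i)"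
proof -
  have l: "linear (frechet_derivative f (at x))" by (rule linear_frechet_derivative[OF assms])
  have "frechet_derivative f (at x) w = frechet_derivative f (at x) (\<Sum>i\<in>Basis. (w \<bullet> i) *\<^sub>R i)"
    by (simp add: euclidean_representation)
  also have "\<dots> = (\<Sum>i\<in>Basis. (w \<bullet> i) *\<^sub>R frechet_derivative f (at x) i)"
    by (simp add: linear_sum[OF l] linear_scale[OF l])
  finally show ?thesis .
qed

section \<open>Parameter integrals and the Hadamard factorization\<close>

text \<open>
  Differentiation under the integral sign. Here pointwise continuity of the directional derivatives has to
  be turned into continuity of the derivative as a bounded linear map, component by component.
\<close>

lemma k_smooth_on_integral:
  fixes F :: "'a::euclidean_space \<times> real \<Rightarrow> real"
  assumes "open U" "U \<times> {0..1} \<subseteq> W" "k_smooth_on k W F"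
  shows "k_smooth_on k U (\<lambda>x. integral {0..1} (\<lambda>t. F (x, t)))"
  using assms(3)
proof (induction k arbitrary: F)
  case 0
  then have "continuous_on (U \<times> cbox 0 1) (\<lambda>(x, t). F (x, t))"
    using assms(2) by (auto intro: continuous_on_subset)
  from integral_continuous_on_param[OF this] show ?case by simp
next
  case (Suc k)
  let ?D = "\<lambda>z. frechet_derivative F (at z)"
  show ?case
  proof (rule k_smooth_on_SucI[OF assms(1)])
    fix x assume x: "x \<in> U"
    then obtain r where r: "r > 0" "ball x r \<subseteq> U" using assms(1) openE by blast
    define fx where "fx = (\<lambda>x t. Blinfun (\<lambda>v. ?D (x, t) (v, 0)))"
    have hd: "(F has_derivative ?D (y, t)) (at (y, t))" if "y \<in> U" "t \<in> {0..1}" for y t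
      by (rule k_smooth_on_has_derivative[OF Suc.prems]) (use assms(2) that in auto)
    have hd1: "((\<lambda>y. F (y, t)) has_derivative (\<lambda>v. ?D (y, t) (v, 0))) (at y)"
      if "y \<in> U" "t \<in> {0..1}" for y t
    proof -
      have "((\<lambda>y. (y, t)) has_derivative (\<lambda>v. (v, 0))) (at y)"
        by (auto intro!: derivative_eq_intros)
      from diff_chain_at[OF this hd[OF that]] show ?thesis by (simp add: o_def)
    qed
    have ap: "blinfun_apply (fx y t) = (\<lambda>v. ?D (y, t) (v, 0))" if "y \<in> U" "t \<in> {0..1}" for y t
      unfolding fx_def
      by (rule bounded_linear_Blinfun_apply) (rule has_derivative_bounded_linear[OF hd1[OF that]])
    have cF: "continuous_on W F" by (rule k_smooth_on_continuous_on[OF Suc.prems])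
    have cD: "continuous_on W (\<lambda>z. ?D z v)" for v
      by (rule k_smooth_on_continuous_on[of k]) (use Suc.prems in \<open>unfold k_smooth_on.simps, blast\<close>)
    have "((\<lambda>x. integral (cbox 0 1) (\<lambda>t. F (x, t))) has_derivative
            blinfun_apply (integral (cbox 0 1) (fx x))) (at x within ball x r)"
    proof (rule leibniz_rule)
      fix y t assume y: "y \<in> ball x r" and t: "t \<in> cbox 0 (1::real)"
      with r have "y \<in> U" "t \<in> {0..1}" by auto
      then show "((\<lambda>x. F (x, t)) has_derivative blinfun_apply (fx y t)) (at y within ball x r)"
        using ap[of y t] hd1[of y t] by (simp add: has_derivative_at_withinI)
    next
      fix y assume y: "y \<in> ball x r"
      have "continuous_on (cbox 0 1) (\<lambda>t. F (y, t))"
        by (rule continuous_on_compose2[OF cF]) (use y r assms(2) in \<open>auto intro!: continuous_intros\<close>)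
      then show "(\<lambda>t. F (y, t)) integrable_on cbox 0 1" by (rule integrable_continuous)
    next
      show "continuous_on (ball x r \<times> cbox 0 1) (\<lambda>(x, t). fx x t)"
      proof (rule continuous_on_blinfun_componentwise)
        fix i :: 'a
        have "continuous_on (ball x r \<times> cbox 0 1) (\<lambda>z. ?D z (i, 0))"
          by (rule continuous_on_subset[OF cD]) (use r assms(2) in auto)
        then show "continuous_on (ball x r \<times> cbox 0 1) (\<lambda>z. blinfun_apply (case z of (x, t) \<Rightarrow> fx x t) i)"
          by (rule continuous_on_eq) (use r ap in auto)
      qed
    qed (use r in auto)
    then have d: "((\<lambda>x. integral {0..1} (\<lambda>t. F (x, t))) has_derivative
            blinfun_apply (integral (cbox 0 1) (fx x))) (at x)"
      using r(1) by (simp add: at_within_open[of x "ball x r"])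
    have int: "fx x integrable_on cbox 0 1"
    proof (rule integrable_continuous, rule continuous_on_blinfun_componentwise)
      fix i :: 'a
      have "continuous_on (cbox 0 1) (\<lambda>t. ?D (x, t) (i, 0))"
        by (rule continuous_on_compose2[OF cD]) (use x assms(2) in \<open>auto intro!: continuous_intros\<close>)
      then show "continuous_on (cbox 0 1) (\<lambda>t. blinfun_apply (fx x t) i)"
        by (rule continuous_on_eq) (use x ap in auto)
    qed
    have "blinfun_apply (integral (cbox 0 1) (fx x)) v = integral {0..1} (\<lambda>t. ?D (x, t) (v, 0))" for v
    proof -
      have "blinfun_apply (integral (cbox 0 1) (fx x)) v = integral (cbox 0 1) (\<lambda>t. blinfun_apply (fx x t) v)"
        by (rule blinfun_apply_integral[OF int])
      also have "\<dots> = integral {0..1} (\<lambda>t. ?D (x, t) (v, 0))"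
        by (simp, rule integral_cong) (use x ap in auto)
      finally show ?thesis .
    qed
    then show "((\<lambda>x. integral {0..1} (\<lambda>t. F (x, t))) has_derivative
            (\<lambda>v. integral {0..1} (\<lambda>t. ?D (x, t) (v, 0)))) (at x)"
      by (intro has_derivative_eq_rhs[OF d] ext)
  next
    fix v
    show "k_smooth_on k U (\<lambda>x. integral {0..1} (\<lambda>t. ?D (x, t) (v, 0)))"
      by (rule Suc.IH) (use Suc.prems in auto)
  qed
qed

text \<open>
  Integrate the derivative of \<open>f\<close> along the segment from \<open>x0\<close> to \<open>x\<close>. The factors \<open>h i\<close> are smooth
  because they are parameter integrals; this is what makes every derivation at \<open>x0\<close> a directional
  derivative.
\<close>

lemma hadamard_factorization:
  fixes f :: "'a::euclidean_space \<Rightarrow> real"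
  assumes f: "smooth_on (ball x0 r) f" and r: "r > 0"
  obtains h where "\<And>i. smooth_on (ball x0 r) (h i)"
    "\<And>x. x \<in> ball x0 r \<Longrightarrow> f x = f x0 + (\<Sum>i\<in>Basis. ((x - x0) \<bullet> i) * h i x)"
    "\<And>i. h i x0 = frechet_derivative f (at x0) i"
proof
  define D where "D = (\<lambda>x. frechet_derivative f (at x))"
  define P where "P = (\<lambda>(x, t). x0 + t *\<^sub>R (x - x0))"
  define W where "W = P -` ball x0 r"
  define h where "h = (\<lambda>i x. integral {0..1} (\<lambda>t. D (P (x, t)) i))"
  have P: "smooth_on UNIV P"
    unfolding P_def case_prod_beta
    by (intro smooth_on_add smooth_on_scaleR smooth_on_diff smooth_on_fst smooth_on_snd smooth_on_const) auto
  have W: "open W"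
    unfolding W_def using smooth_on_continuous_on[OF P] by (simp add: open_vimage)
  have PB: "P (x, t) \<in> ball x0 r" if "x \<in> ball x0 r" "t \<in> {0..1}" for x t
  proof -
    have "norm (t *\<^sub>R (x - x0)) \<le> norm (x - x0)"
      using that by (simp add: mult_left_le_one_le)
    with that show ?thesis by (auto simp: P_def dist_norm norm_minus_commute)
  qed
  have "smooth_on W (\<lambda>z. D (P z) i)" for i
    using smooth_on_compose[OF W open_ball smooth_on_subset[OF P] smooth_on_frechet_derivative[OF f]]
    by (auto simp: W_def D_def)
  then show "smooth_on (ball x0 r) (h i)" for i
    unfolding h_def
    by (intro smooth_onI k_smooth_on_integral[OF open_ball, of _ _ W]) (use PB in \<open>auto simp: W_def smooth_on_def\<close>)
  show "h i x0 = frechet_derivative f (at x0) i" for i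
    by (simp add: h_def P_def D_def)
  fix x assume x: "x \<in> ball x0 r"
  have cD: "continuous_on (ball x0 r) (\<lambda>z. D z i)" for i
    using smooth_on_continuous_on[OF smooth_on_frechet_derivative[OF f]] by (simp add: D_def)
  have int: "(\<lambda>t. D (P (x, t)) i) integrable_on {0..1}" for i
  proof (rule integrable_continuous_real, rule continuous_on_compose2[OF cD])
    show "continuous_on {0..1} (\<lambda>t. P (x, t))"
      by (auto simp: P_def intro!: continuous_intros)
  qed (use PB x in auto)
  have "((\<lambda>t. D (P (x, t)) (x - x0)) has_integral f (P (x, 1)) - f (P (x, 0))) {0..1}"
  proof (rule fundamental_theorem_of_calculus)
    fix t :: real assume t: "t \<in> {0..1}"
    have 1: "((\<lambda>t. P (x, t)) has_derivative (\<lambda>s. s *\<^sub>R (x - x0))) (at t)"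
      by (auto simp: P_def intro!: derivative_eq_intros)
    have 2: "(f has_derivative D (P (x, t))) (at (P (x, t)))"
      unfolding D_def by (rule smooth_on_has_derivative[OF f PB[OF x t]])
    have "((\<lambda>t. f (P (x, t))) has_derivative (\<lambda>s. s *\<^sub>R D (P (x, t)) (x - x0))) (at t)"
      using diff_chain_at[OF 1 2] linear_scale[OF has_derivative_linear[OF 2]] by (simp add: o_def)
    then show "((\<lambda>t. f (P (x, t))) has_vector_derivative D (P (x, t)) (x - x0)) (at t within {0..1})"
      by (simp add: has_vector_derivative_def has_derivative_at_withinI)
  qed simp
  moreover have "D (P (x, t)) (x - x0) = (\<Sum>i\<in>Basis. ((x - x0) \<bullet> i) * D (P (x, t)) i)"
    if "t \<in> {0..1}" for t
    unfolding D_def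
    by (rule frechet_derivative_expand[OF smooth_on_differentiable[OF f PB[OF x that]], of "x - x0", unfolded real_scaleR_def])
  ultimately have "((\<lambda>t. \<Sum>i\<in>Basis. ((x - x0) \<bullet> i) * D (P (x, t)) i) has_integral
      f (P (x, 1)) - f (P (x, 0))) {0..1}"
    by (rule has_integral_eq[rotated])
  then have "((\<lambda>t. \<Sum>i\<in>Basis. ((x - x0) \<bullet> i) * D (P (x, t)) i) has_integral
      f x - f x0) {0..1}" by (simp add: P_def)
  from has_integral_unique[OF this] have "f x - f x0 = (\<Sum>i\<in>Basis. ((x - x0) \<bullet> i) * h i x)"
    unfolding h_def
    by this (intro has_integral_sum has_integral_mult_right integrable_integral int finite_Basis)
  then show "f x = f x0 + (\<Sum>i\<in>Basis. ((x - x0) \<bullet> i) * h i x)" by simp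
qed

section \<open>Cutoff functions\<close>

text \<open>
  The derivative of a member is a combination of members, so smoothness of \<open>flat 0\<close>, the usual function
  \<open>exp (- 1 / t)\<close> extended by zero, follows by an induction for all members at once.
\<close>

definition flat :: "nat \<Rightarrow> real \<Rightarrow> real" where
  "flat n t = (if t > 0 then exp (- inverse t) * inverse t ^ n else 0)"

lemma inverse_power_has_derivative:
  fixes t :: real
  assumes "t > 0"
  shows "((\<lambda>t. inverse t ^ n) has_real_derivative (- real n) * inverse t ^ Suc n) (at t)"
proof (cases n)
  case (Suc m)
  have "(inverse has_real_derivative - (inverse t ^ Suc (Suc 0))) (at t)"
    using DERIV_inverse[of t UNIV] assms by simp
  from DERIV_power[OF this, of n] show ?thesis using Suc by (simp add: algebra_simps)
qed simp

lemma flat_tendsto_0: "(flat n \<longlongrightarrow> 0) (at 0)"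
proof -
  have "((\<lambda>u::real. u ^ n / exp u) \<longlongrightarrow> 0) at_top" by (rule tendsto_power_div_exp_0)
  then have "((\<lambda>t::real. inverse t ^ n / exp (inverse t)) \<longlongrightarrow> 0) (at_right 0)"
    by (rule filterlim_compose[OF _ filterlim_inverse_at_top_right])
  then have 1: "(flat n \<longlongrightarrow> 0) (at_right 0)"
    by (rule Lim_transform_eventually)
       (auto simp: flat_def eventually_at_right_less exp_minus field_simps intro!: eventually_at_rightI[of 0 1])
  have "(flat n \<longlongrightarrow> 0) (at_left 0)"
    by (rule Lim_transform_eventually[OF tendsto_const[of 0]])
       (auto simp: flat_def intro!: eventually_at_leftI[of "-1"])
  with 1 show ?thesis by (simp add: filterlim_split_at)
qed

lemma flat_has_derivative:
  "(flat n has_real_derivative flat (n + 2) t - n * flat (n + 1) t) (at t)"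
proof -
  consider "t > 0" | "t < 0" | "t = 0" by linarith
  then show ?thesis
  proof cases
    case 1
    have "((\<lambda>t. exp (- inverse t)) has_real_derivative exp (- inverse t) * inverse t ^ 2) (at t)"
      using DERIV_fun_exp[OF DERIV_minus[OF inverse_power_has_derivative[OF 1, of 1]]] by (simp add: power2_eq_square)
    from DERIV_mult[OF this inverse_power_has_derivative[OF 1, of n]]
    have "((\<lambda>t. exp (- inverse t) * inverse t ^ n) has_real_derivative
            flat (n + 2) t - n * flat (n + 1) t) (at t)"
      using 1 by (simp add: flat_def algebra_simps power2_eq_square power_add)
    then show ?thesis
      by (rule has_field_derivative_transform_within_open[of _ _ _ "{0<..}"]) (use 1 in \<open>auto simp: flat_def\<close>)
  next
    case 2
    have "((\<lambda>t. 0) has_real_derivative 0) (at t)" by simp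
    then have "(flat n has_real_derivative 0) (at t)"
      by (rule has_field_derivative_transform_within_open[of _ _ _ "{..<0}"]) (use 2 in \<open>auto simp: flat_def\<close>)
    with 2 show ?thesis by (simp add: flat_def)
  next
    case 3
    have "((\<lambda>h. (flat n h - flat n 0) / h) \<longlongrightarrow> 0) (at 0)"
      by (rule Lim_transform_eventually[OF flat_tendsto_0[of "Suc n"]])
         (auto simp: flat_def eventually_at_filter divide_inverse)
    then show ?thesis using 3 by (simp add: has_field_derivative_iff flat_def)
  qed
qed

lemma smooth_on_flat: "smooth_on UNIV (flat n)"
proof (rule smooth_onI)
  fix k show "k_smooth_on k UNIV (flat n)"
  proof (induction k arbitrary: n)
    case 0
    show ?case
      using flat_has_derivative[THEN DERIV_isCont] by (simp add: continuous_at_imp_continuous_on)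
  next
    case (Suc k)
    show ?case
    proof (rule k_smooth_on_SucI[OF open_UNIV])
      show "(flat n has_derivative (\<lambda>v. (flat (n + 2) t + (- n) * flat (n + 1) t) * v)) (at t)" for t
        using flat_has_derivative[of n t] by (simp add: has_field_derivative_def)
      show "k_smooth_on k UNIV (\<lambda>t. (flat (n + 2) t + (- n) * flat (n + 1) t) * v)" for v
        by (intro k_smooth_on_bilinear[OF bounded_bilinear_mult] k_smooth_on_add k_smooth_on_const Suc.IH open_UNIV)
    qed
  qed
qed

lemma smooth_on_inverse: "smooth_on {0<..} (\<lambda>t::real. inverse t ^ Suc n)"
proof (rule smooth_onI)
  fix k show "k_smooth_on k {0<..} (\<lambda>t::real. inverse t ^ Suc n)"
  proof (induction k arbitrary: n)
    case 0
    show ?case by (auto intro!: continuous_intros)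
  next
    case (Suc k)
    show ?case
    proof (rule k_smooth_on_SucI[OF open_greaterThan])
      fix t :: real assume "t \<in> {0<..}"
      then have "((\<lambda>t::real. inverse t ^ Suc n) has_real_derivative (- real (Suc n)) * inverse t ^ Suc (Suc n)) (at t)"
        by (intro inverse_power_has_derivative) simp
      then show "((\<lambda>t::real. inverse t ^ Suc n) has_derivative
            (\<lambda>v. ((- real (Suc n)) * inverse t ^ Suc (Suc n)) * v)) (at t)"
        by (simp only: has_field_derivative_def)
    next
      show "k_smooth_on k {0<..} (\<lambda>t. ((- real (Suc n)) * inverse t ^ Suc (Suc n)) * v)" for v
        by (intro k_smooth_on_bilinear[OF bounded_bilinear_mult] k_smooth_on_const Suc.IH open_greaterThan)
    qed
  qed
qed

text \<open>
  The quotient \<open>flat 0 a / (flat 0 a + flat 0 b)\<close>, where \<open>a\<close> is positive exactly inside the large ball and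
  \<open>b\<close> is positive only outside the small one.
\<close>

lemma smooth_cutoff:
  fixes x0 :: "'a::euclidean_space"
  assumes "r > 0"
  obtains \<rho> :: "'a \<Rightarrow> real" where "smooth_on UNIV \<rho>" "\<And>x. x \<in> ball x0 (r/2) \<Longrightarrow> \<rho> x = 1"
    "\<And>x. x \<notin> ball x0 r \<Longrightarrow> \<rho> x = 0"
proof
  define a where "a = (\<lambda>x::'a. r\<^sup>2 + (-1) * ((x - x0) \<bullet> (x - x0)))"
  define b where "b = (\<lambda>x::'a. (x - x0) \<bullet> (x - x0) + (- (r\<^sup>2/4)))"
  define \<rho> where "\<rho> = (\<lambda>x. flat 0 (a x) * inverse (flat 0 (a x) + flat 0 (b x)) ^ Suc 0)"
  have pos: "flat 0 (a x) + flat 0 (b x) > 0" for x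
  proof -
    have "a x > 0 \<or> b x > 0"
      unfolding a_def b_def using zero_less_power[OF assms, of 2] by linarith
    then show ?thesis unfolding flat_def by (auto intro: add_pos_nonneg add_nonneg_pos)
  qed
  have ab: "smooth_on UNIV a" "smooth_on UNIV b"
    unfolding a_def b_def
    by (intro smooth_on_add smooth_on_mult smooth_on_inner smooth_on_diff smooth_on_ident smooth_on_const open_UNIV)+
  have fab: "smooth_on UNIV (\<lambda>x. flat 0 (a x))" "smooth_on UNIV (\<lambda>x. flat 0 (b x))"
    using smooth_on_compose[OF open_UNIV open_UNIV ab(1) smooth_on_flat]
          smooth_on_compose[OF open_UNIV open_UNIV ab(2) smooth_on_flat] by auto
  show "smooth_on UNIV \<rho>"
    unfolding \<rho>_def
    by (intro smooth_on_mult[OF open_UNIV fab(1)]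
        smooth_on_compose[OF open_UNIV open_greaterThan smooth_on_add[OF open_UNIV fab] smooth_on_inverse])
       (use pos in auto)
  fix x
  have n: "(x - x0) \<bullet> (x - x0) = (dist x0 x)\<^sup>2" by (simp add: dist_norm norm_minus_commute[of x0] power2_norm_eq_inner)
  show "\<rho> x = 1" if "x \<in> ball x0 (r/2)"
  proof -
    have "(dist x0 x)\<^sup>2 < (r/2)\<^sup>2" using that by (intro power_strict_mono) auto
    then have "b x \<le> 0" by (simp add: b_def n power_divide)
    then have "flat 0 (b x) = 0" by (simp add: flat_def)
    then show ?thesis using pos[of x] by (simp add: \<rho>_def)
  qed
  show "\<rho> x = 0" if "x \<notin> ball x0 r"
  proof -
    have "(dist x0 x)\<^sup>2 \<ge> r\<^sup>2" using that assms by (intro power_mono) auto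
    then have "a x \<le> 0" by (simp add: a_def n)
    then show ?thesis by (simp add: \<rho>_def flat_def)
  qed
qed

section \<open>Symmetry of second derivatives\<close>

text \<open>
  The mean value theorem, applied once in each direction. The left-hand side is symmetric in \<open>a\<close> and
  \<open>b\<close>, which forces the second derivatives to be symmetric in the limit.
\<close>

lemma second_difference_mean_value:
  fixes f :: "'a::real_normed_vector \<Rightarrow> real"
  assumes f: "smooth_on S f" and h: "h > 0"
    and S: "\<And>s t. 0 \<le> s \<Longrightarrow> s \<le> h \<Longrightarrow> 0 \<le> t \<Longrightarrow> t \<le> h \<Longrightarrow> z + s *\<^sub>R a + t *\<^sub>R b \<in> S"
  shows "\<exists>s t. 0 < s \<and> s < h \<and> 0 < t \<and> t < h \<and>
    f (z + h *\<^sub>R a + h *\<^sub>R b) - f (z + h *\<^sub>R a) - f (z + h *\<^sub>R b) + f z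
    = h\<^sup>2 * frechet_derivative (\<lambda>x. frechet_derivative f (at x) a) (at (z + s *\<^sub>R a + t *\<^sub>R b)) b"
proof -
  let ?Da = "\<lambda>x. frechet_derivative f (at x) a"
  have Da: "smooth_on S ?Da" by (rule smooth_on_frechet_derivative[OF f])
  have da: "((\<lambda>s. f (z + s *\<^sub>R a + t *\<^sub>R b)) has_real_derivative ?Da (z + s *\<^sub>R a + t *\<^sub>R b)) (at s)"
    if "0 \<le> s" "s \<le> h" "0 \<le> t" "t \<le> h" for s t
  proof -
    have 1: "((\<lambda>s. z + s *\<^sub>R a + t *\<^sub>R b) has_derivative (\<lambda>r. r *\<^sub>R a)) (at s)"
      by (auto intro!: derivative_eq_intros)
    note 2 = smooth_on_has_derivative[OF f S[OF that]]
    show ?thesis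
      using diff_chain_at[OF 1 2] linear_scale[OF has_derivative_linear[OF 2]]
      by (simp add: o_def has_field_derivative_def mult_commute_abs)
  qed
  have db: "((\<lambda>t. ?Da (z + s *\<^sub>R a + t *\<^sub>R b)) has_real_derivative
      frechet_derivative ?Da (at (z + s *\<^sub>R a + t *\<^sub>R b)) b) (at t)"
    if "0 \<le> s" "s \<le> h" "0 \<le> t" "t \<le> h" for s t
  proof -
    have 1: "((\<lambda>t. z + s *\<^sub>R a + t *\<^sub>R b) has_derivative (\<lambda>r. r *\<^sub>R b)) (at t)"
      by (auto intro!: derivative_eq_intros)
    note 2 = smooth_on_has_derivative[OF Da S[OF that]]
    show ?thesis
      using diff_chain_at[OF 1 2] linear_scale[OF has_derivative_linear[OF 2]]
      by (simp add: o_def has_field_derivative_def mult_commute_abs)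
  qed
  have "\<exists>s. 0 < s \<and> s < h \<and>
      (f (z + h *\<^sub>R a + h *\<^sub>R b) - f (z + h *\<^sub>R a + 0 *\<^sub>R b)) - (f (z + 0 *\<^sub>R a + h *\<^sub>R b) - f (z + 0 *\<^sub>R a + 0 *\<^sub>R b))
      = (h - 0) * (?Da (z + s *\<^sub>R a + h *\<^sub>R b) - ?Da (z + s *\<^sub>R a + 0 *\<^sub>R b))"
    using MVT2[OF h, of "\<lambda>s. f (z + s *\<^sub>R a + h *\<^sub>R b) - f (z + s *\<^sub>R a + 0 *\<^sub>R b)"
        "\<lambda>s. ?Da (z + s *\<^sub>R a + h *\<^sub>R b) - ?Da (z + s *\<^sub>R a + 0 *\<^sub>R b)"]
      DERIV_diff[OF da[of _ h] da[of _ 0]] h by auto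
  then obtain s where s: "0 < s" "s < h" and 1:
    "f (z + h *\<^sub>R a + h *\<^sub>R b) - f (z + h *\<^sub>R a) - f (z + h *\<^sub>R b) + f z
      = h * (?Da (z + s *\<^sub>R a + h *\<^sub>R b) - ?Da (z + s *\<^sub>R a + 0 *\<^sub>R b))"
    by auto
  obtain t where t: "0 < t" "t < h" and 2: "?Da (z + s *\<^sub>R a + h *\<^sub>R b) - ?Da (z + s *\<^sub>R a + 0 *\<^sub>R b)
      = (h - 0) * frechet_derivative ?Da (at (z + s *\<^sub>R a + t *\<^sub>R b)) b"
    using MVT2[OF h, of "\<lambda>t. ?Da (z + s *\<^sub>R a + t *\<^sub>R b)"
        "\<lambda>t. frechet_derivative ?Da (at (z + s *\<^sub>R a + t *\<^sub>R b)) b"] db[of s] s by auto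
  show ?thesis
    using s t 1 unfolding 2 by (intro exI[of _ s] exI[of _ t]) (simp add: power2_eq_square)
qed

lemma symmetric_second_derivative:
  fixes f :: "'a::real_normed_vector \<Rightarrow> real"
  assumes f: "smooth_on S f" and S: "open S" "z \<in> S"
  shows "frechet_derivative (\<lambda>x. frechet_derivative f (at x) a) (at z) b
       = frechet_derivative (\<lambda>x. frechet_derivative f (at x) b) (at z) a"
proof (rule ccontr)
  define P where "P = (\<lambda>x. frechet_derivative (\<lambda>x. frechet_derivative f (at x) a) (at x) b)"
  define Q where "Q = (\<lambda>x. frechet_derivative (\<lambda>x. frechet_derivative f (at x) b) (at x) a)"
  assume "\<not> ?thesis"
  then have e: "\<bar>P z - Q z\<bar> / 2 > 0" by (simp add: P_def Q_def)
  have "continuous_on S (\<lambda>x. P x)" "continuous_on S (\<lambda>x. Q x)"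
    unfolding P_def Q_def
    by (rule smooth_on_continuous_on[OF smooth_on_frechet_derivative[OF smooth_on_frechet_derivative[OF f]]])+
  then have "isCont P z" "isCont Q z" using S continuous_on_eq_continuous_at by blast+
  then obtain d1 d2 where d: "d1 > 0" "d2 > 0"
    and P: "\<And>x. dist x z < d1 \<Longrightarrow> \<bar>P x - P z\<bar> < \<bar>P z - Q z\<bar> / 2"
    and Q: "\<And>x. dist x z < d2 \<Longrightarrow> \<bar>Q x - Q z\<bar> < \<bar>P z - Q z\<bar> / 2"
    using e unfolding continuous_at_eps_delta dist_real_def by metis
  obtain d3 where d3: "d3 > 0" "ball z d3 \<subseteq> S" using S openE by blast
  define d where "d = min d1 (min d2 d3)"
  define h where "h = d / (norm a + norm b + 1)"
  have dh: "d > 0" "h > 0" using d d3 by (auto simp: d_def h_def add_nonneg_pos)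
  have near: "dist (z + s *\<^sub>R a + t *\<^sub>R b) z < d" if "0 \<le> s" "s \<le> h" "0 \<le> t" "t \<le> h" for s t
  proof -
    have "dist (z + s *\<^sub>R a + t *\<^sub>R b) z \<le> s * norm a + t * norm b"
      using norm_triangle_ineq[of "s *\<^sub>R a" "t *\<^sub>R b"] that by (simp add: dist_norm add.assoc)
    also have "\<dots> \<le> h * norm a + h * norm b"
      using that by (intro add_mono mult_right_mono) auto
    also have "\<dots> < h * (norm a + norm b + 1)" using dh by (simp add: algebra_simps)
    also have "\<dots> = d" by (simp add: h_def add_nonneg_pos less_imp_neq[symmetric])
    finally show ?thesis .
  qed
  have inS: "z + s *\<^sub>R a + t *\<^sub>R b \<in> S" if "0 \<le> s" "s \<le> h" "0 \<le> t" "t \<le> h" for s t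
    using near[OF that] d3 by (auto simp: d_def dist_commute)
  obtain s t where st: "0 < s" "s < h" "0 < t" "t < h"
    "f (z + h *\<^sub>R a + h *\<^sub>R b) - f (z + h *\<^sub>R a) - f (z + h *\<^sub>R b) + f z = h\<^sup>2 * P (z + s *\<^sub>R a + t *\<^sub>R b)"
    using second_difference_mean_value[OF f dh(2) inS] unfolding P_def by blast
  have inS': "z + s *\<^sub>R b + t *\<^sub>R a \<in> S" if "0 \<le> s" "s \<le> h" "0 \<le> t" "t \<le> h" for s t
    using inS[OF that(3,4,1,2)] by (simp add: algebra_simps)
  obtain s' t' where st': "0 < s'" "s' < h" "0 < t'" "t' < h"
    "f (z + h *\<^sub>R b + h *\<^sub>R a) - f (z + h *\<^sub>R b) - f (z + h *\<^sub>R a) + f z = h\<^sup>2 * Q (z + s' *\<^sub>R b + t' *\<^sub>R a)"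
    using second_difference_mean_value[OF f dh(2) inS'] unfolding Q_def by blast
  have "h\<^sup>2 * P (z + s *\<^sub>R a + t *\<^sub>R b) = h\<^sup>2 * Q (z + t' *\<^sub>R a + s' *\<^sub>R b)"
    using st(5) st'(5) by (simp add: algebra_simps)
  then have eq: "P (z + s *\<^sub>R a + t *\<^sub>R b) = Q (z + t' *\<^sub>R a + s' *\<^sub>R b)" using dh by simp
  have "\<bar>P (z + s *\<^sub>R a + t *\<^sub>R b) - P z\<bar> < \<bar>P z - Q z\<bar> / 2"
    using near[of s t] st by (intro P) (auto simp: d_def)
  moreover have "\<bar>Q (z + t' *\<^sub>R a + s' *\<^sub>R b) - Q z\<bar> < \<bar>P z - Q z\<bar> / 2"
    using near[of t' s'] st' by (intro Q) (auto simp: d_def)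
  ultimately show False using eq by argo
qed

lemma partial_derivative1:
  assumes F: "smooth_on (S \<times> S') F" and z: "s \<in> S" "t \<in> S'"
  shows "((\<lambda>s. F (s, t)) has_derivative (\<lambda>w. frechet_derivative F (at (s, t)) (w, 0))) (at s)"
proof -
  have 1: "((\<lambda>s. (s, t)) has_derivative (\<lambda>w. (w, 0))) (at s)" by (auto intro!: derivative_eq_intros)
  have 2: "(F has_derivative frechet_derivative F (at (s, t))) (at (s, t))"
    by (rule smooth_on_has_derivative[OF F]) (use z in auto)
  from diff_chain_at[OF 1 2] show ?thesis by (simp add: o_def)
qed

lemma partial_derivative2:
  assumes F: "smooth_on (S \<times> S') F" and z: "s \<in> S" "t \<in> S'"
  shows "((\<lambda>t. F (s, t)) has_derivative (\<lambda>w. frechet_derivative F (at (s, t)) (0, w))) (at t)"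
proof -
  have 1: "((\<lambda>t. (s, t)) has_derivative (\<lambda>w. (0, w))) (at t)" by (auto intro!: derivative_eq_intros)
  have 2: "(F has_derivative frechet_derivative F (at (s, t))) (at (s, t))"
    by (rule smooth_on_has_derivative[OF F]) (use z in auto)
  from diff_chain_at[OF 1 2] show ?thesis by (simp add: o_def)
qed

section \<open>Smooth functions on a manifold\<close>

lemma sum_fun_apply: "(\<Sum>i\<in>I. f i) x = (\<Sum>i\<in>I. f i x)"
  for f :: "'i \<Rightarrow> 'a \<Rightarrow> 'b::comm_monoid_add"
  by (induction I rule: infinite_finite_induct) auto

locale smooth_manifold =
  fixes A :: "('m::t2_space, 'e::euclidean_space) chart set"
  assumes atlas: "smooth_atlas A"
begin

abbreviation C where "C \<equiv> smooth_functions A"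
abbreviation T where "T \<equiv> tangent_space A"

text \<open>
  The expression of \<open>f\<close> in the coordinates of the chart \<open>c\<close>, meaningful on the image of the chart.
\<close>

definition local_rep :: "('m, 'e) chart \<Rightarrow> ('m \<Rightarrow> 'b) \<Rightarrow> 'e \<Rightarrow> 'b" where
  "local_rep c f = (\<lambda>x. f (inv_into (fst c) (snd c) x))"

lemma chart_at: obtains U \<phi> where "(U, \<phi>) \<in> A" "p \<in> U"
proof -
  have "p \<in> (\<Union>(U, \<phi>)\<in>A. U)" using atlas by (auto simp: smooth_atlas_def)
  then show ?thesis using that by auto
qed

context
  fixes U \<phi> assumes c: "(U, \<phi>) \<in> A"
begin

lemma chart_open: "open U" "open (\<phi> ` U)"
  and chart_homeo: "homeomorphism U (\<phi> ` U) \<phi> (inv_into U \<phi>)"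
  using atlas c unfolding smooth_atlas_def by blast+

lemma chart_inv: "p \<in> U \<Longrightarrow> inv_into U \<phi> (\<phi> p) = p"
  using chart_homeo by (simp add: homeomorphism_def)

lemma chart_inv': "x \<in> \<phi> ` U \<Longrightarrow> \<phi> (inv_into U \<phi> x) = x"
  and chart_inv_mem: "x \<in> \<phi> ` U \<Longrightarrow> inv_into U \<phi> x \<in> U"
  by (auto simp: f_inv_into_f inv_into_into)

lemma chart_continuous: "continuous_on U \<phi>" "continuous_on (\<phi> ` U) (inv_into U \<phi>)"
  using chart_homeo by (auto simp: homeomorphism_def)

lemma chart_image_open: "open W \<Longrightarrow> open (\<phi> ` (U \<inter> W))"
proof -
  assume W: "open W"
  have "\<phi> ` (U \<inter> W) = \<phi> ` U \<inter> inv_into U \<phi> -` W"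
    using chart_inv by (auto simp: image_iff)
  also have "open \<dots>" by (rule continuous_open_preimage[OF chart_continuous(2) chart_open(2) W])
  finally show ?thesis .
qed

lemma chart_preimage_open: "open S \<Longrightarrow> open (U \<inter> \<phi> -` S)"
  by (rule continuous_open_preimage[OF chart_continuous(1) chart_open(1)])

lemma transition_smooth: "(V, \<psi>) \<in> A \<Longrightarrow> smooth_on (\<phi> ` (U \<inter> V)) (\<lambda>x. \<psi> (inv_into U \<phi> x))"
  using atlas c unfolding smooth_atlas_def by (fastforce simp: o_def)

end

lemma C_continuous: "f \<in> C \<Longrightarrow> continuous_on UNIV f"
  by (simp add: smooth_functions_def smooth_map_def)

lemma C_local_rep: "f \<in> C \<Longrightarrow> (U, \<phi>) \<in> A \<Longrightarrow> smooth_on (\<phi> ` U) (local_rep (U, \<phi>) f)"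
  by (auto simp: smooth_functions_def smooth_map_def real_atlas_def o_def local_rep_def)

text \<open>
  Smoothness may be tested near each point in one chart, because transition maps are smooth.
\<close>

lemma C_I_local:
  fixes f :: "'m \<Rightarrow> real"
  assumes "\<And>p. \<exists>U \<phi> W. (U, \<phi>) \<in> A \<and> p \<in> U \<and> open W \<and> p \<in> W \<and> smooth_on (\<phi> ` (U \<inter> W)) (local_rep (U, \<phi>) f)"
  shows "f \<in> C"
proof -
  have cont: "continuous (at p) f" for p
  proof -
    obtain U \<phi> W where *: "(U, \<phi>) \<in> A" "p \<in> U" "open W" "p \<in> W"
      "smooth_on (\<phi> ` (U \<inter> W)) (local_rep (U, \<phi>) f)" using assms by blast
    have "continuous_on (U \<inter> W) (\<lambda>q. local_rep (U, \<phi>) f (\<phi> q))"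
      by (rule continuous_on_compose2[OF smooth_on_continuous_on[OF *(5)]])
         (auto intro: continuous_on_subset[OF chart_continuous(1)[OF *(1)]])
    then have "continuous_on (U \<inter> W) f"
      by (rule continuous_on_eq) (auto simp: local_rep_def chart_inv[OF *(1)])
    then show ?thesis
      using continuous_on_eq_continuous_at[of "U \<inter> W" f] chart_open(1)[OF *(1)] *(2-4) by auto
  qed
  have "smooth_on (\<psi> ` V) (\<lambda>x. f (inv_into V \<psi> x))" if V: "(V, \<psi>) \<in> A" for V \<psi>
  proof (rule smooth_on_local[OF chart_open(2)[OF V]])
    fix x assume x: "x \<in> \<psi> ` V"
    define p where "p = inv_into V \<psi> x"
    have p: "p \<in> V" "\<psi> p = x" using x chart_inv'[OF V] chart_inv_mem[OF V] by (auto simp: p_def)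
    obtain U \<phi> W where *: "(U, \<phi>) \<in> A" "p \<in> U" "open W" "p \<in> W"
      "smooth_on (\<phi> ` (U \<inter> W)) (local_rep (U, \<phi>) f)" using assms by blast
    let ?N = "\<psi> ` (V \<inter> (U \<inter> W))"
    have N: "open ?N"
      by (rule chart_image_open[OF V]) (use chart_open(1)[OF *(1)] *(3) in auto)
    have 1: "smooth_on ?N (\<lambda>x. \<phi> (inv_into V \<psi> x))"
      by (rule smooth_on_subset[OF transition_smooth[OF V *(1)]]) auto
    have "smooth_on ?N (\<lambda>x. local_rep (U, \<phi>) f (\<phi> (inv_into V \<psi> x)))"
      by (rule smooth_on_compose[OF N chart_image_open[OF *(1) *(3)] 1 *(5)]) (auto simp: chart_inv[OF V])
    then have "smooth_on ?N (\<lambda>x. f (inv_into V \<psi> x))"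
      by (rule smooth_on_cong[OF N, rotated]) (auto simp: local_rep_def chart_inv[OF *(1)] chart_inv[OF V])
    then have "smooth_on (\<psi> ` V \<inter> ?N) (\<lambda>x. f (inv_into V \<psi> x))"
      by (rule smooth_on_subset) auto
    then show "\<exists>T. open T \<and> x \<in> T \<and> smooth_on (\<psi> ` V \<inter> T) (\<lambda>x. f (inv_into V \<psi> x))"
      using N p *(2,4) by (intro exI[of _ ?N]) auto
  qed
  then show ?thesis
    using cont by (auto simp: smooth_functions_def smooth_map_def real_atlas_def o_def
        continuous_at_imp_continuous_on)
qed

lemma C_I:
  fixes f :: "'m \<Rightarrow> real"
  assumes "\<And>U \<phi>. (U, \<phi>) \<in> A \<Longrightarrow> smooth_on (\<phi> ` U) (local_rep (U, \<phi>) f)"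
  shows "f \<in> C"
proof (rule C_I_local)
  fix p
  obtain U \<phi> where "(U, \<phi>) \<in> A" "p \<in> U" by (rule chart_at)
  then show "\<exists>U \<phi> W. (U, \<phi>) \<in> A \<and> p \<in> U \<and> open W \<and> p \<in> W \<and> smooth_on (\<phi> ` (U \<inter> W)) (local_rep (U, \<phi>) f)"
    using assms by (intro exI[of _ U] exI[of _ \<phi>] exI[of _ UNIV]) auto
qed

lemma C_const: "(\<lambda>x. c) \<in> C"
  by (rule C_I) (simp add: local_rep_def)

lemma C_add: "f \<in> C \<Longrightarrow> g \<in> C \<Longrightarrow> f + g \<in> C"
  by (rule C_I) (auto simp: local_rep_def plus_fun_def intro!: smooth_on_add chart_open dest: C_local_rep)

lemma C_mult: "f \<in> C \<Longrightarrow> g \<in> C \<Longrightarrow> f * g \<in> C"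
  by (rule C_I) (auto simp: local_rep_def times_fun_def intro!: smooth_on_mult chart_open dest: C_local_rep)

lemma C_scale: "f \<in> C \<Longrightarrow> c *\<^sub>R f \<in> C"
  by (rule C_I) (auto simp: local_rep_def scaleR_fun_def intro!: smooth_on_mult chart_open dest: C_local_rep)

lemma C_uminus: "f \<in> C \<Longrightarrow> - f \<in> C"
  using C_scale[of f "-1"] by simp

lemma C_diff: "f \<in> C \<Longrightarrow> g \<in> C \<Longrightarrow> f - g \<in> C"
  using C_add[OF _ C_uminus, of f g] by simp

lemma C_zero: "0 \<in> C"
  using C_const[of 0] by (simp add: zero_fun_def)

lemma C_sum: "(\<And>i. i \<in> I \<Longrightarrow> f i \<in> C) \<Longrightarrow> (\<Sum>i\<in>I. f i) \<in> C"
  by (induction I rule: infinite_finite_induct) (auto intro: C_add C_zero)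

text \<open>
  Multiply by a cutoff function supported in a compact subset of the chart and extend by zero. The
  support stays closed in the whole manifold because the manifold is Hausdorff. The support \<open>K\<close> is part of the
  conclusion, since products with \<open>f\<close> are extended by zero in the same way.
\<close>

lemma extend_from_chart:
  assumes c: "(U, \<phi>) \<in> A" "p \<in> U" and W: "open W" "p \<in> W"
    and h: "smooth_on S h" "open S" "\<phi> p \<in> S"
  obtains f N K where "f \<in> C" "open N" "p \<in> N" "N \<subseteq> U \<inter> W"
    "\<And>q. q \<in> N \<Longrightarrow> \<phi> q \<in> S \<and> f q = h (\<phi> q)"
    "closed K" "K \<subseteq> U \<inter> W" "\<And>q. q \<notin> K \<Longrightarrow> f q = (0::real)"
proof -
  have "open (\<phi> ` (U \<inter> W) \<inter> S)" "\<phi> p \<in> \<phi> ` (U \<inter> W) \<inter> S"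
    using chart_image_open[OF c(1) W(1)] h c W by auto
  then obtain r where r: "r > 0" "cball (\<phi> p) r \<subseteq> \<phi> ` (U \<inter> W) \<inter> S"
    by (meson open_contains_cball)
  obtain \<rho> :: "'e \<Rightarrow> real" where \<rho>: "smooth_on UNIV \<rho>" "\<And>x. x \<in> ball (\<phi> p) (r/2) \<Longrightarrow> \<rho> x = 1"
    "\<And>x. x \<notin> ball (\<phi> p) r \<Longrightarrow> \<rho> x = 0" by (rule smooth_cutoff[OF r(1), of "\<phi> p"]) blast
  define f where "f = (\<lambda>q. if q \<in> U then \<rho> (\<phi> q) * h (\<phi> q) else 0)"
  define K where "K = inv_into U \<phi> ` cball (\<phi> p) r"
  have "compact K"
    unfolding K_def
    by (rule compact_continuous_image[OF continuous_on_subset[OF chart_continuous(2)[OF c(1)]]]) (use r in auto)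
  then have clK: "closed K" by (rule compact_imp_closed)
  have f0: "f q = 0" if "q \<notin> K" for q
  proof (cases "q \<in> U")
    case True
    have "\<phi> q \<notin> cball (\<phi> p) r" using that True chart_inv[OF c(1) True] unfolding K_def by (metis imageI)
    then show ?thesis using \<rho>(3)[of "\<phi> q"] by (simp add: f_def)
  qed (simp add: f_def)
  have KW: "K \<subseteq> U \<inter> W \<inter> \<phi> -` S"
    unfolding K_def using r(2) chart_inv[OF c(1)] by (force simp: image_iff subset_iff)
  have "f \<in> C"
  proof (rule C_I_local)
    fix q
    show "\<exists>U \<phi> W. (U, \<phi>) \<in> A \<and> q \<in> U \<and> open W \<and> q \<in> W \<and> smooth_on (\<phi> ` (U \<inter> W)) (local_rep (U, \<phi>) f)"
    proof (cases "q \<in> K")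
      case True
      define W' where "W' = U \<inter> \<phi> -` S"
      have W': "open W'" unfolding W'_def by (rule chart_preimage_open[OF c(1) h(2)])
      have o: "open (\<phi> ` (U \<inter> W'))" by (rule chart_image_open[OF c(1) W'])
      have "smooth_on (\<phi> ` (U \<inter> W')) (\<lambda>x. \<rho> x * h x)"
        by (rule smooth_on_mult[OF o smooth_on_subset[OF \<rho>(1)] smooth_on_subset[OF h(1)]]) (auto simp: W'_def)
      then have "smooth_on (\<phi> ` (U \<inter> W')) (local_rep (U, \<phi>) f)"
        by (rule smooth_on_cong[OF o, rotated]) (auto simp: local_rep_def f_def chart_inv[OF c(1)])
      then show ?thesis using c(1) W' True KW by (intro exI[of _ U] exI[of _ \<phi>] exI[of _ W']) (auto simp: W'_def)
    next
      case False
      obtain V \<psi> where V: "(V, \<psi>) \<in> A" "q \<in> V" by (rule chart_at)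
      have o: "open (\<psi> ` (V \<inter> - K))" by (rule chart_image_open[OF V(1)]) (use clK in auto)
      have "smooth_on (\<psi> ` (V \<inter> - K)) (local_rep (V, \<psi>) f)"
        by (rule smooth_on_cong[OF o _ smooth_on_const[of _ 0]]) (auto simp: local_rep_def f0 chart_inv[OF V(1)])
      then show ?thesis
        using V False clK by (intro exI[of _ V] exI[of _ \<psi>] exI[of _ "- K"]) auto
    qed
  qed
  moreover define N where "N = U \<inter> \<phi> -` ball (\<phi> p) (r/2)"
  have N1: "open N" unfolding N_def by (rule chart_preimage_open[OF c(1) open_ball])
  have N2: "p \<in> N" using c r by (simp add: N_def)
  have NK: "N \<subseteq> K"
  proof
    fix q assume q: "q \<in> N"
    then have "q = inv_into U \<phi> (\<phi> q)" "\<phi> q \<in> cball (\<phi> p) r" using chart_inv[OF c(1)] r by (auto simp: N_def)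
    then show "q \<in> K" unfolding K_def by blast
  qed
  have "f q = h (\<phi> q)" if "q \<in> N" for q using that \<rho>(2)[of "\<phi> q"] by (auto simp: N_def f_def)
  with NK KW have N3: "\<phi> q \<in> S \<and> f q = h (\<phi> q)" if "q \<in> N" for q using that by auto
  have N4: "N \<subseteq> U \<inter> W" using NK KW by auto
  have KW': "K \<subseteq> U \<inter> W" using KW by auto
  show ?thesis by (rule that[OF \<open>f \<in> C\<close> N1 N2 N4 N3 clK KW' f0])
qed

lemma extend_coordinates:
  assumes c: "(U, \<phi>) \<in> A" "p \<in> U"
  obtains \<xi> N where "\<And>i. \<xi> i \<in> C" "\<And>i. open (N i)" "\<And>i. p \<in> N i" "\<And>i. N i \<subseteq> U"
    "\<And>i q. q \<in> N i \<Longrightarrow> \<xi> i q = \<phi> q \<bullet> i"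
proof -
  have "\<exists>\<xi> N. \<xi> \<in> C \<and> open N \<and> p \<in> N \<and> N \<subseteq> U \<and> (\<forall>q\<in>N. \<xi> q = \<phi> q \<bullet> i)" for i
  proof -
    have "smooth_on UNIV (\<lambda>x::'e. x \<bullet> i)" by (intro smooth_on_inner smooth_on_ident smooth_on_const open_UNIV)
    from extend_from_chart[OF c open_UNIV UNIV_I this open_UNIV UNIV_I] show ?thesis
      by (metis Int_lower1 subset_trans)
  qed
  then obtain \<xi> N where \<xi>: "\<And>i. \<xi> i \<in> C" "\<And>i. open (N i)" "\<And>i. p \<in> N i" "\<And>i. N i \<subseteq> U"
    "\<And>i q. q \<in> N i \<Longrightarrow> \<xi> i q = \<phi> q \<bullet> i" by metis
  show ?thesis by (rule that[OF \<xi>])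
qed

section \<open>Tangent vectors\<close>

lemma tangent_not_C: "v \<in> T p \<Longrightarrow> f \<notin> C \<Longrightarrow> v f = 0"
  and tangent_add: "v \<in> T p \<Longrightarrow> f \<in> C \<Longrightarrow> h \<in> C \<Longrightarrow> v (f + h) = v f + v h"
  and tangent_scale: "v \<in> T p \<Longrightarrow> f \<in> C \<Longrightarrow> v (c *\<^sub>R f) = c * v f"
  and tangent_mult: "v \<in> T p \<Longrightarrow> f \<in> C \<Longrightarrow> h \<in> C \<Longrightarrow> v (f * h) = f p * v h + h p * v f"
  by (auto simp: tangent_space_def)

lemma tangent_const: assumes "v \<in> T p" shows "v (\<lambda>x. c) = 0"
proof -
  have "v ((\<lambda>x. 1) * (\<lambda>x. 1)) = 2 * v (\<lambda>x. 1)" using tangent_mult[OF assms C_const C_const] by simp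
  then have 1: "v (\<lambda>x. 1) = 0" by (simp add: times_fun_def)
  have "(\<lambda>x. c) = c *\<^sub>R (\<lambda>x. 1)" by (simp add: scaleR_fun_def)
  then show ?thesis using tangent_scale[OF assms C_const, of c 1] 1 by (metis mult_zero_right)
qed

lemma tangent_zero: "v \<in> T p \<Longrightarrow> v 0 = 0"
  using tangent_const[of v p 0] by (simp add: zero_fun_def)

lemma tangent_diff: "v \<in> T p \<Longrightarrow> f \<in> C \<Longrightarrow> h \<in> C \<Longrightarrow> v (f - h) = v f - v h"
  using tangent_add[of v p f "(-1) *\<^sub>R h"] tangent_scale[of v p h "-1"] C_scale[of h "-1"] by simp

lemma tangent_sum: "v \<in> T p \<Longrightarrow> (\<And>i. i \<in> I \<Longrightarrow> f i \<in> C) \<Longrightarrow> v (\<Sum>i\<in>I. f i) = (\<Sum>i\<in>I. v (f i))"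
  by (induction I rule: infinite_finite_induct) (auto simp: tangent_zero tangent_add C_sum)

text \<open>
  Apply the product rule to \<open>b * (f - h) = 0\<close>, where \<open>b\<close> is a cutoff function supported where \<open>f\<close> and
  \<open>h\<close> agree.
\<close>

lemma tangent_local:
  assumes v: "v \<in> T p" and f: "f \<in> C" "h \<in> C" and N: "open N" "p \<in> N" "\<And>q. q \<in> N \<Longrightarrow> f q = h q"
  shows "v f = v h"
proof -
  obtain U \<phi> where c: "(U, \<phi>) \<in> A" "p \<in> U" by (rule chart_at)
  obtain b M K where b: "b \<in> C" "open M" "p \<in> M" "M \<subseteq> U \<inter> N"
    "\<And>q. q \<in> M \<Longrightarrow> \<phi> q \<in> UNIV \<and> b q = (\<lambda>x. 1) (\<phi> q)"
    "closed K" "K \<subseteq> U \<inter> N" "\<And>q. q \<notin> K \<Longrightarrow> b q = (0::real)"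
    by (rule extend_from_chart[OF c N(1,2) smooth_on_const[of UNIV 1] open_UNIV UNIV_I]) blast
  have "b * (f - h) = 0"
  proof
    fix q show "(b * (f - h)) q = 0 q" using N(3)[of q] b(7) b(8)[of q] by (cases "q \<in> K") auto
  qed
  then have "0 = b p * v (f - h) + (f - h) p * v b"
    using tangent_mult[OF v b(1) C_diff[OF f]] tangent_zero[OF v] by simp
  then show ?thesis using b(3) b(5)[of p] N tangent_diff[OF v f] by simp
qed

definition chart_tangent :: "('m, 'e) chart \<Rightarrow> 'm \<Rightarrow> 'e \<Rightarrow> 'm tangent" where
  "chart_tangent c p w = (\<lambda>f. if f \<in> C then frechet_derivative (local_rep c f) (at (snd c p)) w else 0)"

lemma local_rep_has_derivative:
  assumes "f \<in> C" "(U, \<phi>) \<in> A" "p \<in> U"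
  shows "(local_rep (U, \<phi>) f has_derivative frechet_derivative (local_rep (U, \<phi>) f) (at (\<phi> p))) (at (\<phi> p))"
  by (rule smooth_on_has_derivative[OF C_local_rep[OF assms(1,2)]]) (use assms in auto)

lemma chart_tangent_eqI:
  assumes "f \<in> C" "(local_rep (U, \<phi>) f has_derivative d) (at (\<phi> p))"
  shows "chart_tangent (U, \<phi>) p w f = d w"
  using assms by (simp add: chart_tangent_def frechet_derivative_at[symmetric])

lemma chart_tangent_in_T:
  assumes c: "(U, \<phi>) \<in> A" "p \<in> U"
  shows "chart_tangent (U, \<phi>) p w \<in> T p"
proof -
  let ?v = "chart_tangent (U, \<phi>) p w" and ?r = "local_rep (U, \<phi>)"
  have d: "(?r f has_derivative (\<lambda>w. chart_tangent (U, \<phi>) p w f)) (at (\<phi> p))" if "f \<in> C" for f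
    using local_rep_has_derivative[OF that c] that by (simp add: chart_tangent_def)
  have rp: "?r f (\<phi> p) = f p" for f :: "'m \<Rightarrow> real" by (simp add: local_rep_def chart_inv[OF c])
  have "?v (f + h) = ?v f + ?v h" if "f \<in> C" "h \<in> C" for f h
    by (rule chart_tangent_eqI[OF C_add[OF that]])
       (use has_derivative_add[OF d[OF that(1)] d[OF that(2)]] in \<open>simp add: local_rep_def\<close>)
  moreover have "?v (a *\<^sub>R f) = a * ?v f" if "f \<in> C" for f a
    by (rule chart_tangent_eqI[OF C_scale[OF that]])
       (use has_derivative_mult_right[OF d[OF that]] in \<open>simp add: local_rep_def scaleR_fun_def\<close>)
  moreover have "?v (f * h) = f p * ?v h + h p * ?v f" if "f \<in> C" "h \<in> C" for f h
    by (rule chart_tangent_eqI[OF C_mult[OF that]])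
       (use has_derivative_mult[OF d[OF that(1)] d[OF that(2)]] rp[of f] rp[of h] in \<open>simp add: local_rep_def mult.commute\<close>)
  moreover have "?v f = 0" if "f \<notin> C" for f using that by (simp add: chart_tangent_def)
  ultimately show ?thesis by (auto simp: tangent_space_def)
qed

text \<open>
  By the Hadamard factorization \<open>f\<close> is near \<open>p\<close> the constant \<open>f p\<close> plus \<open>\<Sum>\<^sub>i (\<xi>\<^sub>i - \<xi>\<^sub>i(p)) \<eta>\<^sub>i\<close> with \<open>\<xi>\<^sub>i\<close> the
  coordinates and \<open>\<eta>\<^sub>i(p)\<close> the partial derivatives. A derivation sees only these values, so it is the
  directional derivative along the vector with components \<open>v(\<xi>\<^sub>i)\<close>. Cutoffs make \<open>\<xi>\<^sub>i\<close> and \<open>\<eta>\<^sub>i\<close> global.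
\<close>

lemma tangent_eq_chart_tangent:
  assumes v: "v \<in> T p" and c: "(U, \<phi>) \<in> A" "p \<in> U"
  obtains w where "v = chart_tangent (U, \<phi>) p w"
proof -
  have "open (\<phi> ` U)" "\<phi> p \<in> \<phi> ` U" using c chart_open(2) by auto
  then obtain r where r: "r > 0" "ball (\<phi> p) r \<subseteq> \<phi> ` U" by (meson openE)
  obtain \<xi> N where \<xi>: "\<And>i. \<xi> i \<in> C" "\<And>i. open (N i)" "\<And>i. p \<in> N i" "\<And>i. N i \<subseteq> U"
    "\<And>i q. q \<in> N i \<Longrightarrow> \<xi> i q = \<phi> q \<bullet> i" by (rule extend_coordinates[OF c]) blast
  define w where "w = (\<Sum>i\<in>Basis. v (\<xi> i) *\<^sub>R i)"
  have "v f = chart_tangent (U, \<phi>) p w f" for f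
  proof (cases "f \<in> C")
    case False
    then show ?thesis using tangent_not_C[OF v] by (simp add: chart_tangent_def)
  next
    case f: True
    let ?F = "local_rep (U, \<phi>) f"
    have F: "smooth_on (ball (\<phi> p) r) ?F" by (rule smooth_on_subset[OF C_local_rep[OF f c(1)] r(2)])
    obtain h where h: "\<And>i. smooth_on (ball (\<phi> p) r) (h i)"
      "\<And>x. x \<in> ball (\<phi> p) r \<Longrightarrow> ?F x = ?F (\<phi> p) + (\<Sum>i\<in>Basis. ((x - \<phi> p) \<bullet> i) * h i x)"
      "\<And>i. h i (\<phi> p) = frechet_derivative ?F (at (\<phi> p)) i"
      by (rule hadamard_factorization[OF F r(1)]) blast
    have "\<exists>\<eta> M. \<eta> \<in> C \<and> open M \<and> p \<in> M \<and> M \<subseteq> U \<and> (\<forall>q\<in>M. \<phi> q \<in> ball (\<phi> p) r \<and> \<eta> q = h i (\<phi> q))" for i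
    proof -
      have "\<phi> p \<in> ball (\<phi> p) r" using r by simp
      from extend_from_chart[OF c open_UNIV UNIV_I h(1)[of i] open_ball this] show ?thesis
        by (metis Int_lower1 subset_trans)
    qed
    then obtain \<eta> M where \<eta>: "\<And>i. \<eta> i \<in> C" "\<And>i. open (M i)" "\<And>i. p \<in> M i" "\<And>i. M i \<subseteq> U"
      "\<And>i q. q \<in> M i \<Longrightarrow> \<phi> q \<in> ball (\<phi> p) r \<and> \<eta> i q = h i (\<phi> q)" by metis
    define g where "g = (\<lambda>x. f p) + (\<Sum>i\<in>Basis. (\<xi> i - (\<lambda>x. \<phi> p \<bullet> i)) * \<eta> i)"
    have terms: "(\<xi> i - (\<lambda>x. \<phi> p \<bullet> i)) * \<eta> i \<in> C" for i by (intro C_mult C_diff \<xi> \<eta> C_const)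
    have gC: "g \<in> C" unfolding g_def by (intro C_add C_const C_sum terms)
    define O' where "O' = (\<Inter>i\<in>(Basis::'e set). N i \<inter> M i)"
    have "v f = v g"
    proof (rule tangent_local[OF v f gC])
      show "open O'" unfolding O'_def by (intro open_INT ballI open_Int \<xi> \<eta> finite_Basis)
      show "p \<in> O'" using \<xi> \<eta> by (simp add: O'_def)
      fix q assume q: "q \<in> O'"
      obtain i0 :: 'e where "i0 \<in> Basis" using nonempty_Basis by blast
      then have qU: "q \<in> U" "\<phi> q \<in> ball (\<phi> p) r" using q \<eta>(4,5) by (auto simp: O'_def)
      have "f q = ?F (\<phi> q)" by (simp add: local_rep_def chart_inv[OF c(1) qU(1)])
      also have "\<dots> = f p + (\<Sum>i\<in>Basis. ((\<phi> q - \<phi> p) \<bullet> i) * h i (\<phi> q))"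
        using h(2)[OF qU(2)] by (simp add: local_rep_def chart_inv[OF c])
      also have "\<dots> = f p + (\<Sum>i\<in>Basis. (\<xi> i q - \<phi> p \<bullet> i) * \<eta> i q)"
        using q \<xi>(5) \<eta>(5) by (intro arg_cong2[of _ _ _ _ "(+)"] sum.cong) (auto simp: O'_def inner_diff_left)
      also have "\<dots> = g q" by (simp add: g_def sum_fun_apply)
      finally show "f q = g q" .
    qed
    also have "\<dots> = (\<Sum>i\<in>Basis. v ((\<xi> i - (\<lambda>x. \<phi> p \<bullet> i)) * \<eta> i))"
      by (simp add: g_def tangent_add[OF v C_const C_sum[OF terms]] tangent_sum[OF v terms] tangent_const[OF v])
    also have "\<dots> = (\<Sum>i\<in>Basis. v (\<xi> i) * frechet_derivative ?F (at (\<phi> p)) i)"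
    proof (rule sum.cong)
      fix i :: 'e assume "i \<in> Basis"
      have "v ((\<xi> i - (\<lambda>x. \<phi> p \<bullet> i)) * \<eta> i) = \<eta> i p * v (\<xi> i - (\<lambda>x. \<phi> p \<bullet> i))"
        using tangent_mult[OF v C_diff[OF \<xi>(1) C_const] \<eta>(1)] \<xi>(5)[OF \<xi>(3)] by simp
      then show "v ((\<xi> i - (\<lambda>x. \<phi> p \<bullet> i)) * \<eta> i) = v (\<xi> i) * frechet_derivative ?F (at (\<phi> p)) i"
        using tangent_diff[OF v \<xi>(1) C_const] tangent_const[OF v] \<eta>(5)[OF \<eta>(3), of i] h(3)[of i] by simp
    qed simp
    also have "\<dots> = frechet_derivative ?F (at (\<phi> p)) w"
    proof -
      have l: "linear (frechet_derivative ?F (at (\<phi> p)))"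
        by (rule has_derivative_linear[OF local_rep_has_derivative[OF f c]])
      show ?thesis by (simp add: w_def linear_sum[OF l] linear_scale[OF l])
    qed
    finally show ?thesis using f by (simp add: chart_tangent_def)
  qed
  then show ?thesis using that by blast
qed

end

section \<open>Vector fields\<close>

context smooth_manifold begin

abbreviation VF where "VF \<equiv> vector_fields A"

lemma VF_value: "X \<in> VF \<Longrightarrow> value_at X p \<in> T p"
  and VF_C: "X \<in> VF \<Longrightarrow> f \<in> C \<Longrightarrow> X f \<in> C"
  by (auto simp: vector_fields_def)

lemma VF_not_C: "X \<in> VF \<Longrightarrow> f \<notin> C \<Longrightarrow> X f = 0"
  using tangent_not_C[OF VF_value] by (auto simp: value_at_def fun_eq_iff)

lemma VF_add: "X \<in> VF \<Longrightarrow> f \<in> C \<Longrightarrow> h \<in> C \<Longrightarrow> X (f + h) = X f + X h"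
  using tangent_add[OF VF_value] by (auto simp: value_at_def fun_eq_iff)

lemma VF_scale: "X \<in> VF \<Longrightarrow> f \<in> C \<Longrightarrow> X (c *\<^sub>R f) = c *\<^sub>R X f"
  using tangent_scale[OF VF_value] by (auto simp: value_at_def fun_eq_iff scaleR_fun_def)

lemma VF_mult: "X \<in> VF \<Longrightarrow> f \<in> C \<Longrightarrow> h \<in> C \<Longrightarrow> X (f * h) = f * X h + h * X f"
  using tangent_mult[OF VF_value] by (auto simp: value_at_def fun_eq_iff)

lemma VF_diff: "X \<in> VF \<Longrightarrow> f \<in> C \<Longrightarrow> h \<in> C \<Longrightarrow> X (f - h) = X f - X h"
  using tangent_diff[OF VF_value] by (auto simp: value_at_def fun_eq_iff)

lemma VF_const: "X \<in> VF \<Longrightarrow> X (\<lambda>x. c) = 0"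
  using tangent_const[OF VF_value] by (auto simp: value_at_def fun_eq_iff)

lemma VF_sum: "X \<in> VF \<Longrightarrow> (\<And>i. i \<in> I \<Longrightarrow> f i \<in> C) \<Longrightarrow> X (\<Sum>i\<in>I. f i) = (\<Sum>i\<in>I. X (f i))"
  by (rule ext) (simp add: sum_fun_apply tangent_sum[OF VF_value, unfolded value_at_def])

lemma VF_eqI:
  "X \<in> VF \<Longrightarrow> Y \<in> VF \<Longrightarrow> (\<And>f p. f \<in> C \<Longrightarrow> X f p = Y f p) \<Longrightarrow> X = Y"
  by (rule ext, rename_tac f, case_tac "f \<in> C") (auto simp: VF_not_C)

lemma VF_I:
  assumes "\<And>f. f \<notin> C \<Longrightarrow> X f = 0" "\<And>f. f \<in> C \<Longrightarrow> X f \<in> C"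
    and "\<And>f h p. f \<in> C \<Longrightarrow> h \<in> C \<Longrightarrow> X (f + h) p = X f p + X h p"
    and "\<And>f c p. f \<in> C \<Longrightarrow> X (c *\<^sub>R f) p = c * X f p"
    and "\<And>f h p. f \<in> C \<Longrightarrow> h \<in> C \<Longrightarrow> X (f * h) p = f p * X h p + h p * X f p"
  shows "X \<in> VF"
  using assms by (auto simp: vector_fields_def value_at_def tangent_space_def)

lemma tangent_space_subspace: "subspace (T p)"
  unfolding subspace_def
proof (intro conjI ballI allI)
  show "0 \<in> T p" by (simp add: tangent_space_def)
  show "u + v \<in> T p" if "u \<in> T p" "v \<in> T p" for u v
    using that by (simp add: tangent_space_def algebra_simps)
  show "c *\<^sub>R u \<in> T p" if "u \<in> T p" for c u
    using that by (simp add: tangent_space_def algebra_simps scaleR_fun_def)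
qed

lemmas T_zero = subspace_0[OF tangent_space_subspace]
  and T_add = subspace_add[OF tangent_space_subspace]
  and T_scale = subspace_scale[OF tangent_space_subspace]
  and T_diff = subspace_diff[OF tangent_space_subspace]
  and T_sum = subspace_sum[OF tangent_space_subspace]

lemma value_at_add: "value_at (X + Y) p = value_at X p + value_at Y p"
  and value_at_scaleR: "value_at (c *\<^sub>R X) p = c *\<^sub>R value_at X p"
  and value_at_diff: "value_at (X - Y) p = value_at X p - value_at Y p"
  and value_at_zero: "value_at 0 p = 0"
  and value_at_sum: "value_at (\<Sum>i\<in>I. f i) p = (\<Sum>i\<in>I. value_at (f i) p)"
  and value_at_fun_times: "value_at (fun_times_vf h X) p = h p *\<^sub>R value_at X p"
  by (auto simp: value_at_def fun_eq_iff scaleR_fun_def sum_fun_apply fun_times_vf_def)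

lemma vf_eq_iff_value: "X = Y \<longleftrightarrow> (\<forall>p. value_at X p = value_at Y p)"
  by (auto simp: value_at_def fun_eq_iff)

lemma VF_zero: "0 \<in> VF"
  by (auto simp: vector_fields_def value_at_zero T_zero C_zero)

lemma VF_plus: "X \<in> VF \<Longrightarrow> Y \<in> VF \<Longrightarrow> X + Y \<in> VF"
  by (auto simp: vector_fields_def value_at_add T_add C_add)

lemma VF_scaleR: "X \<in> VF \<Longrightarrow> c *\<^sub>R X \<in> VF"
  by (auto simp: vector_fields_def value_at_scaleR T_scale C_scale) (auto simp: scaleR_fun_def[of c X] C_scale)

lemma VF_minus: "X \<in> VF \<Longrightarrow> Y \<in> VF \<Longrightarrow> X - Y \<in> VF"
  by (auto simp: vector_fields_def value_at_diff T_diff C_diff)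

lemma VF_sums: "(\<And>i. i \<in> I \<Longrightarrow> X i \<in> VF) \<Longrightarrow> (\<Sum>i\<in>I. X i) \<in> VF"
  by (induction I rule: infinite_finite_induct) (auto simp: VF_zero VF_plus)

lemma VF_fun_times: "h \<in> C \<Longrightarrow> X \<in> VF \<Longrightarrow> fun_times_vf h X \<in> VF"
  by (auto simp: vector_fields_def value_at_fun_times T_scale) (auto simp: fun_times_vf_def C_mult)

lemma VF_bracket:
  assumes X: "X \<in> VF" and Y: "Y \<in> VF"
  shows "lie_bracket X Y \<in> VF"
proof (rule VF_I)
  fix f assume f: "f \<notin> C"
  then show "lie_bracket X Y f = 0"
    using X Y VF_not_C[of _ f] VF_const[of _ 0] by (simp add: lie_bracket_def zero_fun_def)
next
  fix f assume f: "f \<in> C"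
  then show "lie_bracket X Y f \<in> C" by (simp add: lie_bracket_def C_diff VF_C X Y)
next
  fix f h p assume f: "f \<in> C" "h \<in> C"
  note fs = VF_C[OF X f(1)] VF_C[OF X f(2)] VF_C[OF Y f(1)] VF_C[OF Y f(2)]
  show "lie_bracket X Y (f + h) p = lie_bracket X Y f p + lie_bracket X Y h p"
    by (simp add: lie_bracket_def VF_add[OF X] VF_add[OF Y] f fs)
  show "lie_bracket X Y (f * h) p = f p * lie_bracket X Y h p + h p * lie_bracket X Y f p"
    by (simp add: lie_bracket_def VF_add[OF X] VF_add[OF Y] VF_mult[OF X] VF_mult[OF Y] f fs C_mult algebra_simps)
next
  fix f c p assume f: "f \<in> C"
  note fs = VF_C[OF X f] VF_C[OF Y f]
  show "lie_bracket X Y (c *\<^sub>R f) p = c * lie_bracket X Y f p"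
    by (simp add: lie_bracket_def VF_scale[OF X] VF_scale[OF Y] f fs) (simp add: scaleR_fun_def algebra_simps)
qed

lemma lie_bracket_add: "X \<in> VF \<Longrightarrow> X' \<in> VF \<Longrightarrow> Y \<in> VF \<Longrightarrow> lie_bracket (X + X') Y = lie_bracket X Y + lie_bracket X' Y"
proof (rule VF_eqI)
  assume h: "X \<in> VF" "X' \<in> VF" "Y \<in> VF"
  show "lie_bracket (X + X') Y \<in> VF" "lie_bracket X Y + lie_bracket X' Y \<in> VF"
    by (intro VF_bracket VF_plus h)+
  fix f p assume "f \<in> C"
  then show "lie_bracket (X + X') Y f p = (lie_bracket X Y + lie_bracket X' Y) f p"
    by (simp add: lie_bracket_def VF_add VF_C h)
qed

lemma lie_bracket_scale: "X \<in> VF \<Longrightarrow> Y \<in> VF \<Longrightarrow> lie_bracket (s *\<^sub>R X) Y = s *\<^sub>R lie_bracket X Y"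
proof (rule VF_eqI)
  fix f p assume h: "X \<in> VF" "Y \<in> VF" "f \<in> C"
  have "(s *\<^sub>R X) (Y f) = s *\<^sub>R X (Y f)" "(s *\<^sub>R X) f = s *\<^sub>R X f" "(s *\<^sub>R lie_bracket X Y) f = s *\<^sub>R lie_bracket X Y f"
    by (simp_all add: scaleR_fun_def)
  then show "lie_bracket (s *\<^sub>R X) Y f p = (s *\<^sub>R lie_bracket X Y) f p"
    using h by (simp add: lie_bracket_def VF_scale VF_C) (simp add: scaleR_fun_def right_diff_distrib)
qed (auto intro: VF_bracket VF_scaleR)

lemma lie_bracket_swap: "lie_bracket Y X = - lie_bracket X Y" for X Y :: "'m vfield"
  by (auto simp: lie_bracket_def fun_eq_iff)

lemma lie_bracket_jacobi:
  assumes h: "X \<in> VF" "Y \<in> VF" "Z \<in> VF"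
  shows "lie_bracket (lie_bracket X Y) Z + lie_bracket (lie_bracket Y Z) X + lie_bracket (lie_bracket Z X) Y = 0"
proof (rule VF_eqI[OF _ VF_zero])
  show "lie_bracket (lie_bracket X Y) Z + lie_bracket (lie_bracket Y Z) X + lie_bracket (lie_bracket Z X) Y \<in> VF"
    by (intro VF_plus VF_bracket h)
qed (simp add: lie_bracket_def VF_diff VF_C h)

lemma lie_bracket_comb:
  assumes "finite F" "\<And>k. k \<in> F \<Longrightarrow> X k \<in> VF" "Y \<in> VF"
  shows "lie_bracket (\<Sum>k\<in>F. a k *\<^sub>R X k) Y = (\<Sum>k\<in>F. a k *\<^sub>R lie_bracket (X k) Y)"
  using assms(1,2)
proof (induction F)
  case empty
  then show ?case using VF_const[OF assms(3), of 0] by (auto simp: lie_bracket_def fun_eq_iff zero_fun_def)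
next
  case (insert k F)
  have k: "X k \<in> VF" and F: "(\<Sum>k\<in>F. a k *\<^sub>R X k) \<in> VF"
    using insert.prems by (auto intro: VF_sums VF_scaleR)
  have "lie_bracket (\<Sum>k\<in>insert k F. a k *\<^sub>R X k) Y = lie_bracket (a k *\<^sub>R X k + (\<Sum>k\<in>F. a k *\<^sub>R X k)) Y"
    by (simp only: sum.insert[OF insert.hyps])
  also have "\<dots> = a k *\<^sub>R lie_bracket (X k) Y + (\<Sum>k\<in>F. a k *\<^sub>R lie_bracket (X k) Y)"
    using insert.IH insert.prems by (simp only: lie_bracket_add[OF VF_scaleR[OF k] F assms(3)] lie_bracket_scale[OF k assms(3)] insert_iff simp_thms)
  finally show ?case by (simp only: sum.insert[OF insert.hyps])
qed

lemma chart_tangent_linear: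
  assumes c: "(U, \<phi>) \<in> A" "p \<in> U"
  shows "linear (chart_tangent (U, \<phi>) p)"
proof -
  have l: "linear (frechet_derivative (local_rep (U, \<phi>) f) (at (\<phi> p)))" if "f \<in> C" for f
    by (rule has_derivative_linear[OF local_rep_has_derivative[OF that c]])
  show ?thesis
    by (rule linearI; rule ext)
       (auto simp: chart_tangent_def linear_add[OF l] linear_scale[OF l] scaleR_fun_def)
qed

lemma T_finite_span:
  obtains B where "finite B" "span B = T p"
proof -
  obtain U \<phi> where c: "(U, \<phi>) \<in> A" "p \<in> U" by (rule chart_at)
  let ?t = "chart_tangent (U, \<phi>) p"
  have "span (?t ` Basis) = ?t ` span Basis"
    by (rule linear_span_image[OF chart_tangent_linear[OF c]])
  also have "\<dots> = T p"
    using chart_tangent_in_T[OF c] by (auto elim!: tangent_eq_chart_tangent[OF _ c])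
  finally show ?thesis using that finite_imageI[OF finite_Basis] by blast
qed

text \<open>
  A coordinate field times a cutoff function.
\<close>

lemma local_chart_field:
  assumes c: "(U, \<phi>) \<in> A" "p \<in> U"
  obtains X N where "X \<in> VF" "open N" "p \<in> N" "N \<subseteq> U"
    "\<And>q. q \<in> N \<Longrightarrow> value_at X q = chart_tangent (U, \<phi>) q w"
proof -
  obtain b N K where b: "b \<in> C" "open N" "p \<in> N" "N \<subseteq> U \<inter> UNIV"
    "\<And>q. q \<in> N \<Longrightarrow> \<phi> q \<in> UNIV \<and> b q = (\<lambda>x. 1) (\<phi> q)"
    "closed K" "K \<subseteq> U \<inter> UNIV" "\<And>q. q \<notin> K \<Longrightarrow> b q = (0::real)"
    by (rule extend_from_chart[OF c open_UNIV UNIV_I smooth_on_const[of UNIV 1] open_UNIV UNIV_I]) blast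
  define X where "X = (\<lambda>f q. b q * chart_tangent (U, \<phi>) q w f)"
  have v: "value_at X q = b q *\<^sub>R chart_tangent (U, \<phi>) q w" for q
    by (simp add: X_def value_at_def scaleR_fun_def)
  have "value_at X q \<in> T q" for q
  proof (cases "q \<in> U")
    case True then show ?thesis by (simp add: v T_scale chart_tangent_in_T[OF c(1)])
  next
    case False then have "b q = 0" using b(7,8) by blast
    then show ?thesis by (simp add: v T_zero)
  qed
  moreover have "X f \<in> C" if f: "f \<in> C" for f
  proof (rule C_I_local)
    fix q
    show "\<exists>U \<phi> W. (U, \<phi>) \<in> A \<and> q \<in> U \<and> open W \<and> q \<in> W \<and> smooth_on (\<phi> ` (U \<inter> W)) (local_rep (U, \<phi>) (X f))"
    proof (cases "q \<in> K")
      case True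
      have "smooth_on (\<phi> ` U) (\<lambda>x. local_rep (U, \<phi>) b x * frechet_derivative (local_rep (U, \<phi>) f) (at x) w)"
        by (intro smooth_on_mult smooth_on_frechet_derivative C_local_rep chart_open[OF c(1)] b(1) f c)
      then have "smooth_on (\<phi> ` U) (local_rep (U, \<phi>) (X f))"
        by (rule smooth_on_cong[OF chart_open(2)[OF c(1)], rotated])
           (auto simp: X_def f chart_tangent_def local_rep_def chart_inv[OF c(1)])
      then show ?thesis using True b(7) c by (intro exI[of _ U] exI[of _ \<phi>] exI[of _ UNIV]) auto
    next
      case False
      obtain V \<psi> where V: "(V, \<psi>) \<in> A" "q \<in> V" by (rule chart_at)
      have o: "open (\<psi> ` (V \<inter> - K))" by (rule chart_image_open[OF V(1)]) (use b in auto)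
      have "smooth_on (\<psi> ` (V \<inter> - K)) (local_rep (V, \<psi>) (X f))"
        by (rule smooth_on_cong[OF o _ smooth_on_const[of _ 0]])
           (auto simp: local_rep_def X_def b(8) chart_inv[OF V(1)])
      then show ?thesis
        using V False b by (intro exI[of _ V] exI[of _ \<psi>] exI[of _ "- K"]) auto
    qed
  qed
  ultimately have "X \<in> VF" by (simp add: vector_fields_def)
  then show ?thesis using that b(2-5) v by auto
qed

section \<open>Smooth functions of two points\<close>

text \<open>
  Smoothness on the product manifold, tested in product charts only; this avoids a manifold structure on
  the product type.
\<close>

definition smooth2 :: "('m \<Rightarrow> 'm \<Rightarrow> real) set" where
  "smooth2 = {F. \<forall>(U, \<phi>)\<in>A. \<forall>(V, \<psi>)\<in>A. smooth_on (\<phi> ` U \<times> \<psi> ` V)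
     (\<lambda>z. F (inv_into U \<phi> (fst z)) (inv_into V \<psi> (snd z)))}"

lemma smooth2D:
  "F \<in> smooth2 \<Longrightarrow> (U, \<phi>) \<in> A \<Longrightarrow> (V, \<psi>) \<in> A \<Longrightarrow> smooth_on (\<phi> ` U \<times> \<psi> ` V)
     (\<lambda>z. F (inv_into U \<phi> (fst z)) (inv_into V \<psi> (snd z)))"
  by (auto simp: smooth2_def)

lemma smooth2_swap: assumes F: "F \<in> smooth2" shows "(\<lambda>x y. F y x) \<in> smooth2"
  unfolding smooth2_def
proof (clarify)
  fix U \<phi> V \<psi> assume c: "(U, \<phi>) \<in> A" and d: "(V, \<psi>) \<in> A"
  have o: "open (\<phi> ` U \<times> \<psi> ` V)" "open (\<psi> ` V \<times> \<phi> ` U)"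
    by (intro open_Times chart_open c d)+
  have sw: "smooth_on (\<phi> ` U \<times> \<psi> ` V) (\<lambda>z. (snd z, fst z))"
    by (intro smooth_on_Pair smooth_on_fst smooth_on_snd o)
  have "smooth_on (\<phi> ` U \<times> \<psi> ` V) (\<lambda>z. (\<lambda>z. F (inv_into V \<psi> (fst z)) (inv_into U \<phi> (snd z))) (snd z, fst z))"
    by (rule smooth_on_compose[OF o sw smooth2D[OF F d c]]) auto
  then show "smooth_on (\<phi> ` U \<times> \<psi> ` V) (\<lambda>z. F (inv_into V \<psi> (snd z)) (inv_into U \<phi> (fst z)))"
    by simp
qed

lemma smooth2_slice1: assumes F: "F \<in> smooth2" shows "(\<lambda>x. F x y) \<in> C"
proof (rule C_I)
  fix U \<phi> assume c: "(U, \<phi>) \<in> A"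
  obtain V \<psi> where d: "(V, \<psi>) \<in> A" "y \<in> V" by (rule chart_at)
  have o: "open (\<phi> ` U)" "open (\<phi> ` U \<times> \<psi> ` V)"
    by (intro open_Times chart_open c d)+
  have "smooth_on (\<phi> ` U) (\<lambda>s. (s, \<psi> y))" by (intro smooth_on_Pair smooth_on_ident smooth_on_const o)
  from smooth_on_compose[OF o this smooth2D[OF F c d(1)]]
  show "smooth_on (\<phi> ` U) (local_rep (U, \<phi>) (\<lambda>x. F x y))"
    using d by (auto simp: local_rep_def chart_inv[OF d])
qed

lemma smooth2_slice2: "F \<in> smooth2 \<Longrightarrow> (\<lambda>y. F x y) \<in> C"
  using smooth2_slice1[OF smooth2_swap] .

lemma smooth2_derivative1_rep:
  assumes F: "F \<in> smooth2" and c: "(U, \<phi>) \<in> A" "p \<in> U" and d: "(V, \<psi>) \<in> A" and t: "t \<in> \<psi> ` V"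
  shows "chart_tangent (U, \<phi>) p w (\<lambda>x. F x (inv_into V \<psi> t)) =
    frechet_derivative (\<lambda>z. F (inv_into U \<phi> (fst z)) (inv_into V \<psi> (snd z))) (at (\<phi> p, t)) (w, 0)"
proof (rule chart_tangent_eqI[OF smooth2_slice1[OF F]])
  have "\<phi> p \<in> \<phi> ` U" using c by simp
  from partial_derivative1[OF smooth2D[OF F c(1) d] this t]
  show "(local_rep (U, \<phi>) (\<lambda>x. F x (inv_into V \<psi> t)) has_derivative
      (\<lambda>w. frechet_derivative (\<lambda>z. F (inv_into U \<phi> (fst z)) (inv_into V \<psi> (snd z))) (at (\<phi> p, t)) (w, 0))) (at (\<phi> p))"
    by (simp add: local_rep_def)
qed

lemma smooth2_derivative2_rep:
  assumes F: "F \<in> smooth2" and c: "(U, \<phi>) \<in> A" and d: "(V, \<psi>) \<in> A" "q \<in> V" and s: "s \<in> \<phi> ` U"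
  shows "chart_tangent (V, \<psi>) q w (\<lambda>y. F (inv_into U \<phi> s) y) =
    frechet_derivative (\<lambda>z. F (inv_into U \<phi> (fst z)) (inv_into V \<psi> (snd z))) (at (s, \<psi> q)) (0, w)"
proof (rule chart_tangent_eqI[OF smooth2_slice2[OF F]])
  have "\<psi> q \<in> \<psi> ` V" using d by simp
  from partial_derivative2[OF smooth2D[OF F c d(1)] s this]
  show "(local_rep (V, \<psi>) (\<lambda>y. F (inv_into U \<phi> s) y) has_derivative
      (\<lambda>w. frechet_derivative (\<lambda>z. F (inv_into U \<phi> (fst z)) (inv_into V \<psi> (snd z))) (at (s, \<psi> q)) (0, w))) (at (\<psi> q))"
    by (simp add: local_rep_def)
qed

lemma smooth2_derivative1_C:
  assumes F: "F \<in> smooth2" and u: "u \<in> T p"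
  shows "(\<lambda>y. u (\<lambda>x. F x y)) \<in> C"
proof (rule C_I)
  fix V \<psi> assume d: "(V, \<psi>) \<in> A"
  obtain U \<phi> where c: "(U, \<phi>) \<in> A" "p \<in> U" by (rule chart_at)
  obtain w where w: "u = chart_tangent (U, \<phi>) p w" by (rule tangent_eq_chart_tangent[OF u c])
  let ?D = "\<lambda>z. frechet_derivative (\<lambda>z. F (inv_into U \<phi> (fst z)) (inv_into V \<psi> (snd z))) (at z) (w, 0)"
  have o: "open (\<psi> ` V)" "open (\<phi> ` U \<times> \<psi> ` V)" by (intro open_Times chart_open c d)+
  have "smooth_on (\<psi> ` V) (\<lambda>t. (\<phi> p, t))" by (intro smooth_on_Pair smooth_on_ident smooth_on_const o)
  then have "smooth_on (\<psi> ` V) (\<lambda>t. ?D (\<phi> p, t))"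
    by (rule smooth_on_compose[OF o _ smooth_on_frechet_derivative[OF smooth2D[OF F c(1) d]]]) (use c in auto)
  then show "smooth_on (\<psi> ` V) (local_rep (V, \<psi>) (\<lambda>y. u (\<lambda>x. F x y)))"
    by (rule smooth_on_cong[OF o(1), rotated])
       (simp add: w local_rep_def smooth2_derivative1_rep[OF F c d])
qed

lemma smooth2_derivative2_C: "F \<in> smooth2 \<Longrightarrow> u \<in> T p \<Longrightarrow> (\<lambda>x. u (\<lambda>y. F x y)) \<in> C"
  using smooth2_derivative1_C[OF smooth2_swap] .

text \<open>
  In charts this is the symmetry of the mixed second derivative in a direction of the first and a
  direction of the second factor.
\<close>

lemma smooth2_derivatives_commute:
  assumes F: "F \<in> smooth2" and u: "u \<in> T p" and v: "v \<in> T q"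
  shows "u (\<lambda>x. v (\<lambda>y. F x y)) = v (\<lambda>y. u (\<lambda>x. F x y))"
proof -
  obtain U \<phi> where c: "(U, \<phi>) \<in> A" "p \<in> U" by (rule chart_at)
  obtain w where w: "u = chart_tangent (U, \<phi>) p w" by (rule tangent_eq_chart_tangent[OF u c])
  obtain V \<psi> where d: "(V, \<psi>) \<in> A" "q \<in> V" by (rule chart_at)
  obtain w' where w': "v = chart_tangent (V, \<psi>) q w'" by (rule tangent_eq_chart_tangent[OF v d])
  let ?F = "\<lambda>z. F (inv_into U \<phi> (fst z)) (inv_into V \<psi> (snd z))"
  let ?S = "\<phi> ` U \<times> \<psi> ` V"
  have o: "open ?S" "open (\<phi> ` U)" "open (\<psi> ` V)" by (intro open_Times chart_open c d)+
  have z: "\<phi> p \<in> \<phi> ` U" "\<psi> q \<in> \<psi> ` V" using c d by auto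
  note sF = smooth2D[OF F c(1) d(1)]
  have "u (\<lambda>x. v (\<lambda>y. F x y)) = frechet_derivative (\<lambda>z. frechet_derivative ?F (at z) (0, w')) (at (\<phi> p, \<psi> q)) (w, 0)"
    unfolding w
  proof (rule chart_tangent_eqI[OF smooth2_derivative2_C[OF F v]])
    show "(local_rep (U, \<phi>) (\<lambda>x. v (F x)) has_derivative
      (\<lambda>w. frechet_derivative (\<lambda>z. frechet_derivative ?F (at z) (0, w')) (at (\<phi> p, \<psi> q)) (w, 0))) (at (\<phi> p))"
      by (rule has_derivative_transform_within_open[OF
            partial_derivative1[OF smooth_on_frechet_derivative[OF sF, of "(0, w')"] z] o(2) z(1)])
         (simp add: local_rep_def w' smooth2_derivative2_rep[OF F c(1) d])
  qed
  also have "\<dots> = frechet_derivative (\<lambda>z. frechet_derivative ?F (at z) (w, 0)) (at (\<phi> p, \<psi> q)) (0, w')"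
    by (rule symmetric_second_derivative[OF sF o(1)]) (use z in auto)
  also have "\<dots> = v (\<lambda>y. u (\<lambda>x. F x y))"
    unfolding w'
  proof (rule chart_tangent_eqI[OF smooth2_derivative1_C[OF F u], symmetric])
    show "(local_rep (V, \<psi>) (\<lambda>y. u (\<lambda>x. F x y)) has_derivative
      (\<lambda>w'. frechet_derivative (\<lambda>z. frechet_derivative ?F (at z) (w, 0)) (at (\<phi> p, \<psi> q)) (0, w'))) (at (\<psi> q))"
      by (rule has_derivative_transform_within_open[OF
            partial_derivative2[OF smooth_on_frechet_derivative[OF sF, of "(w, 0)"] z] o(3) z(2)])
         (simp add: local_rep_def w smooth2_derivative1_rep[OF F c d(1)])
  qed
  finally show ?thesis .
qed

end

section \<open>Invariant vector fields on a Lie group\<close>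

locale lie_group_manifold = smooth_manifold A
  for A :: "('g::{t2_space, second_countable_topology}, 'e::euclidean_space) chart set" +
  fixes G :: "'g monoid" (structure)
  assumes lie: "lie_group G A"
begin

sublocale group G
  using lie by (simp add: lie_group_def)

lemma carrier_UNIV [simp]: "carrier G = UNIV"
  using lie by (simp add: lie_group_def)

lemma G_assoc: "a \<otimes> b \<otimes> c = a \<otimes> (b \<otimes> c)" by (rule m_assoc) auto
lemma G_one [simp]: "\<one> \<otimes> a = a" "a \<otimes> \<one> = a" by (auto intro: l_one r_one)
lemma G_inv [simp]: "inv a \<otimes> a = \<one>" "a \<otimes> inv a = \<one>" by (auto intro: l_inv r_inv)
lemma G_inv2 [simp]: "inv a \<otimes> (a \<otimes> b) = b" "a \<otimes> (inv a \<otimes> b) = b"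
  by (simp_all add: G_assoc[symmetric])

lemma mult_smooth: "smooth_map (product_atlas A A) A (\<lambda>(x, y). x \<otimes> y)"
  using lie by (simp add: lie_group_def)

lemma continuous_translations:
  "continuous_on UNIV (\<lambda>p. p \<otimes> a)" "continuous_on UNIV (\<lambda>p. a \<otimes> p)"
proof -
  have m: "continuous_on UNIV (\<lambda>(x, y). x \<otimes> y)" using mult_smooth by (simp add: smooth_map_def)
  have "continuous_on UNIV (\<lambda>p. (p, a))" "continuous_on UNIV (\<lambda>p. (a, p))"
    by (auto intro!: continuous_intros)
  from continuous_on_compose2[OF m this(1)] continuous_on_compose2[OF m this(2)]
  show "continuous_on UNIV (\<lambda>p. p \<otimes> a)" "continuous_on UNIV (\<lambda>p. a \<otimes> p)" by auto
qed

text \<open>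
  Smoothness of the multiplication is given in charts of all three copies of the group. Near each point
  compose with a chart around the product to remove the third one.
\<close>

lemma mult_smooth2:
  assumes f: "f \<in> C"
  shows "(\<lambda>x y. f (x \<otimes> y)) \<in> smooth2"
  unfolding smooth2_def
proof (clarify)
  fix U \<phi> V \<psi> assume c: "(U, \<phi>) \<in> A" and d: "(V, \<psi>) \<in> A"
  let ?m = "\<lambda>(x, y). x \<otimes> y" and ?S = "\<phi> ` U \<times> \<psi> ` V"
  let ?i = "\<lambda>z. (inv_into U \<phi> (fst z), inv_into V \<psi> (snd z))"
  have o: "open ?S" by (intro open_Times chart_open c d)
  have m: "continuous_on UNIV ?m" using mult_smooth by (simp add: smooth_map_def)
  have ic: "continuous_on ?S ?i"
    by (intro continuous_on_Pair continuous_on_compose2[OF chart_continuous(2)[OF c] continuous_on_fst]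
        continuous_on_compose2[OF chart_continuous(2)[OF d] continuous_on_snd] continuous_on_id) auto
  have mic: "continuous_on ?S (\<lambda>z. ?m (?i z))"
    using continuous_on_compose2[OF m ic] by auto
  have inj: "inj_on (map_prod \<phi> \<psi>) (U \<times> V)"
    using chart_inv[OF c] chart_inv[OF d] by (intro map_prod_inj_on inj_on_inverseI)
  have inv: "inv_into (U \<times> V) (map_prod \<phi> \<psi>) z = ?i z" if "z \<in> ?S" for z
    by (rule inv_into_f_eq[OF inj])
       (use that chart_inv_mem[OF c] chart_inv_mem[OF d] chart_inv'[OF c] chart_inv'[OF d] in \<open>auto simp: mem_Times_iff\<close>)
  show "smooth_on ?S (\<lambda>z. f (inv_into U \<phi> (fst z) \<otimes> inv_into V \<psi> (snd z)))"
  proof (rule smooth_on_local[OF o])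
    fix z0 assume z0: "z0 \<in> ?S"
    obtain W \<omega> where W: "(W, \<omega>) \<in> A" "?m (?i z0) \<in> W" by (rule chart_at)
    let ?N = "?S \<inter> (\<lambda>z. ?m (?i z)) -` W"
    have N: "open ?N" by (rule continuous_open_preimage[OF mic o chart_open(1)[OF W(1)]])
    have "(U \<times> V, map_prod \<phi> \<psi>) \<in> product_atlas A A" using c d by (auto simp: product_atlas_def)
    then have sm: "smooth_on (map_prod \<phi> \<psi> ` ((U \<times> V) \<inter> ?m -` W)) (\<omega> \<circ> ?m \<circ> inv_into (U \<times> V) (map_prod \<phi> \<psi>))"
      using mult_smooth W(1) unfolding smooth_map_def by blast
    have "?N \<subseteq> map_prod \<phi> \<psi> ` ((U \<times> V) \<inter> ?m -` W)"
    proof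
      fix z assume z: "z \<in> ?N"
      then have "z = map_prod \<phi> \<psi> (?i z)" using chart_inv'[OF c] chart_inv'[OF d] by (auto simp: mem_Times_iff)
      moreover have "?i z \<in> (U \<times> V) \<inter> ?m -` W"
        using z chart_inv_mem[OF c] chart_inv_mem[OF d] by (auto simp: mem_Times_iff)
      ultimately show "z \<in> map_prod \<phi> \<psi> ` ((U \<times> V) \<inter> ?m -` W)" by blast
    qed
    from smooth_on_subset[OF sm this]
    have 1: "smooth_on ?N (\<lambda>z. \<omega> (?m (?i z)))"
      by (rule smooth_on_cong[OF N, rotated]) (simp add: inv)
    have "smooth_on ?N (\<lambda>z. local_rep (W, \<omega>) f (\<omega> (?m (?i z))))"
      by (rule smooth_on_compose[OF N chart_open(2)[OF W(1)] 1 C_local_rep[OF f W(1)]]) auto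
    then have "smooth_on ?N (\<lambda>z. f (inv_into U \<phi> (fst z) \<otimes> inv_into V \<psi> (snd z)))"
      by (rule smooth_on_cong[OF N, rotated]) (simp add: local_rep_def chart_inv[OF W(1)])
    then show "\<exists>T. open T \<and> z0 \<in> T \<and> smooth_on (?S \<inter> T) (\<lambda>z. f (inv_into U \<phi> (fst z) \<otimes> inv_into V \<psi> (snd z)))"
      using N z0 W(2) by (intro exI[of _ ?N]) (auto simp: Int_absorb1)
  qed
qed

lemma left_translate_C_iff: "(\<lambda>y. f (a \<otimes> y)) \<in> C \<longleftrightarrow> f \<in> C"
proof
  assume "(\<lambda>y. f (a \<otimes> y)) \<in> C"
  from smooth2_slice2[OF mult_smooth2[OF this], of "inv a"] show "f \<in> C" by simp
next
  assume "f \<in> C" then show "(\<lambda>y. f (a \<otimes> y)) \<in> C" by (rule smooth2_slice2[OF mult_smooth2])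
qed

lemma left_translate_C: "f \<in> C \<Longrightarrow> (\<lambda>y. f (a \<otimes> y)) \<in> C"
  by (rule smooth2_slice2[OF mult_smooth2])

lemma right_translate_C: "f \<in> C \<Longrightarrow> (\<lambda>x. f (x \<otimes> a)) \<in> C"
  by (rule smooth2_slice1[OF mult_smooth2])

lemma right_translate_C_iff: "(\<lambda>y. f (y \<otimes> a)) \<in> C \<longleftrightarrow> f \<in> C"
proof
  assume "(\<lambda>y. f (y \<otimes> a)) \<in> C"
  from right_translate_C[OF this, of "inv a"] show "f \<in> C" by (simp add: G_assoc)
qed (rule right_translate_C)

definition left_field :: "'g tangent \<Rightarrow> 'g vfield" where
  "left_field v = (\<lambda>f x. v (\<lambda>y. f (x \<otimes> y)))"

definition right_field :: "'g tangent \<Rightarrow> 'g vfield" where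
  "right_field u = (\<lambda>f x. u (\<lambda>y. f (y \<otimes> x)))"

lemma fun_reparam:
  "(\<lambda>y. (f + h) (a \<otimes> y)) = (\<lambda>y. f (a \<otimes> y)) + (\<lambda>y. h (a \<otimes> y))"
  "(\<lambda>y. (f * h) (a \<otimes> y)) = (\<lambda>y. f (a \<otimes> y)) * (\<lambda>y. h (a \<otimes> y))"
  "(\<lambda>y. (c *\<^sub>R f) (a \<otimes> y)) = c *\<^sub>R (\<lambda>y. f (a \<otimes> y))"
  "(\<lambda>y. (f + h) (y \<otimes> a)) = (\<lambda>y. f (y \<otimes> a)) + (\<lambda>y. h (y \<otimes> a))"
  "(\<lambda>y. (f * h) (y \<otimes> a)) = (\<lambda>y. f (y \<otimes> a)) * (\<lambda>y. h (y \<otimes> a))"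
  "(\<lambda>y. (c *\<^sub>R f) (y \<otimes> a)) = c *\<^sub>R (\<lambda>y. f (y \<otimes> a))"
  for f h :: "'g \<Rightarrow> real"
  by (auto simp: scaleR_fun_def)

lemma left_field_VF:
  assumes v: "v \<in> T \<one>"
  shows "left_field v \<in> VF"
proof (rule VF_I)
  fix f :: "'g \<Rightarrow> real" assume "f \<notin> C"
  then show "left_field v f = 0"
    using tangent_not_C[OF v] left_translate_C_iff by (auto simp: left_field_def)
next
  fix f assume "f \<in> C"
  then show "left_field v f \<in> C" unfolding left_field_def by (rule smooth2_derivative2_C[OF mult_smooth2 v])
qed (simp_all only: left_field_def fun_reparam tangent_add[OF v left_translate_C left_translate_C]
    tangent_mult[OF v left_translate_C left_translate_C] tangent_scale[OF v left_translate_C] G_one)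

lemma right_field_VF:
  assumes v: "v \<in> T \<one>"
  shows "right_field v \<in> VF"
proof (rule VF_I)
  fix f :: "'g \<Rightarrow> real" assume "f \<notin> C"
  then show "right_field v f = 0"
    using tangent_not_C[OF v] right_translate_C_iff by (auto simp: right_field_def)
next
  fix f assume "f \<in> C"
  then show "right_field v f \<in> C" unfolding right_field_def by (rule smooth2_derivative1_C[OF mult_smooth2 v])
qed (simp_all only: right_field_def fun_reparam tangent_add[OF v right_translate_C right_translate_C]
    tangent_mult[OF v right_translate_C right_translate_C] tangent_scale[OF v right_translate_C] G_one)

lemma value_at_left_field: "value_at (left_field v) \<one> = v"
  and value_at_right_field: "value_at (right_field v) \<one> = v"
  by (auto simp: value_at_def left_field_def right_field_def)

lemma left_field_translate: "left_field v (\<lambda>y. f (a \<otimes> y)) p = left_field v f (a \<otimes> p)"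
  by (simp add: left_field_def G_assoc)

lemma right_field_translate: "right_field v (\<lambda>y. f (y \<otimes> a)) p = right_field v f (p \<otimes> a)"
  by (simp add: right_field_def G_assoc)

abbreviation LA where "LA \<equiv> lie_algebra G A"

lemma lie_algebraD: "X \<in> LA \<Longrightarrow> X \<in> VF" by (simp add: lie_algebra_def)

lemma lie_algebra_iff:
  "X \<in> LA \<longleftrightarrow> X \<in> VF \<and> (\<forall>f\<in>C. \<forall>a p. X f (a \<otimes> p) = X (\<lambda>y. f (a \<otimes> y)) p)"
proof -
  have "(value_at X (a \<otimes> p) = pushforward A (\<lambda>x. a \<otimes> x) (value_at X p)) \<longleftrightarrow>
        (\<forall>f\<in>C. X f (a \<otimes> p) = X (\<lambda>y. f (a \<otimes> y)) p)" if "X \<in> VF" for a p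
    using VF_not_C[OF that] by (auto simp: value_at_def pushforward_def fun_eq_iff o_def)
  then show ?thesis by (auto simp: lie_algebra_def)
qed

lemma left_field_LA: "v \<in> T \<one> \<Longrightarrow> left_field v \<in> LA"
  by (simp add: lie_algebra_iff left_field_VF left_field_translate)

lemma LA_eq_left_field: assumes "X \<in> LA" shows "X = left_field (value_at X \<one>)"
proof (rule VF_eqI[OF lie_algebraD[OF assms] left_field_VF[OF VF_value[OF lie_algebraD[OF assms]]]])
  fix f p assume "f \<in> C"
  then have "X f (p \<otimes> \<one>) = X (\<lambda>y. f (p \<otimes> y)) \<one>" using assms unfolding lie_algebra_iff by blast
  then show "X f p = left_field (value_at X \<one>) f p" by (simp add: left_field_def value_at_def)
qed

lemma LA_bracket: assumes X: "X \<in> LA" and Y: "Y \<in> LA" shows "lie_bracket X Y \<in> LA"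
  unfolding lie_algebra_iff
proof (intro conjI ballI allI)
  show "lie_bracket X Y \<in> VF" by (intro VF_bracket lie_algebraD X Y)
  fix f a p assume f: "f \<in> C"
  have tr: "Z (\<lambda>y. h (a \<otimes> y)) = (\<lambda>y. Z h (a \<otimes> y))" if "Z \<in> LA" "h \<in> C" for Z h
    using that unfolding lie_algebra_iff by auto
  show "lie_bracket X Y f (a \<otimes> p) = lie_bracket X Y (\<lambda>y. f (a \<otimes> y)) p"
    using f X Y by (simp add: lie_bracket_def tr VF_C lie_algebraD)
qed

lemma left_field_linear: "linear left_field"
  by (rule linearI) (auto simp: left_field_def fun_eq_iff scaleR_fun_def)

lemma lie_algebra_eq: "LA = left_field ` T \<one>"
proof
  show "LA \<subseteq> left_field ` T \<one>" using LA_eq_left_field VF_value[OF lie_algebraD] by blast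
  show "left_field ` T \<one> \<subseteq> LA" using left_field_LA by blast
qed

text \<open>
  Left invariant fields differentiate \<open>f (x \<otimes> y)\<close> in \<open>y\<close> and right invariant fields differentiate it in
  \<open>x\<close>, and such derivatives commute.
\<close>

lemma left_right_commute:
  assumes v: "v \<in> T \<one>" and u: "u \<in> T \<one>"
  shows "lie_bracket (left_field v) (right_field u) = 0"
proof (rule VF_eqI)
  fix f a assume f: "f \<in> C"
  have va: "value_at (left_field v) a \<in> T a" by (rule VF_value[OF left_field_VF[OF v]])
  have "left_field v (right_field u f) a = value_at (left_field v) a (\<lambda>y. u (\<lambda>x. f (x \<otimes> y)))"
    by (simp add: value_at_def right_field_def)
  also have "\<dots> = u (\<lambda>x. value_at (left_field v) a (\<lambda>y. f (x \<otimes> y)))"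
    by (rule smooth2_derivatives_commute[OF mult_smooth2[OF f] u va, symmetric])
  also have "\<dots> = right_field u (left_field v f) a"
    by (simp add: right_field_def left_field_def value_at_def G_assoc)
  finally show "lie_bracket (left_field v) (right_field u) f a = 0 f a"
    by (simp add: lie_bracket_def)
qed (auto intro: VF_bracket left_field_VF right_field_VF v u VF_zero)

abbreviation push where "push a \<equiv> pushforward A (\<lambda>x. a \<otimes> x)"

lemma push_left_field: "v \<in> T \<one> \<Longrightarrow> push a (value_at (left_field v) p) = value_at (left_field v) (a \<otimes> p)"
  using left_field_LA[of v] by (simp add: lie_algebra_def)

lemma push_T: assumes v: "v \<in> T p" shows "push a v \<in> T (a \<otimes> p)"
proof -
  have "v (\<lambda>y. f (a \<otimes> y) + h (a \<otimes> y)) = v (\<lambda>y. f (a \<otimes> y)) + v (\<lambda>y. h (a \<otimes> y))"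
    "v (\<lambda>y. f (a \<otimes> y) * h (a \<otimes> y)) = f (a \<otimes> p) * v (\<lambda>y. h (a \<otimes> y)) + h (a \<otimes> p) * v (\<lambda>y. f (a \<otimes> y))"
    if "f \<in> C" "h \<in> C" for f h
    using that tangent_add[OF v left_translate_C left_translate_C, of f h a a]
      tangent_mult[OF v left_translate_C left_translate_C, of f h a a]
    by (simp_all add: plus_fun_def times_fun_def)
  moreover have "v (\<lambda>y. (c *\<^sub>R f) (a \<otimes> y)) = c * v (\<lambda>y. f (a \<otimes> y))" if "f \<in> C" for f c
    using tangent_scale[OF v left_translate_C[OF that]] by (simp add: scaleR_fun_def)
  ultimately show ?thesis
    unfolding tangent_space_def[of _ "a \<otimes> p"]
    by (simp add: pushforward_def o_def C_add C_mult C_scale)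
qed

lemma T_eq_left_field: assumes v: "v \<in> T p" obtains u where "u \<in> T \<one>" "v = value_at (left_field u) p"
proof
  have "push (inv p) v \<in> T (inv p \<otimes> p)" by (rule push_T[OF v])
  then show "push (inv p) v \<in> T \<one>" by simp
  show "v = value_at (left_field (push (inv p) v)) p"
  proof
    fix f
    have "v f = 0" if "(\<lambda>y. f (p \<otimes> y)) \<notin> C"
      using that left_translate_C[of f p] tangent_not_C[OF v] by blast
    then show "v f = value_at (left_field (push (inv p) v)) p f"
      by (simp add: value_at_def left_field_def pushforward_def o_def)
  qed
qed

end

section \<open>Curvature algebra of cyclic structure constants\<close>

lemma sum3_rotate:
  "(\<Sum>i\<in>I. \<Sum>j\<in>I. \<Sum>k\<in>I. h i j k) = (\<Sum>i\<in>I. \<Sum>j\<in>I. \<Sum>k\<in>I. h k i j)"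
  for h :: "'i \<Rightarrow> 'i \<Rightarrow> 'i \<Rightarrow> 'b::comm_monoid_add"
proof -
  have "(\<Sum>i\<in>I. \<Sum>j\<in>I. \<Sum>k\<in>I. h k i j) = (\<Sum>i\<in>I. \<Sum>k\<in>I. \<Sum>j\<in>I. h k i j)"
    by (intro sum.cong sum.swap refl)
  also have "\<dots> = (\<Sum>k\<in>I. \<Sum>i\<in>I. \<Sum>j\<in>I. h k i j)" by (rule sum.swap)
  finally show ?thesis by simp
qed

lemma sum3_swap23:
  "(\<Sum>i\<in>I. \<Sum>j\<in>I. \<Sum>k\<in>I. h i j k) = (\<Sum>i\<in>I. \<Sum>j\<in>I. \<Sum>k\<in>I. h i k j)"
  for h :: "'i \<Rightarrow> 'i \<Rightarrow> 'i \<Rightarrow> 'b::comm_monoid_add"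
  by (intro sum.cong sum.swap refl)

lemma sum3_rotate':
  "(\<Sum>i\<in>I. \<Sum>j\<in>I. \<Sum>k\<in>I. h i j k) = (\<Sum>i\<in>I. \<Sum>j\<in>I. \<Sum>k\<in>I. h j k i)"
  for h :: "'i \<Rightarrow> 'i \<Rightarrow> 'i \<Rightarrow> 'b::comm_monoid_add"
  by (rule sum3_rotate[of "\<lambda>i j k. h j k i", symmetric])

lemma sum3_reverse:
  "(\<Sum>i\<in>I. \<Sum>j\<in>I. \<Sum>k\<in>I. h i j k) = (\<Sum>i\<in>I. \<Sum>j\<in>I. \<Sum>k\<in>I. h k j i)"
  for h :: "'i \<Rightarrow> 'i \<Rightarrow> 'i \<Rightarrow> 'b::comm_monoid_add"
  by (rule trans[OF sum3_swap23 sum3_rotate])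

text \<open>
  The form is nonnegative on \<open>t N + e\<^sub>k\<close> for every \<open>t\<close>, where it is affine in \<open>t\<close> with slope twice the
  pairing of \<open>N\<close> with \<open>e\<^sub>k\<close>.
\<close>

lemma psd_kernel:
  fixes B :: "'i \<Rightarrow> 'i \<Rightarrow> real"
  assumes I: "finite I" and sym: "\<And>i j. B i j = B j i"
    and psd: "\<And>x. (\<Sum>i\<in>I. \<Sum>j\<in>I. x i * x j * B i j) \<ge> 0"
    and N: "(\<Sum>i\<in>I. \<Sum>j\<in>I. N i * N j * B i j) = 0" and k: "k \<in> I"
  shows "(\<Sum>i\<in>I. N i * B i k) = 0"
proof (rule ccontr)
  define b where "b = (\<Sum>i\<in>I. N i * B i k)"
  assume "\<not> ?thesis" then have b: "b \<noteq> 0" by (simp add: b_def)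
  define t where "t = - (B k k + 1) / (2 * b)"
  define d where "d = (\<lambda>i. if i = k then 1 else (0::real))"
  have d1: "(\<Sum>i\<in>I. d i * h i) = h k" for h :: "'i \<Rightarrow> real"
  proof -
    have "(\<Sum>i\<in>I. d i * h i) = (\<Sum>i\<in>I. if i = k then h i else 0)"
      by (rule sum.cong) (auto simp: d_def)
    then show ?thesis using I k by simp
  qed
  have "(\<Sum>i\<in>I. \<Sum>j\<in>I. (t * N i + d i) * (t * N j + d j) * B i j)
      = t\<^sup>2 * (\<Sum>i\<in>I. \<Sum>j\<in>I. N i * N j * B i j) + t * (\<Sum>i\<in>I. N i * (\<Sum>j\<in>I. d j * B i j))
        + t * (\<Sum>i\<in>I. d i * (\<Sum>j\<in>I. N j * B i j)) + (\<Sum>i\<in>I. d i * (\<Sum>j\<in>I. d j * B i j))"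
    by (simp add: sum_distrib_left sum.distrib algebra_simps power2_eq_square)
  also have "\<dots> = 2 * t * b + B k k"
  proof -
    have "(\<Sum>j\<in>I. N j * B k j) = b"
      unfolding b_def by (intro sum.cong refl arg_cong2[of _ _ _ _ "(*)"] sym)
    then show ?thesis unfolding N d1 by (simp add: b_def)
  qed
  also have "\<dots> < 0"
  proof -
    have "2 * t * b = - (B k k + 1)" using b by (simp add: t_def)
    then show ?thesis by linarith
  qed
  finally show False using psd[of "\<lambda>i. t * N i + d i"] by linarith
qed

text \<open>
  The structure constants are meant to vanish when an index lies outside \<open>I\<close>; the identities can
  then be required for all indices.
\<close>

locale cyclic_structure_constants =
  fixes I :: "'i set" and c :: "'i \<Rightarrow> 'i \<Rightarrow> 'i \<Rightarrow> real"
  assumes fin: "finite I"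
    and antisym: "c i j k = - c j i k"
    and cyclic: "c i j k + c j k i + c k i j = 0"
    and jacobi: "(\<Sum>m\<in>I. c i j m * c m k l + c j k m * c m i l + c k i m * c m j l) = 0"
begin

text \<open>
  The curvature component \<open>\<langle>R(e\<^sub>i, e\<^sub>j) e\<^sub>k, e\<^sub>l\<rangle>\<close> of the connection \<open>\<langle>\<nabla>\<^sub>i e\<^sub>j, e\<^sub>k\<rangle> = c\<^sub>k\<^sub>j\<^sub>i\<close>, see \<open>coef_curvature\<close>
  below.
\<close>

definition R :: "'i \<Rightarrow> 'i \<Rightarrow> 'i \<Rightarrow> 'i \<Rightarrow> real" where
  "R i j k l = (\<Sum>m\<in>I. c m k j * c l m i - c m k i * c l m j - c i j m * c l k m)"

definition S :: real where "S = (\<Sum>i\<in>I. \<Sum>j\<in>I. \<Sum>k\<in>I. (c i j k)\<^sup>2)"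

definition killing :: "'i \<Rightarrow> 'i \<Rightarrow> real" where
  "killing i j = (\<Sum>a\<in>I. \<Sum>b\<in>I. c i a b * c j b a)"

lemma R_skew: "R i j k l = - R j i k l"
  unfolding R_def sum_negf[symmetric]
proof (intro sum.cong refl)
  fix m show "c m k j * c l m i - c m k i * c l m j - c i j m * c l k m
      = - (c m k i * c l m j - c m k j * c l m i - c j i m * c l k m)"
    using antisym[of i j m] by (simp add: algebra_simps)
qed

text \<open>
  Multiply the cyclic identity by \<open>c i j k\<close> and sum: the two rotated terms give equal sums.
\<close>

lemma sum_rotated_product: "(\<Sum>i\<in>I. \<Sum>j\<in>I. \<Sum>k\<in>I. c i j k * c k i j) = - S / 2"
proof -
  let ?P = "\<Sum>i\<in>I. \<Sum>j\<in>I. \<Sum>k\<in>I. c i j k * c k i j"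
  have P2: "(\<Sum>i\<in>I. \<Sum>j\<in>I. \<Sum>k\<in>I. c i j k * c j k i) = ?P"
    by (subst sum3_rotate) (simp add: mult.commute)
  have "0 = (\<Sum>i\<in>I. \<Sum>j\<in>I. \<Sum>k\<in>I. c i j k * (c i j k + c j k i + c k i j))"
    by (simp add: cyclic)
  also have "\<dots> = S + ?P + ?P"
    by (simp add: distrib_left sum.distrib P2 S_def power2_eq_square)
  finally show ?thesis by simp
qed

lemma scalar_curvature_sum:
  "(\<Sum>i\<in>I. \<Sum>j\<in>I. R i j j i) = - S / 2 - (\<Sum>m\<in>I. (\<Sum>i\<in>I. c m i i)\<^sup>2)"
proof -
  have "(\<Sum>i\<in>I. \<Sum>j\<in>I. R i j j i)
      = (\<Sum>i\<in>I. \<Sum>j\<in>I. \<Sum>m\<in>I. c m j j * c i m i) - (\<Sum>i\<in>I. \<Sum>j\<in>I. \<Sum>m\<in>I. c m j i * c i m j)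
        - (\<Sum>i\<in>I. \<Sum>j\<in>I. \<Sum>m\<in>I. c i j m * c i j m)"
    by (simp add: R_def sum_subtractf)
  also have "(\<Sum>i\<in>I. \<Sum>j\<in>I. \<Sum>m\<in>I. c i j m * c i j m) = S" by (simp add: S_def power2_eq_square)
  also have "(\<Sum>i\<in>I. \<Sum>j\<in>I. \<Sum>m\<in>I. c m j i * c i m j) = - S / 2"
    unfolding sum_rotated_product[symmetric] by (rule sum3_reverse)
  also have "(\<Sum>i\<in>I. \<Sum>j\<in>I. \<Sum>m\<in>I. c m j j * c i m i) = - (\<Sum>m\<in>I. (\<Sum>i\<in>I. c m i i)\<^sup>2)"
  proof -
    have "(\<Sum>i\<in>I. \<Sum>j\<in>I. \<Sum>m\<in>I. c m j j * c i m i) = (\<Sum>m\<in>I. \<Sum>i\<in>I. \<Sum>j\<in>I. c m j j * c i m i)"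
      by (rule sum3_rotate')
    also have "\<dots> = (\<Sum>m\<in>I. \<Sum>i\<in>I. \<Sum>j\<in>I. - (c m j j * c m i i))"
    proof (intro sum.cong refl)
      fix m i j show "c m j j * c i m i = - (c m j j * c m i i)" using antisym[of i m i] by simp
    qed
    also have "\<dots> = - (\<Sum>m\<in>I. (\<Sum>i\<in>I. c m i i)\<^sup>2)"
      by (simp add: sum_negf power2_eq_square sum_product mult.commute)
    finally show ?thesis .
  qed
  finally show ?thesis by simp
qed

lemma killing_commute: "killing i j = killing j i"
  unfolding killing_def by (subst sum.swap) (simp add: mult.commute)

lemma trace_killing: "(\<Sum>m\<in>I. killing m m) = S / 2"
proof -
  have "(\<Sum>m\<in>I. killing m m) = - (\<Sum>m\<in>I. \<Sum>a\<in>I. \<Sum>b\<in>I. c m a b * c b m a)"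
    unfolding killing_def sum_negf[symmetric]
  proof (intro sum.cong refl)
    fix m a b show "c m a b * c m b a = - (c m a b * c b m a)" using antisym[of m b a] by simp
  qed
  then show ?thesis by (simp add: sum_rotated_product)
qed

text \<open>
  The first term of \<open>R\<close> sums to traces of \<open>ad\<close>, which vanish. In the second one the cyclic identity splits off a
  part that cancels the third.
\<close>

lemma ricci_eq_killing:
  assumes unimod: "\<And>i. (\<Sum>k\<in>I. c i k k) = 0"
  shows "(\<Sum>i\<in>I. R i j k i) = - killing j k"
proof -
  have "(\<Sum>i\<in>I. R i j k i) = (\<Sum>i\<in>I. \<Sum>m\<in>I. c m k j * c i m i) - (\<Sum>i\<in>I. \<Sum>m\<in>I. c m k i * c i m j)
      - (\<Sum>i\<in>I. \<Sum>m\<in>I. c i j m * c i k m)"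
    by (simp add: R_def sum_subtractf)
  also have "(\<Sum>i\<in>I. \<Sum>m\<in>I. c m k j * c i m i) = 0"
  proof -
    have "(\<Sum>i\<in>I. \<Sum>m\<in>I. c m k j * c i m i) = (\<Sum>m\<in>I. c m k j * (\<Sum>i\<in>I. c i m i))"
      by (subst sum.swap) (simp add: sum_distrib_left)
    also have "\<dots> = (\<Sum>m\<in>I. c m k j * (\<Sum>i\<in>I. - c m i i))"
      by (intro sum.cong refl arg_cong2[of _ _ _ _ "(*)"] antisym)
    finally show ?thesis by (simp add: sum_negf unimod)
  qed
  also have "(\<Sum>i\<in>I. \<Sum>m\<in>I. c m k i * c i m j) = (\<Sum>i\<in>I. \<Sum>m\<in>I. - (c m k i * c m j i)) - (\<Sum>i\<in>I. \<Sum>m\<in>I. c m k i * c j i m)"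
    unfolding sum_subtractf[symmetric]
  proof (intro sum.cong refl)
    fix i m
    have "c i m j = - c m j i - c j i m" using cyclic[of i m j] by simp
    show "c m k i * c i m j = - (c m k i * c m j i) - c m k i * c j i m"
      unfolding \<open>c i m j = - c m j i - c j i m\<close> by (simp add: algebra_simps)
  qed
  also have "(\<Sum>i\<in>I. \<Sum>m\<in>I. - (c m k i * c m j i)) = - (\<Sum>i\<in>I. \<Sum>m\<in>I. c i j m * c i k m)"
    by (subst sum.swap) (simp add: sum_negf mult.commute)
  also have "(\<Sum>i\<in>I. \<Sum>m\<in>I. c m k i * c j i m) = - killing j k"
    unfolding killing_def sum_negf[symmetric]
  proof (intro sum.cong refl)
    fix i m show "c m k i * c j i m = - (c j i m * c k m i)" using antisym[of m k i] by simp
  qed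
  finally show ?thesis by simp
qed

text \<open>
  By the Jacobi identity \<open>ad\<close> is a representation, so \<open>B([X, Y], Z)\<close> is the trace of
  \<open>ad X ad Y ad Z - ad Y ad X ad Z\<close>, and traces of products are invariant under rotation.
\<close>

lemma killing_bracket_cyclic:
  fixes i j k
  defines "f \<equiv> \<lambda>i j k. \<Sum>m\<in>I. c i j m * killing m k"
  shows "f i j k = f j k i"
proof -
  define t where "t = (\<lambda>i j k. \<Sum>a\<in>I. \<Sum>b\<in>I. \<Sum>m\<in>I. c i a m * c j m b * c k b a)"
  have jac: "(\<Sum>m\<in>I. c i j m * c m a b) = (\<Sum>m\<in>I. c j a m * c i m b) - (\<Sum>m\<in>I. c i a m * c j m b)" for i j a b
  proof -
    have "0 = (\<Sum>m\<in>I. c i j m * c m a b + c j a m * c m i b + c a i m * c m j b)"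
      by (simp add: jacobi)
    also have "\<dots> = (\<Sum>m\<in>I. c i j m * c m a b - c j a m * c i m b + c i a m * c j m b)"
    proof (intro sum.cong refl)
      fix m
      have 1: "c m i b = - c i m b" and 2: "c a i m = - c i a m" and 3: "c m j b = - c j m b"
        by (rule antisym)+
      show "c i j m * c m a b + c j a m * c m i b + c a i m * c m j b
          = c i j m * c m a b - c j a m * c i m b + c i a m * c j m b"
        unfolding 1 2 3 by simp
    qed
    finally show ?thesis by (simp add: sum.distrib sum_subtractf)
  qed
  have f: "f i j k = t j i k - t i j k" for i j k
  proof -
    have "f i j k = (\<Sum>m\<in>I. \<Sum>a\<in>I. \<Sum>b\<in>I. c i j m * c m a b * c k b a)"
      by (simp add: f_def killing_def sum_distrib_left mult.assoc)
    also have "\<dots> = (\<Sum>a\<in>I. \<Sum>b\<in>I. \<Sum>m\<in>I. c i j m * c m a b * c k b a)"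
      by (rule sum3_rotate)
    also have "\<dots> = (\<Sum>a\<in>I. \<Sum>b\<in>I. (\<Sum>m\<in>I. c i j m * c m a b) * c k b a)"
      by (simp add: sum_distrib_right)
    also have "\<dots> = t j i k - t i j k"
      by (simp only: jac) (simp add: t_def sum_distrib_right left_diff_distrib sum_subtractf)
    finally show ?thesis .
  qed
  have t: "t i j k = t j k i" for i j k
    unfolding t_def
    by (rule trans[OF sum3_rotate']) (simp add: mult_ac)
  show ?thesis unfolding f using t[of j i k] t[of i j k] t[of i k j] by simp
qed

text \<open>
  The basis vectors indexed by \<open>E\<close> span the derived algebra: by \<open>out\<close> the others are orthogonal to all
  brackets, and by \<open>sp\<close> a vector orthogonal to all brackets has no component along \<open>E\<close>.
\<close>

lemma nonpositive_curvature_imp_abelian: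
  assumes unimod: "\<And>i. (\<Sum>k\<in>I. c i k k) = 0"
    and nonpos: "\<And>x y. (\<Sum>i\<in>I. \<Sum>j\<in>I. \<Sum>k\<in>I. \<Sum>l\<in>I. x i * y j * y k * x l * R i j k l) \<le> 0"
    and E: "E \<subseteq> I" and out: "\<And>i j k. k \<in> I - E \<Longrightarrow> c i j k = 0"
    and sp: "\<forall>x. (\<forall>i\<in>I. \<forall>j\<in>I. (\<Sum>k\<in>I. c i j k * x k) = 0) \<longrightarrow> (\<forall>l\<in>E. x l = 0)"
  shows "S = 0"
proof -
  have sum_times_delta: "(\<Sum>i\<in>I. (if i = a then 1 else 0) * h i) = h a" if "a \<in> I" for a and h :: "'i \<Rightarrow> real"
    using fin that by (simp add: if_distrib[of "\<lambda>r. r * _"] cong: if_cong)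
  \<comment> \<open>The Ricci form is a sum of curvatures of planes containing a basis vector.\<close>
  have dirR: "(\<Sum>j\<in>I. \<Sum>k\<in>I. y j * y k * R a j k a) \<le> 0" if a: "a \<in> I" for a y
  proof -
    define d where "d = (\<lambda>i. if i = a then 1 else (0::real))"
    have "(\<Sum>i\<in>I. \<Sum>j\<in>I. \<Sum>k\<in>I. \<Sum>l\<in>I. d i * y j * y k * d l * R i j k l)
        = (\<Sum>i\<in>I. d i * (\<Sum>j\<in>I. \<Sum>k\<in>I. y j * y k * (\<Sum>l\<in>I. d l * R i j k l)))"
      by (simp add: sum_distrib_left mult_ac)
    also have "\<dots> = (\<Sum>j\<in>I. \<Sum>k\<in>I. y j * y k * R a j k a)"
      unfolding d_def sum_times_delta[OF a] ..
    finally show ?thesis using nonpos[of d y] by linarith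
  qed
  \<comment> \<open>Nonpositive curvature makes the Ricci form nonpositive, and it is minus the Killing form.\<close>
  have psd: "(\<Sum>i\<in>I. \<Sum>j\<in>I. x i * x j * killing i j) \<ge> 0" for x
  proof -
    have 1: "(\<Sum>i\<in>I. \<Sum>j\<in>I. x i * x j * killing i j) = - (\<Sum>j\<in>I. \<Sum>k\<in>I. x j * x k * (\<Sum>a\<in>I. R a j k a))"
      unfolding ricci_eq_killing[OF unimod] by (simp add: sum_negf)
    have "(\<Sum>j\<in>I. \<Sum>k\<in>I. x j * x k * (\<Sum>a\<in>I. R a j k a)) = (\<Sum>a\<in>I. \<Sum>j\<in>I. \<Sum>k\<in>I. x j * x k * R a j k a)"
      unfolding sum_distrib_left by (rule sum3_rotate')
    also have "\<dots> \<le> 0" by (intro sum_nonpos dirR)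
    finally show ?thesis using 1 by linarith
  qed
  \<comment> \<open>Pairing the cyclic form \<open>B([i, j], k)\<close> with the cyclic identity shows that brackets are isotropic for \<open>B\<close>.\<close>
  have bb: "(\<Sum>m\<in>I. \<Sum>k\<in>I. c i j m * c i j k * killing m k) = 0" if ij: "i \<in> I" "j \<in> I" for i j
  proof -
    define f where "f = (\<lambda>i j k. \<Sum>m\<in>I. c i j m * killing m k)"
    have fc: "f i j k = f j k i" for i j k unfolding f_def by (rule killing_bracket_cyclic)
    define h where "h = (\<lambda>i j k. f i j k * c i j k)"
    let ?T = "\<Sum>i\<in>I. \<Sum>j\<in>I. \<Sum>k\<in>I. h i j k"
    have 1: "(\<Sum>i\<in>I. \<Sum>j\<in>I. \<Sum>k\<in>I. f i j k * c j k i) = ?T"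
    proof -
      have "f i j k * c j k i = h j k i" for i j k using fc[of i j k] by (simp add: h_def)
      then show ?thesis by (simp only:) (rule sum3_rotate'[symmetric])
    qed
    have 2: "(\<Sum>i\<in>I. \<Sum>j\<in>I. \<Sum>k\<in>I. f i j k * c k i j) = ?T"
    proof -
      have "f i j k * c k i j = h k i j" for i j k using fc[of k i j] by (simp add: h_def)
      then show ?thesis by (simp only:) (rule sum3_rotate[symmetric])
    qed
    have "0 = (\<Sum>i\<in>I. \<Sum>j\<in>I. \<Sum>k\<in>I. f i j k * (c i j k + c j k i + c k i j))" by (simp add: cyclic)
    also have "\<dots> = ?T + ?T + ?T" by (simp add: distrib_left sum.distrib 1 2) (simp add: h_def)
    finally have "?T = 0" by simp
    moreover define b where "b = (\<lambda>i j. \<Sum>m\<in>I. \<Sum>k\<in>I. c i j m * c i j k * killing m k)"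
    have "(\<Sum>k\<in>I. h i j k) = b i j" for i j
      unfolding b_def h_def f_def sum_distrib_right by (subst sum.swap) (simp only: mult_ac)
    ultimately have T: "(\<Sum>i\<in>I. \<Sum>j\<in>I. b i j) = 0" by simp
    have nn: "b i j \<ge> 0" for i j unfolding b_def by (rule psd)
    have "(\<Sum>j\<in>I. b i j) = 0"
      using T sum_nonneg_eq_0_iff[OF fin, of "\<lambda>i. \<Sum>j\<in>I. b i j"] ij nn by (simp add: sum_nonneg)
    then have "b i j = 0"
      using sum_nonneg_eq_0_iff[OF fin, of "\<lambda>j. b i j"] ij nn by simp
    then show ?thesis by (simp only: b_def)
  qed
  \<comment> \<open>Isotropic vectors of a semidefinite form lie in its kernel, and brackets span the vectors indexed by \<open>E\<close>.\<close>
  have kE: "killing l k = 0" if l: "l \<in> E" and k: "k \<in> I" for l k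
  proof -
    have "\<forall>i\<in>I. \<forall>j\<in>I. (\<Sum>m\<in>I. c i j m * killing m k) = 0"
      using psd_kernel[OF fin killing_commute psd bb k] by blast
    then show ?thesis using sp[THEN spec, of "\<lambda>m. killing m k"] l by blast
  qed
  \<comment> \<open>Nonpositive summands of a vanishing Ricci curvature vanish.\<close>
  have RE: "R a l l a = 0" if l: "l \<in> E" and a: "a \<in> I" for a l
  proof -
    have np: "R a l l a \<le> 0" if a: "a \<in> I" for a
    proof -
      define d where "d = (\<lambda>i. if i = l then 1 else (0::real))"
      have "(\<Sum>j\<in>I. \<Sum>k\<in>I. d j * d k * R a j k a) = (\<Sum>j\<in>I. d j * (\<Sum>k\<in>I. d k * R a j k a))"
        by (simp add: sum_distrib_left mult_ac)
      also have "\<dots> = R a l l a" unfolding d_def using sum_times_delta l E by (simp add: subset_iff)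
      finally show ?thesis using dirR[OF a, of d] by simp
    qed
    have "(\<Sum>a\<in>I. R a l l a) = 0" using ricci_eq_killing[OF unimod] kE[OF l] l E by auto
    then have "(\<Sum>a\<in>I. - R a l l a) = 0" by (simp add: sum_negf)
    then show ?thesis using sum_nonneg_eq_0_iff[OF fin, of "\<lambda>a. - R a l l a"] np a by simp
  qed
  \<comment> \<open>For \<open>m\<close> outside \<open>E\<close> the curvature of the plane of \<open>m\<close> and \<open>l\<close> is minus the squared length of the bracket.\<close>
  have central: "c m l n = 0" if m: "m \<in> I - E" and l: "l \<in> I" and n: "n \<in> I" for m l n
  proof (cases "l \<in> E")
    case True
    have "R m l l m = - (\<Sum>n\<in>I. (c m l n)\<^sup>2)"
      unfolding R_def sum_negf[symmetric] using out[OF m] by (simp add: power2_eq_square)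
    then have "(\<Sum>n\<in>I. (c m l n)\<^sup>2) = 0" using RE[OF True, of m] m by simp
    then show ?thesis using sum_nonneg_eq_0_iff[OF fin, of "\<lambda>n. (c m l n)\<^sup>2"] n by simp
  next
    case False
    then show ?thesis using cyclic[of m l n] out[OF m] out[of l] l by simp
  qed
  have "killing m m = 0" if "m \<in> I" for m
    by (cases "m \<in> E") (use kE that central in \<open>auto simp: killing_def\<close>)
  then have "(\<Sum>m\<in>I. killing m m) = 0" by simp
  then show ?thesis by (simp add: trace_killing)
qed

lemma S_eq_0:
  assumes "S = 0" "i \<in> I" "j \<in> I" "k \<in> I"
  shows "c i j k = 0"
proof -
  have "(\<Sum>j\<in>I. \<Sum>k\<in>I. (c i j k)\<^sup>2) = 0"
    using assms(1,2) unfolding S_def by (subst (asm) sum_nonneg_eq_0_iff) (auto simp: fin sum_nonneg)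
  then have "(\<Sum>k\<in>I. (c i j k)\<^sup>2) = 0"
    using assms(3) by (subst (asm) sum_nonneg_eq_0_iff) (auto simp: fin sum_nonneg)
  then show ?thesis
    using assms(4) by (subst (asm) sum_nonneg_eq_0_iff) (auto simp: fin)
qed

lemma S_nonneg: "S \<ge> 0" unfolding S_def by (intro sum_nonneg) auto

end

section \<open>Orthonormal bases of subspaces\<close>

text \<open>
  Tangent spaces are subspaces of a function space that carries no inner product of its own, hence an
  inner product relative to a carrier.
\<close>

locale inner_on =
  fixes V :: "'a::real_vector set" and ip :: "'a \<Rightarrow> 'a \<Rightarrow> real"
  assumes V: "subspace V"
    and ip_commute: "u \<in> V \<Longrightarrow> v \<in> V \<Longrightarrow> ip u v = ip v u"
    and ip_add: "u \<in> V \<Longrightarrow> v \<in> V \<Longrightarrow> w \<in> V \<Longrightarrow> ip (u + v) w = ip u w + ip v w"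
    and ip_scale: "u \<in> V \<Longrightarrow> v \<in> V \<Longrightarrow> ip (c *\<^sub>R u) v = c * ip u v"
    and ip_pos: "u \<in> V \<Longrightarrow> u \<noteq> 0 \<Longrightarrow> ip u u > 0"
begin

lemmas V_scale = subspace_scale[OF V] and V_zero = subspace_0[OF V]
  and V_sum = subspace_sum[OF V] and V_diff = subspace_diff[OF V]

lemma ip_zero: "v \<in> V \<Longrightarrow> ip 0 v = 0"
  using ip_scale[of v v 0] by simp

lemma ip_diff: "u \<in> V \<Longrightarrow> v \<in> V \<Longrightarrow> w \<in> V \<Longrightarrow> ip (u - v) w = ip u w - ip v w"
  using ip_add[of u "(-1) *\<^sub>R v" w] ip_scale[of v w "-1"] V_scale[of v "-1"] by simp

lemma ip_sum: "(\<And>i. i \<in> I \<Longrightarrow> f i \<in> V) \<Longrightarrow> w \<in> V \<Longrightarrow> ip (\<Sum>i\<in>I. f i) w = (\<Sum>i\<in>I. ip (f i) w)"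
  by (induction I rule: infinite_finite_induct) (auto simp: ip_zero ip_add V_sum)

lemma ip_comb: "(\<And>i. i \<in> I \<Longrightarrow> f i \<in> V) \<Longrightarrow> w \<in> V \<Longrightarrow>
    ip (\<Sum>i\<in>I. a i *\<^sub>R f i) w = (\<Sum>i\<in>I. a i * ip (f i) w)"
  by (subst ip_sum) (auto simp: V_scale ip_scale)

definition orthonormal :: "'a set \<Rightarrow> bool" where
  "orthonormal B \<longleftrightarrow> B \<subseteq> V \<and> (\<forall>u\<in>B. \<forall>v\<in>B. ip u v = (if u = v then 1 else 0))"

lemma orthonormal_coefficient:
  assumes B: "orthonormal B" and t: "finite t" "t \<subseteq> B" and b: "b \<in> B"
  shows "ip (\<Sum>v\<in>t. a v *\<^sub>R v) b = (if b \<in> t then a b else 0)"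
proof -
  have "ip (\<Sum>v\<in>t. a v *\<^sub>R v) b = (\<Sum>v\<in>t. a v * ip v b)"
    by (rule ip_comb) (use B t b in \<open>auto simp: orthonormal_def\<close>)
  also have "\<dots> = (\<Sum>v\<in>t. if v = b then a v else 0)"
    by (rule sum.cong) (use B t b in \<open>auto simp: orthonormal_def subset_iff\<close>)
  also have "\<dots> = (if b \<in> t then a b else 0)" using t by simp
  finally show ?thesis .
qed

lemma orthonormal_independent: assumes B: "orthonormal B" shows "independent B"
proof
  assume "dependent B"
  then obtain t u v where t: "finite t" "t \<subseteq> B" "(\<Sum>v\<in>t. u v *\<^sub>R v) = 0" "v \<in> t" "u v \<noteq> 0"
    unfolding dependent_explicit by blast
  have "ip 0 v = u v" using orthonormal_coefficient[OF B t(1,2), of v u] t by auto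
  moreover have "ip 0 v = 0" by (rule ip_zero) (use B t in \<open>auto simp: orthonormal_def\<close>)
  ultimately show False using t by simp
qed

lemma span_orthonormal_subset: "orthonormal B \<Longrightarrow> span B \<subseteq> V"
  by (simp add: orthonormal_def span_minimal[OF _ V])

lemma orthonormal_expand:
  assumes B: "orthonormal B" "finite B" and x: "x \<in> span B"
  shows "x = (\<Sum>b\<in>B. ip x b *\<^sub>R b)"
proof -
  obtain u where u: "x = (\<Sum>v\<in>B. u v *\<^sub>R v)" using x span_finite[OF B(2)] by auto
  have "ip x b = u b" if "b \<in> B" for b
    unfolding u using orthonormal_coefficient[OF B(1,2) order_refl that] that by simp
  then show ?thesis using u by simp
qed

lemma orthonormal_representation:
  assumes B: "orthonormal B" "finite B" and x: "x \<in> span B" and b: "b \<in> B"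
  shows "representation B x b = ip x b"
proof -
  have "representation B x b = representation B (\<Sum>b\<in>B. ip x b *\<^sub>R b) b"
    using orthonormal_expand[OF B x] by simp
  also have "\<dots> = (\<Sum>b'\<in>B. ip x b' * representation B b' b)"
    by (simp add: representation_sum[OF orthonormal_independent[OF B(1)]] span_base span_scale
        representation_scale[OF orthonormal_independent[OF B(1)]])
  also have "\<dots> = (\<Sum>b'\<in>B. if b' = b then ip x b' else 0)"
    by (rule sum.cong) (auto simp: representation_basis[OF orthonormal_independent[OF B(1)]])
  also have "\<dots> = ip x b" using B b by simp
  finally show ?thesis .
qed

lemma parseval:
  assumes B: "orthonormal B" "finite B" and x: "x \<in> span B" and y: "y \<in> V"
  shows "ip x y = (\<Sum>b\<in>B. ip x b * ip y b)"
proof -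
  have BV: "b \<in> V" if "b \<in> B" for b using B that by (auto simp: orthonormal_def)
  have "ip x y = ip (\<Sum>b\<in>B. ip x b *\<^sub>R b) y" using orthonormal_expand[OF B x] by simp
  also have "\<dots> = (\<Sum>b\<in>B. ip x b * ip b y)" by (rule ip_comb) (use BV y in auto)
  also have "\<dots> = (\<Sum>b\<in>B. ip x b * ip y b)"
    by (rule sum.cong) (use BV y ip_commute in auto)
  finally show ?thesis .
qed

lemma orthonormal_extend:
  assumes B: "orthonormal B" "finite B" and v: "v \<in> V"
  shows "\<exists>B'. orthonormal B' \<and> finite B' \<and> B \<subseteq> B' \<and> span B' = span (insert v B)"
proof (cases "v \<in> span B")
  case True
  then have "span (insert v B) = span B" by (simp add: span_redundant)
  then show ?thesis using B by blast
next
  case False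
  have BV: "b \<in> V" if "b \<in> B" for b using B that by (auto simp: orthonormal_def)
  define p where "p = (\<Sum>b\<in>B. ip v b *\<^sub>R b)"
  define w where "w = v - p"
  have pB: "p \<in> span B" unfolding p_def by (intro span_sum span_scale span_base)
  have pV: "p \<in> V" unfolding p_def by (intro V_sum V_scale BV)
  have wV: "w \<in> V" unfolding w_def by (intro V_diff v pV)
  have w0: "w \<noteq> 0" using False pB by (auto simp: w_def)
  have wb: "ip w b = 0" if b: "b \<in> B" for b
    unfolding w_def using ip_diff[OF v pV BV[OF b]] orthonormal_coefficient[OF B(1,2) order_refl b, of "ip v"] b
    by (simp add: p_def)
  define s where "s = sqrt (ip w w)"
  have s: "s > 0" "s * s = ip w w" using ip_pos[OF wV w0] by (auto simp: s_def)
  define e where "e = (1 / s) *\<^sub>R w"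
  have eV: "e \<in> V" unfolding e_def by (intro V_scale wV)
  have ee: "ip e e = 1"
    using s(1) ip_scale[OF wV eV, of "1/s", folded e_def] ip_commute[OF wV eV]
      ip_scale[OF wV wV, of "1/s", folded e_def]
    by (simp add: s(2)[symmetric])
  have eb: "ip e b = 0" "ip b e = 0" if "b \<in> B" for b
    using ip_scale[OF wV BV[OF that]] wb[OF that] ip_commute[OF eV BV[OF that]] by (auto simp: e_def)
  have "orthonormal (insert e B)"
    using B(1) eV ee eb by (auto simp: orthonormal_def)
  moreover have "span (insert e B) = span (insert v B)"
  proof (rule span_eq[THEN iffD2], intro conjI subsetI)
    fix x assume "x \<in> insert e B"
    moreover have "e \<in> span (insert v B)"
      unfolding e_def w_def
      by (intro span_scale span_diff span_base[of v] subsetD[OF span_mono[OF subset_insertI] pB]) simp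
    ultimately show "x \<in> span (insert v B)" by (auto intro: span_base)
  next
    fix x assume "x \<in> insert v B"
    moreover have "v = s *\<^sub>R e + p" using s by (simp add: e_def w_def)
    moreover have "s *\<^sub>R e + p \<in> span (insert e B)"
      by (intro span_add span_scale span_base[of e] subsetD[OF span_mono[OF subset_insertI] pB]) simp
    ultimately show "x \<in> span (insert e B)" by (auto intro: span_base)
  qed
  ultimately show ?thesis using B(2) by (intro exI[of _ "insert e B"]) auto
qed

lemma gram_schmidt:
  assumes B: "orthonormal B" "finite B" and S: "finite S" "S \<subseteq> V"
  shows "\<exists>B'. orthonormal B' \<and> finite B' \<and> B \<subseteq> B' \<and> span B' = span (S \<union> B)"
  using S
proof (induction S)
  case empty then show ?case using B by auto
next
  case (insert v S)
  then obtain B1 where B1: "orthonormal B1" "finite B1" "B \<subseteq> B1" "span B1 = span (S \<union> B)" by auto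
  obtain B' where B': "orthonormal B'" "finite B'" "B1 \<subseteq> B'" "span B' = span (insert v B1)"
    using orthonormal_extend[OF B1(1,2)] insert.prems by blast
  have "span (insert v B1) = span (insert v (S \<union> B))"
    using B1(4) by (simp add: span_insert)
  then show ?case using B' B1(3) by (intro exI[of _ B']) auto
qed

end

lemma dependent_pair:
  fixes u v :: "'a::real_vector"
  assumes "\<not> (u \<noteq> v \<and> independent {u, v})"
  shows "\<exists>t. v = t *\<^sub>R u \<or> u = t *\<^sub>R v"
proof (cases "u = v")
  case True then show ?thesis by (intro exI[of _ 1]) simp
next
  case False
  then have "\<not> independent {v} \<or> u \<in> span {v}" using assms by (auto simp: independent_insert)
  then show ?thesis
  proof
    assume "\<not> independent {v}"
    then have "v = 0" by simp
    then show ?thesis by (intro exI[of _ 0]) simp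
  next
    assume "u \<in> span {v}" then show ?thesis by (auto simp: span_singleton)
  qed
qed

context inner_on begin

text \<open>
  Up to the factor \<open>ip u u\<close> the determinant is the squared length of the component of \<open>v\<close> orthogonal to \<open>u\<close>.
\<close>

lemma gram_determinant_pos:
  assumes u: "u \<in> V" and v: "v \<in> V" and i: "u \<noteq> v" "independent {u, v}"
  shows "ip u u * ip v v - (ip u v)\<^sup>2 > 0"
proof -
  have "u \<noteq> 0" using i(2) dependent_zero[of "{u, v}"] by auto
  then have uu: "ip u u > 0" using ip_pos u by blast
  define t where "t = ip u v / ip u u"
  define w where "w = v - t *\<^sub>R u"
  have "v \<notin> span {u}" using i by (auto simp: insert_commute[of u v] independent_insert)
  then have "w \<noteq> 0" by (auto simp: w_def span_singleton)
  moreover have wV: "w \<in> V" unfolding w_def by (intro V_diff V_scale u v)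
  ultimately have "ip w w > 0" using ip_pos by blast
  have x: "ip x w = ip x v - t * ip x u" if "x \<in> V" for x
    using that u v wV ip_commute[of x] ip_diff[of v "t *\<^sub>R u" x] ip_scale[of u x t] V_scale[OF u, of t] V_diff
    by (simp add: w_def)
  have "ip w w = ip v w - t * ip u w"
    using ip_diff[OF v V_scale[OF u] wV, of t] ip_scale[OF u wV, of t] by (simp add: w_def)
  also have "\<dots> = ip v v - (ip u v)\<^sup>2 / ip u u"
    using uu by (simp add: x u v ip_commute[OF v u] t_def power2_eq_square)
  finally have "ip w w * ip u u = ip u u * ip v v - (ip u v)\<^sup>2"
    using uu by (simp add: field_simps)
  then show ?thesis using \<open>ip w w > 0\<close> uu by (metis mult_pos_pos)
qed

end

text \<open>
  Independence of the trace from the basis: expand \<open>L d\<close>, for \<open>d\<close> in the chosen basis, in the basis \<open>B\<close>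
  and exchange the order of summation. Linearity is assumed on \<open>V\<close> only, since brackets of vector fields are
  linear only there.
\<close>

lemma trace_on_eq:
  fixes L :: "'a::real_vector \<Rightarrow> 'a"
  assumes B: "independent B" "finite B" "span B = V"
    and LV: "\<And>x. x \<in> V \<Longrightarrow> L x \<in> V"
    and add: "\<And>x y. x \<in> V \<Longrightarrow> y \<in> V \<Longrightarrow> L (x + y) = L x + L y"
    and scale: "\<And>c x. x \<in> V \<Longrightarrow> L (c *\<^sub>R x) = c *\<^sub>R L x"
  shows "trace_on V L = (\<Sum>b\<in>B. representation B (L b) b)"
proof -
  have V: "subspace V" using B(3) by auto
  have L0: "L 0 = 0" using scale[OF subspace_0[OF V], of 0] by simp
  have Lsum: "L (\<Sum>i\<in>I. a i *\<^sub>R f i) = (\<Sum>i\<in>I. a i *\<^sub>R L (f i))" if "\<And>i. i \<in> I \<Longrightarrow> f i \<in> V"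
    for I :: "'a set" and a f
    using that
    by (induction I rule: infinite_finite_induct)
       (auto simp: L0 add scale subspace_scale[OF V] subspace_sum[OF V])
  define D where "D = (SOME B. independent B \<and> span B = V)"
  have "independent D \<and> span D = V" unfolding D_def by (rule someI[of _ B]) (use B in auto)
  then have D: "independent D" "span D = V" by auto
  have finD: "finite D"
    using independent_span_bound[OF B(2) D(1)] D(2) B(3) span_superset by blast
  have BV: "b \<in> V" if "b \<in> B" for b using span_base[OF that] B(3) by simp
  have DV: "d \<in> V" if "d \<in> D" for d using span_base[OF that] D(2) by simp
  have exB: "x = (\<Sum>b\<in>B. representation B x b *\<^sub>R b)" if "x \<in> V" for x
    using sum_representation_eq[OF B(1) _ B(2) order_refl, of x] that B(3) by simp
  have exD: "x = (\<Sum>d\<in>D. representation D x d *\<^sub>R d)" if "x \<in> V" for x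
    using sum_representation_eq[OF D(1) _ finD order_refl, of x] that D(2) by simp
  have rep_sum: "representation E (\<Sum>i\<in>I. a i *\<^sub>R f i) e = (\<Sum>i\<in>I. a i * representation E (f i) e)"
    if "independent E" "span E = V" "\<And>i. i \<in> I \<Longrightarrow> f i \<in> V" for E e I and a :: "'a \<Rightarrow> real" and f
    using that
    by (subst representation_sum) (auto simp: representation_scale subspace_scale[OF V])
  have "trace_on V L = (\<Sum>d\<in>D. representation D (L d) d)"
    by (simp add: trace_on_def D_def Let_def)
  also have "\<dots> = (\<Sum>d\<in>D. \<Sum>b\<in>B. representation B (L d) b * representation D b d)"
  proof (rule sum.cong)
    fix d assume d: "d \<in> D"
    have "representation D (L d) d = representation D (\<Sum>b\<in>B. representation B (L d) b *\<^sub>R b) d"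
      using exB[OF LV[OF DV[OF d]]] by simp
    also have "\<dots> = (\<Sum>b\<in>B. representation B (L d) b * representation D b d)"
      by (rule rep_sum[OF D BV])
    finally show "representation D (L d) d = (\<Sum>b\<in>B. representation B (L d) b * representation D b d)" .
  qed simp
  also have "\<dots> = (\<Sum>b\<in>B. \<Sum>d\<in>D. representation D b d * representation B (L d) b)"
    by (subst sum.swap) (simp add: mult.commute)
  also have "\<dots> = (\<Sum>b\<in>B. representation B (L b) b)"
  proof (rule sum.cong)
    fix b assume b: "b \<in> B"
    have "(\<Sum>d\<in>D. representation D b d * representation B (L d) b) = representation B (\<Sum>d\<in>D. representation D b d *\<^sub>R L d) b"
      by (rule rep_sum[OF B(1,3) LV[OF DV], symmetric])
    also have "(\<Sum>d\<in>D. representation D b d *\<^sub>R L d) = L (\<Sum>d\<in>D. representation D b d *\<^sub>R d)"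
      by (rule Lsum[OF DV, symmetric])
    also have "\<dots> = L b" using exD[OF BV[OF b]] by simp
    finally show "(\<Sum>d\<in>D. representation D b d * representation B (L d) b) = representation B (L b) b" .
  qed simp
  finally show ?thesis .
qed

section \<open>The Levi-Civita connection in an orthonormal frame\<close>

text \<open>
  A global orthonormal frame whose brackets have constant coefficients that satisfy the cyclic
  identity: the situation of a left invariant frame, with the group forgotten.
\<close>

locale framed_manifold = smooth_manifold A + str: cyclic_structure_constants I c
  for A :: "('m::t2_space, 'e::euclidean_space) chart set"
    and I :: "'i set" and c :: "'i \<Rightarrow> 'i \<Rightarrow> 'i \<Rightarrow> real" +
  fixes g :: "'m \<Rightarrow> 'm tangent \<Rightarrow> 'm tangent \<Rightarrow> real" and X :: "'i \<Rightarrow> 'm vfield"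
  assumes metric: "riemannian_metric A g"
    and X_VF: "i \<in> I \<Longrightarrow> X i \<in> VF"
    and X_orthonormal: "i \<in> I \<Longrightarrow> j \<in> I \<Longrightarrow> g p (value_at (X i) p) (value_at (X j) p) = (if i = j then 1 else 0)"
    and X_span: "v \<in> T p \<Longrightarrow> v = (\<Sum>i\<in>I. g p v (value_at (X i) p) *\<^sub>R value_at (X i) p)"
    and X_bracket: "i \<in> I \<Longrightarrow> j \<in> I \<Longrightarrow> lie_bracket (X i) (X j) = (\<Sum>k\<in>I. c i j k *\<^sub>R X k)"
begin

sublocale inner: inner_on "T p" "g p" for p
proof
  show "subspace (T p)" by (rule tangent_space_subspace)
qed (use metric in \<open>unfold riemannian_metric_def, blast+\<close>)

lemma sum_times_delta: "a \<in> I \<Longrightarrow> (\<Sum>i\<in>I. h i * (if i = a then 1 else 0)) = h a"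
  "a \<in> I \<Longrightarrow> (\<Sum>i\<in>I. h i * (if a = i then 1 else 0)) = h a"
  for h :: "'i \<Rightarrow> real"
  using str.fin by (simp_all add: if_distrib[of "\<lambda>r. _ * r"] cong: if_cong)

abbreviation Xp where "Xp i p \<equiv> value_at (X i) p"

lemma Xp_T: "i \<in> I \<Longrightarrow> Xp i p \<in> T p" by (rule VF_value[OF X_VF])

definition coef :: "'m vfield \<Rightarrow> 'i \<Rightarrow> 'm \<Rightarrow> real" where "coef Y k = metric_fun g Y (X k)"

lemma coef_C: "Y \<in> VF \<Longrightarrow> k \<in> I \<Longrightarrow> coef Y k \<in> C"
  using metric X_VF unfolding coef_def riemannian_metric_def by blast

lemma coef_at: "coef Y k p = g p (value_at Y p) (Xp k p)" by (simp add: coef_def metric_fun_def)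

lemma value_expand: "Y \<in> VF \<Longrightarrow> value_at Y p = (\<Sum>k\<in>I. coef Y k p *\<^sub>R Xp k p)"
  unfolding coef_at by (rule X_span[OF VF_value])

lemma apply_expand: "Y \<in> VF \<Longrightarrow> Y f p = (\<Sum>k\<in>I. coef Y k p * X k f p)"
  using fun_cong[OF value_expand[of Y p], of f]
  by (simp add: value_at_def sum_fun_apply scaleR_fun_def)

lemma coef_add: "Y \<in> VF \<Longrightarrow> Z \<in> VF \<Longrightarrow> k \<in> I \<Longrightarrow> coef (Y + Z) k = coef Y k + coef Z k"
  by (rule ext) (simp add: coef_at value_at_add inner.ip_add VF_value Xp_T)

lemma coef_diff: "Y \<in> VF \<Longrightarrow> Z \<in> VF \<Longrightarrow> k \<in> I \<Longrightarrow> coef (Y - Z) k = coef Y k - coef Z k"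
  by (rule ext) (simp add: coef_at value_at_diff inner.ip_diff VF_value Xp_T)

lemma coef_fun_times: "Y \<in> VF \<Longrightarrow> k \<in> I \<Longrightarrow> coef (fun_times_vf f Y) k = f * coef Y k"
  by (rule ext) (simp add: coef_at value_at_fun_times inner.ip_scale VF_value Xp_T)

lemma fun_times_apply: "fun_times_vf f Y h = f * Y h" for f :: "'m \<Rightarrow> real"
  by (simp add: fun_times_vf_def)

lemma lie_bracket_apply: "lie_bracket Y Z f = Y (Z f) - Z (Y f)" for f :: "'m \<Rightarrow> real"
  by (simp add: lie_bracket_def)

lemma coef_X: "i \<in> I \<Longrightarrow> k \<in> I \<Longrightarrow> coef (X i) k = (\<lambda>p. if i = k then 1 else 0)"
  by (rule ext) (simp add: coef_at X_orthonormal)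

definition combine :: "('i \<Rightarrow> 'm \<Rightarrow> real) \<Rightarrow> 'm vfield" where
  "combine h = (\<Sum>k\<in>I. fun_times_vf (h k) (X k))"

lemma combine_VF: "(\<And>k. k \<in> I \<Longrightarrow> h k \<in> C) \<Longrightarrow> combine h \<in> VF"
  unfolding combine_def by (intro VF_sums VF_fun_times X_VF)

lemma coef_combine: assumes k: "k \<in> I" shows "coef (combine h) k = h k"
proof
  fix p
  have "coef (combine h) k p = (\<Sum>j\<in>I. h j p * g p (Xp j p) (Xp k p))"
    unfolding coef_at combine_def value_at_sum value_at_fun_times
    by (rule inner.ip_comb) (use Xp_T k in auto)
  also have "\<dots> = (\<Sum>j\<in>I. h j p * (if j = k then 1 else 0))"
    by (intro sum.cong refl) (simp add: X_orthonormal k)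
  also have "\<dots> = h k p" by (rule sum_times_delta[OF k])
  finally show "coef (combine h) k p = h k p" .
qed

lemma VF_eq_coef: assumes "Y \<in> VF" "Z \<in> VF" "\<And>k. k \<in> I \<Longrightarrow> coef Y k = coef Z k" shows "Y = Z"
  unfolding vf_eq_iff_value using assms(3) by (simp add: value_expand assms(1,2))

lemma metric_fun_expand:
  assumes Y: "Y \<in> VF" and Z: "Z \<in> VF"
  shows "metric_fun g Y Z = (\<Sum>k\<in>I. coef Y k * coef Z k)"
proof
  fix p
  have "metric_fun g Y Z p = g p (\<Sum>k\<in>I. coef Y k p *\<^sub>R Xp k p) (value_at Z p)"
    using value_expand[OF Y] by (simp add: metric_fun_def)
  also have "\<dots> = (\<Sum>k\<in>I. coef Y k p * g p (Xp k p) (value_at Z p))"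
    by (rule inner.ip_comb) (use Xp_T VF_value[OF Z] in auto)
  also have "\<dots> = (\<Sum>k\<in>I. coef Y k p * coef Z k p)"
    by (rule sum.cong) (auto simp: coef_at inner.ip_commute Xp_T VF_value[OF Z])
  finally show "metric_fun g Y Z p = (\<Sum>k\<in>I. coef Y k * coef Z k) p" by (simp add: sum_fun_apply)
qed

text \<open>
  The bracket is a commutator of derivations, so the second order terms in \<open>f\<close> cancel up to the brackets
  of the frame fields.
\<close>

lemma coef_bracket:
  assumes Y: "Y \<in> VF" and Z: "Z \<in> VF" and k: "k \<in> I"
  shows "coef (lie_bracket Y Z) k p = Y (coef Z k) p - Z (coef Y k) p
     + (\<Sum>i\<in>I. \<Sum>j\<in>I. c i j k * coef Y i p * coef Z j p)"
proof -
  define h where "h = (\<lambda>k. Y (coef Z k) - Z (coef Y k)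
     + (\<Sum>i\<in>I. \<Sum>j\<in>I. c i j k *\<^sub>R (coef Y i * coef Z j)))"
  have hC: "h k \<in> C" if "k \<in> I" for k
    unfolding h_def by (intro C_add C_diff C_sum C_scale C_mult VF_C[OF Y] VF_C[OF Z] coef_C Y Z that)
  have hp: "h k p = Y (coef Z k) p - Z (coef Y k) p
     + (\<Sum>i\<in>I. \<Sum>j\<in>I. c i j k * coef Y i p * coef Z j p)" for k p
    by (simp add: h_def sum_fun_apply scaleR_fun_def mult.assoc)
  have app: "W (W' f) p = (\<Sum>j\<in>I. coef W' j p * W (X j f) p) + (\<Sum>j\<in>I. W (coef W' j) p * X j f p)"
    if W: "W \<in> VF" "W' \<in> VF" "f \<in> C" for W W' f p
  proof -
    have "W' f = (\<Sum>j\<in>I. coef W' j * X j f)"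
      by (rule ext) (simp add: apply_expand[OF W(2)] sum_fun_apply)
    then have "W (W' f) = (\<Sum>j\<in>I. W (coef W' j * X j f))"
      using VF_sum[OF W(1), of I "\<lambda>j. coef W' j * X j f"] by (simp add: C_mult coef_C W VF_C X_VF)
    also have "\<dots> = (\<Sum>j\<in>I. coef W' j * W (X j f) + X j f * W (coef W' j))"
      by (intro sum.cong refl VF_mult) (auto intro: coef_C W VF_C[OF X_VF])
    finally show ?thesis by (simp add: sum_fun_apply sum.distrib mult.commute)
  qed
  have "lie_bracket Y Z = combine h"
  proof (rule VF_eqI[OF VF_bracket[OF Y Z] combine_VF[OF hC]])
    fix f p assume f: "f \<in> C"
    have br: "X i (X j f) p - X j (X i f) p = (\<Sum>k\<in>I. c i j k * X k f p)" if "i \<in> I" "j \<in> I" for i j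
      using fun_cong[OF fun_cong[OF X_bracket[OF that], of f], of p]
      by (simp add: lie_bracket_def sum_fun_apply scaleR_fun_def)
    have cross: "(\<Sum>j\<in>I. coef Z j p * Y (X j f) p) - (\<Sum>j\<in>I. coef Y j p * Z (X j f) p)
        = (\<Sum>k\<in>I. (\<Sum>i\<in>I. \<Sum>j\<in>I. c i j k * coef Y i p * coef Z j p) * X k f p)"
    proof -
      have 1: "(\<Sum>j\<in>I. coef Z j p * Y (X j f) p) = (\<Sum>i\<in>I. \<Sum>j\<in>I. coef Y i p * coef Z j p * X i (X j f) p)"
        by (subst sum.swap) (simp add: apply_expand[OF Y] sum_distrib_left mult_ac)
      have 2: "(\<Sum>j\<in>I. coef Y j p * Z (X j f) p) = (\<Sum>i\<in>I. \<Sum>j\<in>I. coef Y i p * coef Z j p * X j (X i f) p)"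
        by (simp add: apply_expand[OF Z] sum_distrib_left mult_ac)
      have "(\<Sum>j\<in>I. coef Z j p * Y (X j f) p) - (\<Sum>j\<in>I. coef Y j p * Z (X j f) p)
        = (\<Sum>i\<in>I. \<Sum>j\<in>I. coef Y i p * coef Z j p * (X i (X j f) p - X j (X i f) p))"
        unfolding 1 2 by (simp add: sum_subtractf right_diff_distrib)
      also have "\<dots> = (\<Sum>i\<in>I. \<Sum>j\<in>I. \<Sum>k\<in>I. c i j k * coef Y i p * coef Z j p * X k f p)"
        by (intro sum.cong refl) (simp add: br sum_distrib_left mult_ac)
      also have "\<dots> = (\<Sum>k\<in>I. \<Sum>i\<in>I. \<Sum>j\<in>I. c i j k * coef Y i p * coef Z j p * X k f p)"
        by (rule sum3_rotate')
      finally show ?thesis by (simp add: sum_distrib_right)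
    qed
    have "lie_bracket Y Z f p = Y (Z f) p - Z (Y f) p" by (simp add: lie_bracket_def)
    also have "\<dots> = (\<Sum>j\<in>I. coef Z j p * Y (X j f) p) - (\<Sum>j\<in>I. coef Y j p * Z (X j f) p)
       + (\<Sum>k\<in>I. (Y (coef Z k) p - Z (coef Y k) p) * X k f p)"
      using app[OF Y Z f, of p] app[OF Z Y f, of p] by (simp add: sum_subtractf left_diff_distrib)
    also have "\<dots> = (\<Sum>k\<in>I. h k p * X k f p)"
      unfolding cross hp by (simp add: sum.distrib[symmetric] distrib_right add.commute)
    also have "\<dots> = combine h f p" by (simp add: combine_def sum_fun_apply fun_times_vf_def)
    finally show "lie_bracket Y Z f p = combine h f p" .
  qed
  then show ?thesis by (simp add: coef_combine[OF k] hp)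
qed

text \<open>
  The connection with Christoffel symbols \<open>\<langle>\<nabla>\<^sub>i e\<^sub>j, e\<^sub>k\<rangle> = c\<^sub>k\<^sub>j\<^sub>i\<close>, which is what the Koszul formula gives
  for a cyclic frame.
\<close>

definition nabla :: "'m vfield \<Rightarrow> 'm vfield \<Rightarrow> 'm vfield" where
  "nabla Y Z = combine (\<lambda>k. Y (coef Z k) + (\<Sum>i\<in>I. \<Sum>j\<in>I. c k j i *\<^sub>R (coef Y i * coef Z j)))"

lemma nabla_VF: "Y \<in> VF \<Longrightarrow> Z \<in> VF \<Longrightarrow> nabla Y Z \<in> VF"
  unfolding nabla_def by (intro combine_VF C_add C_sum C_scale C_mult coef_C VF_C[of Y])

lemma coef_nabla:
  "k \<in> I \<Longrightarrow> coef (nabla Y Z) k p = Y (coef Z k) p + (\<Sum>i\<in>I. \<Sum>j\<in>I. c k j i * coef Y i p * coef Z j p)"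
  by (simp add: nabla_def coef_combine sum_fun_apply scaleR_fun_def mult.assoc)

lemma nabla_torsion:
  assumes Y: "Y \<in> VF" and Z: "Z \<in> VF"
  shows "nabla Y Z - nabla Z Y = lie_bracket Y Z"
proof (rule VF_eq_coef[OF VF_minus[OF nabla_VF[OF Y Z] nabla_VF[OF Z Y]] VF_bracket[OF Y Z]], rule ext)
  fix k p assume k: "k \<in> I"
  have "(\<Sum>i\<in>I. \<Sum>j\<in>I. c k j i * coef Z i p * coef Y j p) = (\<Sum>i\<in>I. \<Sum>j\<in>I. c k i j * coef Z j p * coef Y i p)"
    by (rule sum.swap)
  also have "\<dots> = (\<Sum>i\<in>I. \<Sum>j\<in>I. c k i j * coef Y i p * coef Z j p)" by (simp add: mult_ac)
  finally have "(\<Sum>i\<in>I. \<Sum>j\<in>I. c k j i * coef Y i p * coef Z j p) - (\<Sum>i\<in>I. \<Sum>j\<in>I. c k j i * coef Z i p * coef Y j p)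
      = (\<Sum>i\<in>I. \<Sum>j\<in>I. (c k j i - c k i j) * coef Y i p * coef Z j p)"
    by (simp add: sum_subtractf left_diff_distrib)
  also have "\<dots> = (\<Sum>i\<in>I. \<Sum>j\<in>I. c i j k * coef Y i p * coef Z j p)"
  proof (intro sum.cong refl)
    fix i j
    have "c k j i - c k i j = c i j k" using str.cyclic[of i j k] str.antisym[of j k i] by simp
    then show "(c k j i - c k i j) * coef Y i p * coef Z j p = c i j k * coef Y i p * coef Z j p" by simp
  qed
  finally show "coef (nabla Y Z - nabla Z Y) k p = coef (lie_bracket Y Z) k p"
    by (simp add: coef_diff nabla_VF Y Z k coef_nabla coef_bracket)
qed

lemma nabla_metric:
  assumes Y: "Y \<in> VF" and Z: "Z \<in> VF" and W: "W \<in> VF"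
  shows "Y (metric_fun g Z W) = metric_fun g (nabla Y Z) W + metric_fun g Z (nabla Y W)"
proof
  fix p
  have "Y (metric_fun g Z W) = (\<Sum>k\<in>I. Y (coef Z k * coef W k))"
    unfolding metric_fun_expand[OF Z W] by (rule VF_sum[OF Y]) (intro C_mult coef_C Z W)
  also have "\<dots> = (\<Sum>k\<in>I. coef Z k * Y (coef W k) + coef W k * Y (coef Z k))"
    by (intro sum.cong refl VF_mult[OF Y] coef_C Z W)
  finally have 1: "Y (metric_fun g Z W) p = (\<Sum>k\<in>I. coef Z k p * Y (coef W k) p) + (\<Sum>k\<in>I. coef W k p * Y (coef Z k) p)"
    by (simp add: sum_fun_apply sum.distrib)
  let ?P = "\<Sum>k\<in>I. \<Sum>i\<in>I. \<Sum>j\<in>I. c k j i * coef Y i p * coef Z j p * coef W k p"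
  let ?Q = "\<Sum>k\<in>I. \<Sum>i\<in>I. \<Sum>j\<in>I. c k j i * coef Y i p * coef W j p * coef Z k p"
  have 2: "metric_fun g (nabla Y Z) W p = (\<Sum>k\<in>I. coef W k p * Y (coef Z k) p) + ?P"
    by (simp add: metric_fun_expand[OF nabla_VF[OF Y Z] W] sum_fun_apply coef_nabla distrib_right
        sum.distrib sum_distrib_right mult.commute[of "coef W _ p"])
  have 3: "metric_fun g Z (nabla Y W) p = (\<Sum>k\<in>I. coef Z k p * Y (coef W k) p) + ?Q"
    by (simp add: metric_fun_expand[OF Z nabla_VF[OF Y W]] sum_fun_apply coef_nabla distrib_left
        sum.distrib sum_distrib_left mult_ac)
  have "?Q = (\<Sum>k\<in>I. \<Sum>i\<in>I. \<Sum>j\<in>I. c j k i * coef Y i p * coef W k p * coef Z j p)"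
    by (rule sum3_reverse)
  also have "\<dots> = (\<Sum>k\<in>I. \<Sum>i\<in>I. \<Sum>j\<in>I. - (c k j i * coef Y i p * coef Z j p * coef W k p))"
  proof (intro sum.cong refl)
    fix k i j
    show "c j k i * coef Y i p * coef W k p * coef Z j p = - (c k j i * coef Y i p * coef Z j p * coef W k p)"
      using str.antisym[of j k i] by simp
  qed
  finally have "?Q = - ?P" by (simp add: sum_negf)
  then show "Y (metric_fun g Z W) p = (metric_fun g (nabla Y Z) W + metric_fun g Z (nabla Y W)) p"
    by (simp add: 1 2 3)
qed

lemma nabla_affine: "affine_connection A nabla"
  unfolding affine_connection_def
proof (intro conjI ballI)
  fix Y Z assume "Y \<in> VF" "Z \<in> VF" then show "nabla Y Z \<in> VF" by (rule nabla_VF)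
next
  fix Y Y' Z assume h: "Y \<in> VF" "Y' \<in> VF" "Z \<in> VF"
  show "nabla (Y + Y') Z = nabla Y Z + nabla Y' Z"
    by (rule VF_eq_coef, (intro nabla_VF VF_plus h)+, rule ext)
       (simp add: coef_nabla coef_add h nabla_VF VF_plus distrib_left distrib_right sum.distrib)
next
  fix Y Z Z' assume h: "Y \<in> VF" "Z \<in> VF" "Z' \<in> VF"
  show "nabla Y (Z + Z') = nabla Y Z + nabla Y Z'"
    by (rule VF_eq_coef, (intro nabla_VF VF_plus h)+, rule ext)
       (simp add: coef_nabla coef_add h nabla_VF VF_plus VF_add coef_C distrib_left distrib_right sum.distrib)
next
  fix Y Z f assume h: "Y \<in> VF" "Z \<in> VF" "f \<in> C"
  show "nabla (fun_times_vf f Y) Z = fun_times_vf f (nabla Y Z)"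
    by (rule VF_eq_coef, (intro nabla_VF VF_fun_times h)+, rule ext)
       (simp add: coef_nabla coef_fun_times h nabla_VF VF_fun_times fun_times_apply sum_distrib_left distrib_left mult_ac)
  show "nabla Y (fun_times_vf f Z) = fun_times_vf (Y f) Z + fun_times_vf f (nabla Y Z)"
    by (rule VF_eq_coef, (intro nabla_VF VF_fun_times VF_plus VF_C[of Y] h)+, rule ext)
       (simp add: coef_nabla coef_fun_times coef_add h nabla_VF VF_fun_times VF_C VF_mult coef_C
         sum_distrib_left distrib_left mult_ac)
qed

text \<open>
  The difference of two such connections, paired with a third field, is symmetric in the first two
  arguments (no torsion) and skew in the last two (metric), hence zero. This is the Koszul argument.
\<close>

lemma levi_civita_unique:
  assumes D: "levi_civita_connection A g D" and D': "levi_civita_connection A g D'"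
    and Y: "Y \<in> VF" and Z: "Z \<in> VF"
  shows "D Y Z = D' Y Z"
proof -
  have DVF: "D Y Z \<in> VF" "D' Y Z \<in> VF" if "Y \<in> VF" "Z \<in> VF" for Y Z
    using D D' that by (auto simp: levi_civita_connection_def affine_connection_def)
  define S where "S = (\<lambda>Y Z W p. g p (value_at (D Y Z) p) (value_at W p) - g p (value_at (D' Y Z) p) (value_at W p))"
  have symm: "S Y Z W p = S Z Y W p" if "Y \<in> VF" "Z \<in> VF" "W \<in> VF" for Y Z W p
  proof -
    have "D Y Z - D Z Y = D' Y Z - D' Z Y" using D D' that by (simp add: levi_civita_connection_def)
    then have "value_at (D Y Z) p - value_at (D Z Y) p = value_at (D' Y Z) p - value_at (D' Z Y) p"
      by (metis value_at_diff)
    then have "g p (value_at (D Y Z) p - value_at (D Z Y) p) (value_at W p)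
       = g p (value_at (D' Y Z) p - value_at (D' Z Y) p) (value_at W p)" by simp
    then show ?thesis using that DVF by (simp add: S_def inner.ip_diff VF_value)
  qed
  have skew: "S Y Z W p = - S Y W Z p" if "Y \<in> VF" "Z \<in> VF" "W \<in> VF" for Y Z W p
  proof -
    have "metric_fun g (D Y Z) W + metric_fun g Z (D Y W) = metric_fun g (D' Y Z) W + metric_fun g Z (D' Y W)"
    proof -
      have "Y (metric_fun g Z W) = metric_fun g (D Y Z) W + metric_fun g Z (D Y W)"
        using D that unfolding levi_civita_connection_def by blast
      moreover have "Y (metric_fun g Z W) = metric_fun g (D' Y Z) W + metric_fun g Z (D' Y W)"
        using D' that unfolding levi_civita_connection_def by blast
      ultimately show ?thesis by (rule trans[OF sym])
    qed
    from fun_cong[OF this, of p] show ?thesis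
      using that DVF by (simp add: S_def metric_fun_def inner.ip_commute[OF VF_value[OF \<open>Z \<in> VF\<close>] VF_value])
  qed
  have zero: "S Y Z W p = 0" if "W \<in> VF" for W p
    using symm[OF Y Z that, of p] skew[OF Z Y that, of p] symm[OF Z that Y, of p] skew[OF that Z Y, of p]
      symm[OF that Y Z, of p] skew[OF Y that Z, of p] by linarith
  show ?thesis
  proof (rule VF_eq_coef[OF DVF(1)[OF Y Z] DVF(2)[OF Y Z]], rule ext)
    fix k p assume "k \<in> I"
    from zero[OF X_VF[OF this], of p] show "coef (D Y Z) k p = coef (D' Y Z) k p"
      by (simp add: S_def coef_at)
  qed
qed

lemma levi_civita_connection_cong:
  assumes D: "levi_civita_connection A g D" and eq: "\<And>Y Z. Y \<in> VF \<Longrightarrow> Z \<in> VF \<Longrightarrow> D' Y Z = D Y Z"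
  shows "levi_civita_connection A g D'"
proof -
  have "affine_connection A D" using D by (simp add: levi_civita_connection_def)
  then have "affine_connection A D'"
    unfolding affine_connection_def by (simp add: eq VF_plus VF_fun_times)
  moreover have "D Y Z \<in> VF" if "Y \<in> VF" "Z \<in> VF" for Y Z
    using \<open>affine_connection A D\<close> that by (simp add: affine_connection_def)
  moreover have "D Y Z - D Z Y = lie_bracket Y Z" if "Y \<in> VF" "Z \<in> VF" for Y Z
    using D that by (simp add: levi_civita_connection_def)
  moreover have "Y (metric_fun g Z W) = metric_fun g (D Y Z) W + metric_fun g Z (D Y W)"
    if "Y \<in> VF" "Z \<in> VF" "W \<in> VF" for Y Z W
    using D that unfolding levi_civita_connection_def by blast
  ultimately show ?thesis
    unfolding levi_civita_connection_def by (intro conjI ballI) (simp_all only: eq)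
qed

lemma nabla_levi_civita: "levi_civita_connection A g nabla"
  unfolding levi_civita_connection_def using nabla_affine nabla_torsion nabla_metric by blast

text \<open>
  Outside the vector fields the connection chosen by \<open>levi_civita\<close> is zero by convention, hence the
  truncation of \<open>nabla\<close>.
\<close>

lemma levi_civita_eq_nabla:
  assumes "Y \<in> VF" "Z \<in> VF"
  shows "levi_civita A g Y Z = nabla Y Z"
proof -
  define D where "D = (\<lambda>Y Z. if Y \<in> VF \<and> Z \<in> VF then nabla Y Z else 0)"
  have D: "levi_civita_connection A g D"
    by (rule levi_civita_connection_cong[OF nabla_levi_civita]) (simp add: D_def)
  have "levi_civita A g = D"
    unfolding levi_civita_def
  proof (rule the_equality)
    show "levi_civita_connection A g D \<and> (\<forall>X Y. X \<notin> VF \<or> Y \<notin> VF \<longrightarrow> D X Y = 0)"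
      using D by (simp add: D_def)
    fix D' assume D': "levi_civita_connection A g D' \<and> (\<forall>X Y. X \<notin> VF \<or> Y \<notin> VF \<longrightarrow> D' X Y = 0)"
    show "D' = D"
    proof (intro ext)
      fix Y Z
      show "D' Y Z f p = D Y Z f p" for f p
        using D' levi_civita_unique[OF _ D, of D' Y Z]
        by (cases "Y \<in> VF \<and> Z \<in> VF") (auto simp: D_def)
    qed
  qed
  with assms show ?thesis by (simp add: D_def)
qed

lemma coef_nabla_nabla:
  assumes Y: "Y \<in> VF" and Z: "Z \<in> VF" and W: "W \<in> VF" and l: "l \<in> I"
  shows "coef (nabla Y (nabla Z W)) l p = Y (Z (coef W l)) p
    + (\<Sum>j\<in>I. \<Sum>k\<in>I. c l k j * Y (coef Z j) p * coef W k p)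
    + (\<Sum>j\<in>I. \<Sum>k\<in>I. c l k j * coef Z j p * Y (coef W k) p)
    + (\<Sum>i\<in>I. \<Sum>m\<in>I. c l m i * coef Y i p * Z (coef W m) p)
    + (\<Sum>i\<in>I. \<Sum>j\<in>I. \<Sum>k\<in>I. coef Y i p * coef Z j p * coef W k p * (\<Sum>m\<in>I. c m k j * c l m i))"
proof -
  have "coef (nabla Z W) l = Z (coef W l) + (\<Sum>j\<in>I. \<Sum>k\<in>I. c l k j *\<^sub>R (coef Z j * coef W k))"
    unfolding nabla_def by (rule coef_combine[OF l])
  then have "Y (coef (nabla Z W) l) = Y (Z (coef W l)) + Y (\<Sum>j\<in>I. \<Sum>k\<in>I. c l k j *\<^sub>R (coef Z j * coef W k))"
    by (simp add: VF_add[OF Y VF_C[OF Z coef_C[OF W l]]] C_sum C_scale C_mult coef_C Z W)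
  also have "Y (\<Sum>j\<in>I. \<Sum>k\<in>I. c l k j *\<^sub>R (coef Z j * coef W k))
      = (\<Sum>j\<in>I. \<Sum>k\<in>I. c l k j *\<^sub>R (coef Z j * Y (coef W k) + coef W k * Y (coef Z j)))"
    by (simp add: VF_sum[OF Y] VF_scale[OF Y] VF_mult[OF Y] C_sum C_scale C_mult coef_C Z W)
  finally have 1: "Y (coef (nabla Z W) l) p = Y (Z (coef W l)) p
    + (\<Sum>j\<in>I. \<Sum>k\<in>I. c l k j * Y (coef Z j) p * coef W k p)
    + (\<Sum>j\<in>I. \<Sum>k\<in>I. c l k j * coef Z j p * Y (coef W k) p)"
    by (simp add: sum_fun_apply scaleR_fun_def sum.distrib[symmetric] algebra_simps)
  have "(\<Sum>i\<in>I. \<Sum>m\<in>I. c l m i * coef Y i p * coef (nabla Z W) m p)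
     = (\<Sum>i\<in>I. \<Sum>m\<in>I. c l m i * coef Y i p * Z (coef W m) p)
     + (\<Sum>i\<in>I. \<Sum>m\<in>I. \<Sum>j\<in>I. \<Sum>k\<in>I. coef Y i p * coef Z j p * coef W k p * (c m k j * c l m i))"
    by (simp add: coef_nabla distrib_left sum.distrib sum_distrib_left mult_ac)
  also have "(\<Sum>i\<in>I. \<Sum>m\<in>I. \<Sum>j\<in>I. \<Sum>k\<in>I. coef Y i p * coef Z j p * coef W k p * (c m k j * c l m i))
     = (\<Sum>i\<in>I. \<Sum>j\<in>I. \<Sum>k\<in>I. coef Y i p * coef Z j p * coef W k p * (\<Sum>m\<in>I. c m k j * c l m i))"
    unfolding sum_distrib_left by (intro sum.cong refl sum3_rotate)
  finally show ?thesis by (simp add: coef_nabla[OF l] 1)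
qed

text \<open>
  All terms that differentiate the components of \<open>Y\<close>, \<open>Z\<close> or \<open>W\<close> cancel. What remains is tensorial, with
  the components \<open>R\<close>.
\<close>

lemma coef_curvature:
  assumes Y: "Y \<in> VF" and Z: "Z \<in> VF" and W: "W \<in> VF" and l: "l \<in> I"
  shows "coef (curvature A g Y Z W) l p =
    (\<Sum>i\<in>I. \<Sum>j\<in>I. \<Sum>k\<in>I. coef Y i p * coef Z j p * coef W k p * str.R i j k l)"
proof -
  note YZ = VF_bracket[OF Y Z]
  let ?s = "\<lambda>i j k. coef Y i p * coef Z j p * coef W k p"
  have cv: "curvature A g Y Z W = nabla Y (nabla Z W) - nabla Z (nabla Y W) - nabla (lie_bracket Y Z) W"
    by (simp add: curvature_def Let_def levi_civita_eq_nabla nabla_VF Y Z W YZ)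
  have br: "coef (nabla (lie_bracket Y Z) W) l p = Y (Z (coef W l)) p - Z (Y (coef W l)) p
    + (\<Sum>j\<in>I. \<Sum>k\<in>I. c l k j * Y (coef Z j) p * coef W k p)
    - (\<Sum>j\<in>I. \<Sum>k\<in>I. c l k j * Z (coef Y j) p * coef W k p)
    + (\<Sum>i\<in>I. \<Sum>j\<in>I. \<Sum>k\<in>I. ?s i j k * (\<Sum>m\<in>I. c i j m * c l k m))"
  proof -
    have "(\<Sum>m\<in>I. \<Sum>k\<in>I. c l k m * coef (lie_bracket Y Z) m p * coef W k p)
      = (\<Sum>j\<in>I. \<Sum>k\<in>I. c l k j * Y (coef Z j) p * coef W k p)
      - (\<Sum>j\<in>I. \<Sum>k\<in>I. c l k j * Z (coef Y j) p * coef W k p)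
      + (\<Sum>m\<in>I. \<Sum>k\<in>I. \<Sum>i\<in>I. \<Sum>j\<in>I. ?s i j k * (c i j m * c l k m))"
      by (simp add: coef_bracket[OF Y Z] distrib_left distrib_right right_diff_distrib left_diff_distrib
          sum.distrib sum_subtractf sum_distrib_left sum_distrib_right mult_ac)
    also have "(\<Sum>m\<in>I. \<Sum>k\<in>I. \<Sum>i\<in>I. \<Sum>j\<in>I. ?s i j k * (c i j m * c l k m))
       = (\<Sum>i\<in>I. \<Sum>j\<in>I. \<Sum>k\<in>I. \<Sum>m\<in>I. ?s i j k * (c i j m * c l k m))"
    proof -
      have "(\<Sum>m\<in>I. \<Sum>k\<in>I. \<Sum>i\<in>I. \<Sum>j\<in>I. ?s i j k * (c i j m * c l k m))
         = (\<Sum>m\<in>I. \<Sum>i\<in>I. \<Sum>j\<in>I. \<Sum>k\<in>I. ?s i j k * (c i j m * c l k m))"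
        by (intro sum.cong refl sum3_rotate)
      also have "\<dots> = (\<Sum>i\<in>I. \<Sum>j\<in>I. \<Sum>m\<in>I. \<Sum>k\<in>I. ?s i j k * (c i j m * c l k m))"
        by (rule sum3_rotate)
      also have "\<dots> = (\<Sum>i\<in>I. \<Sum>j\<in>I. \<Sum>k\<in>I. \<Sum>m\<in>I. ?s i j k * (c i j m * c l k m))"
        by (intro sum.cong refl sum.swap)
      finally show ?thesis .
    qed
    finally show ?thesis
      unfolding coef_nabla[OF l] by (simp only:) (simp add: lie_bracket_apply sum_distrib_left)
  qed
  have sw: "(\<Sum>i\<in>I. \<Sum>j\<in>I. \<Sum>k\<in>I. coef Z i p * coef Y j p * coef W k p * (\<Sum>m\<in>I. c m k j * c l m i))
     = (\<Sum>i\<in>I. \<Sum>j\<in>I. \<Sum>k\<in>I. ?s i j k * (\<Sum>m\<in>I. c m k i * c l m j))"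
    by (subst sum.swap) (simp add: mult_ac)
  have "coef (curvature A g Y Z W) l p
      = (\<Sum>i\<in>I. \<Sum>j\<in>I. \<Sum>k\<in>I. ?s i j k * (\<Sum>m\<in>I. c m k j * c l m i))
      - (\<Sum>i\<in>I. \<Sum>j\<in>I. \<Sum>k\<in>I. ?s i j k * (\<Sum>m\<in>I. c m k i * c l m j))
      - (\<Sum>i\<in>I. \<Sum>j\<in>I. \<Sum>k\<in>I. ?s i j k * (\<Sum>m\<in>I. c i j m * c l k m))"
    unfolding cv
    by (simp add: coef_diff nabla_VF VF_minus Y Z W YZ l br coef_nabla_nabla[OF Y Z W l] coef_nabla_nabla[OF Z Y W l] sw)
  also have "\<dots> = (\<Sum>i\<in>I. \<Sum>j\<in>I. \<Sum>k\<in>I. ?s i j k * str.R i j k l)"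
    by (simp add: str.R_def sum_subtractf right_diff_distrib)
  finally show ?thesis .
qed

end

section \<open>Sectional, Ricci and scalar curvature in the frame\<close>

context framed_manifold begin

abbreviation co where "co p u i \<equiv> g p u (Xp i p)"

lemma curvature_VF: "Y \<in> VF \<Longrightarrow> Z \<in> VF \<Longrightarrow> W \<in> VF \<Longrightarrow> curvature A g Y Z W \<in> VF"
  by (simp add: curvature_def Let_def levi_civita_eq_nabla nabla_VF VF_bracket VF_minus)

text \<open>
  The field with constant components in the frame extends \<open>u\<close>, so the choice in \<open>extension\<close> is from a
  nonempty set.
\<close>

lemma extension:
  assumes u: "u \<in> T p"
  shows "extension A p u \<in> VF" "value_at (extension A p u) p = u"
proof -
  let ?Y = "\<Sum>i\<in>I. co p u i *\<^sub>R X i"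
  have "?Y \<in> VF" by (intro VF_sums VF_scaleR X_VF)
  moreover have "value_at ?Y p = u"
    unfolding value_at_sum value_at_scaleR by (rule X_span[OF u, symmetric])
  ultimately have "extension A p u \<in> VF \<and> value_at (extension A p u) p = u"
    unfolding extension_def by - (rule someI[where x = ?Y], simp)
  then show "extension A p u \<in> VF" "value_at (extension A p u) p = u" by auto
qed

lemma curvature_at_T: "u \<in> T p \<Longrightarrow> v \<in> T p \<Longrightarrow> w \<in> T p \<Longrightarrow> curvature_at A g p u v w \<in> T p"
  unfolding curvature_at_def by (intro VF_value curvature_VF extension)

lemma curvature_at_component:
  assumes "u \<in> T p" "v \<in> T p" "w \<in> T p" "l \<in> I"
  shows "co p (curvature_at A g p u v w) l =
    (\<Sum>i\<in>I. \<Sum>j\<in>I. \<Sum>k\<in>I. co p u i * co p v j * co p w k * str.R i j k l)"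
  using coef_curvature[OF extension(1)[OF assms(1)] extension(1)[OF assms(2)] extension(1)[OF assms(3)] assms(4), of p]
  by (simp only: coef_at curvature_at_def extension(2)[OF assms(1)] extension(2)[OF assms(2)] extension(2)[OF assms(3)])

lemma g_expand: "u \<in> T p \<Longrightarrow> v \<in> T p \<Longrightarrow> g p u v = (\<Sum>l\<in>I. co p u l * co p v l)"
proof -
  assume u: "u \<in> T p" and v: "v \<in> T p"
  have "g p u v = g p (\<Sum>l\<in>I. co p u l *\<^sub>R Xp l p) v"
    by (rule arg_cong[where f = "\<lambda>x. g p x v"], rule X_span[OF u])
  also have "\<dots> = (\<Sum>l\<in>I. co p u l * g p (Xp l p) v)" by (rule inner.ip_comb) (use Xp_T v in auto)
  also have "\<dots> = (\<Sum>l\<in>I. co p u l * co p v l)"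
    by (intro sum.cong refl) (simp add: inner.ip_commute[OF Xp_T v])
  finally show ?thesis .
qed

lemma curvature_form:
  assumes u: "u \<in> T p" and v: "v \<in> T p"
  shows "g p (curvature_at A g p u v v) u =
    (\<Sum>i\<in>I. \<Sum>j\<in>I. \<Sum>k\<in>I. \<Sum>l\<in>I. co p u i * co p v j * co p v k * co p u l * str.R i j k l)"
proof -
  have "g p (curvature_at A g p u v v) u = (\<Sum>l\<in>I. (\<Sum>i\<in>I. \<Sum>j\<in>I. \<Sum>k\<in>I. co p u i * co p v j * co p v k * str.R i j k l) * co p u l)"
    by (subst g_expand[OF curvature_at_T[OF u v v] u]) (simp add: curvature_at_component[OF u v v])
  also have "\<dots> = (\<Sum>l\<in>I. \<Sum>i\<in>I. \<Sum>j\<in>I. \<Sum>k\<in>I. co p u i * co p v j * co p v k * co p u l * str.R i j k l)"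
    by (simp add: sum_distrib_right sum_distrib_left mult_ac)
  also have "\<dots> = (\<Sum>i\<in>I. \<Sum>j\<in>I. \<Sum>l\<in>I. \<Sum>k\<in>I. co p u i * co p v j * co p v k * co p u l * str.R i j k l)"
    by (rule sum3_rotate)
  also have "\<dots> = (\<Sum>i\<in>I. \<Sum>j\<in>I. \<Sum>k\<in>I. \<Sum>l\<in>I. co p u i * co p v j * co p v k * co p u l * str.R i j k l)"
    by (intro sum.cong refl sum.swap)
  finally show ?thesis .
qed

lemma T_eqI: "u \<in> T p \<Longrightarrow> v \<in> T p \<Longrightarrow> (\<And>l. l \<in> I \<Longrightarrow> co p u l = co p v l) \<Longrightarrow> u = v"
proof -
  assume u: "u \<in> T p" and v: "v \<in> T p" and eq: "\<And>l. l \<in> I \<Longrightarrow> co p u l = co p v l"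
  have "u = (\<Sum>l\<in>I. co p u l *\<^sub>R Xp l p)" by (rule X_span[OF u])
  also have "\<dots> = (\<Sum>l\<in>I. co p v l *\<^sub>R Xp l p)" by (rule sum.cong) (auto simp: eq)
  also have "\<dots> = v" by (rule X_span[OF v, symmetric])
  finally show ?thesis .
qed

lemma curvature_at_same: assumes u: "u \<in> T p" and w: "w \<in> T p" shows "curvature_at A g p u u w = 0"
proof (rule T_eqI[OF curvature_at_T[OF u u w] T_zero])
  fix l assume l: "l \<in> I"
  let ?S = "\<Sum>i\<in>I. \<Sum>j\<in>I. \<Sum>k\<in>I. co p u i * co p u j * co p w k * str.R i j k l"
  have "?S = (\<Sum>i\<in>I. \<Sum>j\<in>I. \<Sum>k\<in>I. co p u j * co p u i * co p w k * str.R j i k l)"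
    by (rule sum.swap)
  also have "\<dots> = (\<Sum>i\<in>I. \<Sum>j\<in>I. \<Sum>k\<in>I. - (co p u i * co p u j * co p w k * str.R i j k l))"
    by (intro sum.cong refl, subst str.R_skew) simp
  also have "\<dots> = - ?S" by (simp add: sum_negf)
  finally have "?S = 0" by simp
  then show "co p (curvature_at A g p u u w) l = co p 0 l"
    by (simp add: curvature_at_component[OF u u w l] inner.ip_zero Xp_T l)
qed

lemma curvature_form_dependent:
  assumes u: "u \<in> T p" and v: "v \<in> T p" and dep: "v = t *\<^sub>R u \<or> u = t *\<^sub>R v"
  shows "g p (curvature_at A g p u v v) u = 0"
proof -
  have sc: "curvature_at A g p (s *\<^sub>R a) b w = s *\<^sub>R curvature_at A g p a b w"
    "curvature_at A g p a (s *\<^sub>R b) w = s *\<^sub>R curvature_at A g p a b w"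
    if h: "a \<in> T p" "b \<in> T p" "w \<in> T p" for s a b w
    by (rule T_eqI[OF curvature_at_T[OF T_scale[OF h(1)] h(2,3)] T_scale[OF curvature_at_T[OF h]]],
        simp add: curvature_at_component T_scale h inner.ip_scale curvature_at_T Xp_T sum_distrib_left mult_ac)
       (rule T_eqI[OF curvature_at_T[OF h(1) T_scale[OF h(2)] h(3)] T_scale[OF curvature_at_T[OF h]]],
        simp add: curvature_at_component T_scale h inner.ip_scale curvature_at_T Xp_T sum_distrib_left mult_ac)
  have z: "g p (curvature_at A g p w w y) x = 0" if "w \<in> T p" "y \<in> T p" "x \<in> T p" for w y x
    using that by (simp add: curvature_at_same inner.ip_zero)
  from dep show ?thesis
  proof
    assume vt: "v = t *\<^sub>R u"
    have "curvature_at A g p u v v = t *\<^sub>R curvature_at A g p u u v"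
      using sc(2)[OF u u v, of t] vt by simp
    then have "g p (curvature_at A g p u v v) u = t * g p (curvature_at A g p u u v) u"
      by (simp only: inner.ip_scale[OF curvature_at_T[OF u u v] u])
    then show ?thesis using z[OF u v u] by simp
  next
    assume ut: "u = t *\<^sub>R v"
    have "curvature_at A g p u v v = t *\<^sub>R curvature_at A g p v v v"
      using sc(1)[OF v v v, of t] ut by simp
    then have "g p (curvature_at A g p u v v) u = t * g p (curvature_at A g p v v v) u"
      by (simp only: inner.ip_scale[OF curvature_at_T[OF v v v] u])
    then show ?thesis using z[OF v v u] by simp
  qed
qed

lemma frame_inj: "inj_on (\<lambda>i. Xp i p) I"
proof (rule inj_onI)
  fix i j assume "i \<in> I" "j \<in> I" "Xp i p = Xp j p"
  then show "i = j" using X_orthonormal[of i j p] X_orthonormal[of i i p] by (auto split: if_splits)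
qed

lemma frame_orthonormal: "inner.orthonormal p ((\<lambda>i. Xp i p) ` I)"
  unfolding inner.orthonormal_def using Xp_T X_orthonormal inj_onD[OF frame_inj] by auto

lemma frame_span: "span ((\<lambda>i. Xp i p) ` I) = T p"
proof
  show "span ((\<lambda>i. Xp i p) ` I) \<subseteq> T p" by (rule inner.span_orthonormal_subset[OF frame_orthonormal])
  show "T p \<subseteq> span ((\<lambda>i. Xp i p) ` I)"
  proof
    fix v assume "v \<in> T p"
    moreover have "(\<Sum>i\<in>I. co p v i *\<^sub>R Xp i p) \<in> span ((\<lambda>i. Xp i p) ` I)"
      by (intro span_sum span_scale span_base imageI)
    ultimately show "v \<in> span ((\<lambda>i. Xp i p) ` I)" by (rule ssubst[OF X_span])
  qed
qed

lemma ricci_formula: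
  assumes v: "v \<in> T p" and w: "w \<in> T p"
  shows "ricci_curvature A g p v w = (\<Sum>i\<in>I. \<Sum>j\<in>I. \<Sum>k\<in>I. co p v j * co p w k * str.R i j k i)"
proof -
  let ?B = "(\<lambda>i. Xp i p) ` I" and ?L = "\<lambda>u. curvature_at A g p u v w"
  note on = frame_orthonormal[of p]
  have fB: "finite ?B" using str.fin by simp
  have LT: "?L u \<in> T p" if "u \<in> T p" for u by (rule curvature_at_T[OF that v w])
  have "trace_on (T p) ?L = (\<Sum>b\<in>?B. representation ?B (?L b) b)"
  proof (rule trace_on_eq[OF inner.orthonormal_independent[OF on] fB frame_span LT])
    fix u u' assume u: "u \<in> T p" "u' \<in> T p"
    show "?L (u + u') = ?L u + ?L u'"
      by (rule T_eqI[OF LT[OF T_add[OF u]] T_add[OF LT[OF u(1)] LT[OF u(2)]]])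
         (simp add: curvature_at_component T_add u v w inner.ip_add LT Xp_T distrib_right sum.distrib)
  next
    fix a u assume u: "u \<in> T p"
    show "?L (a *\<^sub>R u) = a *\<^sub>R ?L u"
      by (rule T_eqI[OF LT[OF T_scale[OF u]] T_scale[OF LT[OF u]]])
         (simp add: curvature_at_component T_scale u v w inner.ip_scale LT Xp_T sum_distrib_left mult_ac)
  qed
  also have "\<dots> = (\<Sum>b\<in>?B. g p (?L b) b)"
    by (intro sum.cong refl inner.orthonormal_representation[OF on fB]) (use frame_span LT Xp_T in auto)
  also have "\<dots> = (\<Sum>i\<in>I. co p (?L (Xp i p)) i)"
    by (subst sum.reindex[OF frame_inj]) simp
  also have "\<dots> = (\<Sum>i\<in>I. \<Sum>j\<in>I. \<Sum>k\<in>I. co p v j * co p w k * str.R i j k i)"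
  proof (rule sum.cong)
    fix a assume a: "a \<in> I"
    have "co p (?L (Xp a p)) a = (\<Sum>i\<in>I. (\<Sum>j\<in>I. \<Sum>k\<in>I. co p v j * co p w k * str.R i j k a) * (if a = i then 1 else 0))"
      by (simp add: curvature_at_component[OF Xp_T[OF a] v w a] sum_distrib_left sum_distrib_right X_orthonormal[OF a] mult_ac)
    also have "\<dots> = (\<Sum>j\<in>I. \<Sum>k\<in>I. co p v j * co p w k * str.R a j k a)" by (rule sum_times_delta(2)[OF a])
    finally show "co p (?L (Xp a p)) a = (\<Sum>j\<in>I. \<Sum>k\<in>I. co p v j * co p w k * str.R a j k a)" .
  qed simp
  finally show ?thesis by (simp add: ricci_curvature_def)
qed

lemma frame_sectional_curvature:
  assumes i: "i \<in> I" and j: "j \<in> I" and ne: "i \<noteq> j"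
  shows "plane_basis A p (Xp i p) (Xp j p)"
    and "sectional_curvature A g p (Xp i p) (Xp j p) = str.R i j j i"
proof -
  have "Xp i p \<noteq> Xp j p" using inj_onD[OF frame_inj _ i j] ne by auto
  moreover have "independent {Xp i p, Xp j p}"
    by (rule independent_mono[OF inner.orthonormal_independent[OF frame_orthonormal[of p]]]) (use i j in auto)
  ultimately show "plane_basis A p (Xp i p) (Xp j p)" by (simp add: plane_basis_def Xp_T i j)
  have "co p (curvature_at A g p (Xp i p) (Xp j p) (Xp j p)) i
     = (\<Sum>a\<in>I. (\<Sum>b\<in>I. (\<Sum>d\<in>I. str.R a b d i * (if j = d then 1 else 0)) * (if j = b then 1 else 0)) * (if i = a then 1 else 0))"
    by (simp add: curvature_at_component Xp_T i j X_orthonormal sum_distrib_left sum_distrib_right mult_ac)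
  also have "\<dots> = str.R i j j i" by (simp only: sum_times_delta i j)
  finally show "sectional_curvature A g p (Xp i p) (Xp j p) = str.R i j j i"
    using ne by (simp add: sectional_curvature_def X_orthonormal i j)
qed

text \<open>
  The orthonormal basis in the definition of the scalar curvature is an arbitrary one; Parseval's identity
  for it replaces it by the frame.
\<close>

lemma scalar_curvature_formula: "scalar_curvature A g p = (\<Sum>i\<in>I. \<Sum>j\<in>I. str.R i j j i)"
proof -
  define B where "B = (SOME B. orthonormal_basis A g p B)"
  have "orthonormal_basis A g p ((\<lambda>i. Xp i p) ` I)"
    using frame_orthonormal[of p] frame_span by (simp add: orthonormal_basis_def inner.orthonormal_def)
  then have B: "orthonormal_basis A g p B" unfolding B_def by (rule someI)
  then have sp: "span B = T p" and on: "inner.orthonormal p B"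
    using span_superset[of B] by (auto simp: orthonormal_basis_def inner.orthonormal_def)
  have BT: "b \<in> T p" if "b \<in> B" for b using that on by (auto simp: inner.orthonormal_def)
  have fB: "finite B"
    using independent_span_bound[OF _ inner.orthonormal_independent[OF on], of "(\<lambda>i. Xp i p) ` I"]
      str.fin BT by (auto simp: frame_span)
  have pars: "(\<Sum>e\<in>B. co p e j * co p e k) = (if j = k then 1 else 0)" if "j \<in> I" "k \<in> I" for j k
  proof -
    have "co p (Xp j p) k = (\<Sum>e\<in>B. g p (Xp j p) e * g p (Xp k p) e)"
      by (rule inner.parseval[OF on fB]) (use sp Xp_T that in auto)
    also have "\<dots> = (\<Sum>e\<in>B. co p e j * co p e k)"
      by (intro sum.cong refl) (simp add: inner.ip_commute[OF Xp_T BT] that)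
    finally show ?thesis using X_orthonormal[OF that] by simp
  qed
  have "scalar_curvature A g p = (\<Sum>e\<in>B. \<Sum>i\<in>I. \<Sum>j\<in>I. \<Sum>k\<in>I. co p e j * co p e k * str.R i j k i)"
    by (simp add: scalar_curvature_def B_def[symmetric] Let_def ricci_formula BT)
  also have "\<dots> = (\<Sum>i\<in>I. \<Sum>e\<in>B. \<Sum>j\<in>I. \<Sum>k\<in>I. co p e j * co p e k * str.R i j k i)" by (rule sum.swap)
  also have "\<dots> = (\<Sum>i\<in>I. \<Sum>j\<in>I. \<Sum>e\<in>B. \<Sum>k\<in>I. co p e j * co p e k * str.R i j k i)"
    by (intro sum.cong refl sum.swap)
  also have "\<dots> = (\<Sum>i\<in>I. \<Sum>j\<in>I. \<Sum>k\<in>I. \<Sum>e\<in>B. co p e j * co p e k * str.R i j k i)"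
    by (intro sum.cong refl sum.swap)
  also have "\<dots> = (\<Sum>i\<in>I. \<Sum>j\<in>I. \<Sum>k\<in>I. str.R i j k i * (if j = k then 1 else 0))"
    by (intro sum.cong refl) (simp add: sum_distrib_right[symmetric] pars)
  also have "\<dots> = (\<Sum>i\<in>I. \<Sum>j\<in>I. str.R i j j i)"
    by (intro sum.cong refl sum_times_delta)
  finally show ?thesis .
qed

end

section \<open>A left invariant frame adapted to the derived algebra\<close>

locale cyclic_metric_lie_group = lie_group_manifold A G
  for A :: "('g::{t2_space, second_countable_topology}, 'e::euclidean_space) chart set"
    and G :: "'g monoid" (structure) +
  fixes g :: "'g \<Rightarrow> 'g tangent \<Rightarrow> 'g tangent \<Rightarrow> real"
  assumes g_metric: "riemannian_metric A g"
    and g_invariant: "left_invariant_metric G A g"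
    and g_cyclic: "cyclic_metric G A g"
begin

sublocale inner: inner_on "T p" "g p" for p
proof
  show "subspace (T p)" by (rule tangent_space_subspace)
qed (use g_metric in \<open>unfold riemannian_metric_def, blast+\<close>)

abbreviation L where "L \<equiv> left_field"

lemma L_inner: "u \<in> T \<one> \<Longrightarrow> v \<in> T \<one> \<Longrightarrow> g p (value_at (L u) p) (value_at (L v) p) = g \<one> u v"
proof -
  assume u: "u \<in> T \<one>" and v: "v \<in> T \<one>"
  have "g (p \<otimes> \<one>) (push p u) (push p v) = g \<one> u v"
    using g_invariant u v unfolding left_invariant_metric_def by blast
  then show ?thesis
    using push_left_field[OF u, of p \<one>] push_left_field[OF v, of p \<one>] by (simp add: value_at_left_field)
qed

text \<open>
  The bracket of the Lie algebra, transported to the tangent space at the unit.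
\<close>

definition br where "br u v = value_at (lie_bracket (L u) (L v)) \<one>"

lemma br_T: "u \<in> T \<one> \<Longrightarrow> v \<in> T \<one> \<Longrightarrow> br u v \<in> T \<one>"
  unfolding br_def by (intro VF_value VF_bracket left_field_VF)

lemma bracket_L: "u \<in> T \<one> \<Longrightarrow> v \<in> T \<one> \<Longrightarrow> lie_bracket (L u) (L v) = L (br u v)"
  unfolding br_def by (rule LA_eq_left_field[OF LA_bracket[OF left_field_LA left_field_LA]])

lemma br_comb:
  assumes "finite F" "\<And>k. k \<in> F \<Longrightarrow> f k \<in> T \<one>" "v \<in> T \<one>"
  shows "br (\<Sum>k\<in>F. a k *\<^sub>R f k) v = (\<Sum>k\<in>F. a k *\<^sub>R br (f k) v)"
proof -
  have "L (\<Sum>k\<in>F. a k *\<^sub>R f k) = (\<Sum>k\<in>F. a k *\<^sub>R L (f k))"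
    by (simp add: linear_sum[OF left_field_linear] linear_scale[OF left_field_linear])
  then show ?thesis
    unfolding br_def using lie_bracket_comb[OF assms(1), of "\<lambda>k. L (f k)" "L v" a] left_field_VF assms
    by (simp add: value_at_sum value_at_scaleR)
qed

lemma br_swap: "br v u = - br u v"
  unfolding br_def lie_bracket_swap[of "L v" "L u"] by (auto simp: value_at_def fun_eq_iff)

lemma br_comb2:
  assumes "finite F" "\<And>k. k \<in> F \<Longrightarrow> f k \<in> T \<one>" "v \<in> T \<one>"
  shows "br v (\<Sum>k\<in>F. a k *\<^sub>R f k) = (\<Sum>k\<in>F. a k *\<^sub>R br v (f k))"
  unfolding br_swap[of v] using br_comb[OF assms, where a = a] by (simp add: sum_negf)

text \<open>
  Extend an orthonormal basis \<open>E1\<close> of the derived algebra by the Gram-Schmidt process.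
\<close>

lemma adapted_orthonormal_basis:
  obtains E1 E where "finite E" "E1 \<subseteq> E" "inner.orthonormal \<one> E" "span E = T \<one>"
    "span E1 = span {br u v | u v. u \<in> T \<one> \<and> v \<in> T \<one>}"
proof -
  obtain F where F: "finite F" "span F = T \<one>" by (rule T_finite_span)
  let ?D = "{br u v | u v. u \<in> T \<one> \<and> v \<in> T \<one>}"
  have DT: "?D \<subseteq> T \<one>" using br_T by auto
  obtain B where B: "B \<subseteq> ?D" "independent B" "?D \<subseteq> span B"
    using maximal_independent_subset[of ?D] by blast
  have "finite B" using independent_span_bound[OF F(1) B(2)] B(1) DT F(2) by auto
  moreover have "B \<subseteq> T \<one>" using B DT by auto
  moreover have "inner.orthonormal \<one> {}" by (simp add: inner.orthonormal_def)
  ultimately obtain E1 where E1: "inner.orthonormal \<one> E1" "finite E1" "span E1 = span (B \<union> {})"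
    using inner.gram_schmidt[of \<one> "{}" B] by auto
  have sE1: "span E1 = span ?D"
    using E1(3) B(3) span_mono[OF B(1)] span_minimal[OF B(3) subspace_span] by auto
  have "F \<subseteq> T \<one>" using F(2) span_superset by auto
  then obtain E where E: "inner.orthonormal \<one> E" "finite E" "E1 \<subseteq> E" "span E = span (F \<union> E1)"
    using inner.gram_schmidt[OF E1(1,2) F(1)] by auto
  have "span E = T \<one>"
  proof
    show "span E \<subseteq> T \<one>" by (rule inner.span_orthonormal_subset[OF E(1)])
    show "T \<one> \<subseteq> span E" using E(4) F(2) span_mono[of F "F \<union> E1"] by auto
  qed
  then show ?thesis using that E sE1 by blast
qed

end

locale adapted_basis = cyclic_metric_lie_group A G g
  for A :: "('g::{t2_space, second_countable_topology}, 'e::euclidean_space) chart set"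
    and G :: "'g monoid" (structure)
    and g :: "'g \<Rightarrow> 'g tangent \<Rightarrow> 'g tangent \<Rightarrow> real" +
  fixes E E1 :: "'g tangent set"
  assumes E: "finite E" "E1 \<subseteq> E" "inner.orthonormal \<one> E" "span E = T \<one>"
    and E1: "span E1 = span {br u v | u v. u \<in> T \<one> \<and> v \<in> T \<one>}"
begin

text \<open>
  The value 0 outside \<open>E\<close> makes the identities for structure constants hold without restriction on the
  indices.
\<close>

definition c :: "'g tangent \<Rightarrow> 'g tangent \<Rightarrow> 'g tangent \<Rightarrow> real" where
  "c i j k = (if i \<in> E \<and> j \<in> E \<and> k \<in> E then g \<one> (br i j) k else 0)"

lemma E_T: "i \<in> E \<Longrightarrow> i \<in> T \<one>" using E(4) span_base by blast

lemma E_inner: "i \<in> E \<Longrightarrow> j \<in> E \<Longrightarrow> g \<one> i j = (if i = j then 1 else 0)"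
  using E(3) by (simp add: inner.orthonormal_def)

lemma E_expand: "v \<in> T \<one> \<Longrightarrow> v = (\<Sum>k\<in>E. g \<one> v k *\<^sub>R k)"
  by (rule inner.orthonormal_expand[OF E(3,1)]) (simp add: E(4))

lemma br_expand: "i \<in> E \<Longrightarrow> j \<in> E \<Longrightarrow> br i j = (\<Sum>k\<in>E. c i j k *\<^sub>R k)"
  using E_expand[OF br_T[OF E_T E_T], of i j] by (simp add: c_def)

lemma L_bracket_expand: "i \<in> E \<Longrightarrow> j \<in> E \<Longrightarrow> lie_bracket (L i) (L j) = (\<Sum>k\<in>E. c i j k *\<^sub>R L k)"
  unfolding bracket_L[OF E_T E_T]
  by (simp add: br_expand linear_sum[OF left_field_linear] linear_scale[OF left_field_linear])

lemma c_antisym: "c i j k = - c j i k"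
proof -
  have "g \<one> (- u) k = - g \<one> u k" if "u \<in> T \<one>" "k \<in> E" for u
    using inner.ip_scale[OF that(1) E_T[OF that(2)], of "-1"] by simp
  then show ?thesis by (auto simp: c_def br_swap[of i j] br_T E_T)
qed

lemma c_cyclic: "c i j k + c j k i + c k i j = 0"
proof (cases "i \<in> E \<and> j \<in> E \<and> k \<in> E")
  case True
  then have "L i \<in> LA" "L j \<in> LA" "L k \<in> LA" by (auto intro: left_field_LA E_T)
  then have "lie_inner G g (lie_bracket (L i) (L j)) (L k) + lie_inner G g (lie_bracket (L j) (L k)) (L i)
        + lie_inner G g (lie_bracket (L k) (L i)) (L j) = 0"
    using g_cyclic unfolding cyclic_metric_def by blast
  then show ?thesis using True by (simp add: c_def lie_inner_def br_def value_at_left_field)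
qed (auto simp: c_def)

lemma c_jacobi: "(\<Sum>m\<in>E. c i j m * c m k l + c j k m * c m i l + c k i m * c m j l) = 0"
proof (cases "i \<in> E \<and> j \<in> E \<and> k \<in> E \<and> l \<in> E")
  case True
  have VFE: "L i \<in> VF" if "i \<in> E" for i by (rule left_field_VF[OF E_T[OF that]])
  have t: "value_at (lie_bracket (lie_bracket (L i) (L j)) (L k)) \<one> = (\<Sum>m\<in>E. c i j m *\<^sub>R br m k)"
    if "i \<in> E" "j \<in> E" "k \<in> E" for i j k
    using that by (simp add: L_bracket_expand lie_bracket_comb[OF E(1)] VFE value_at_sum value_at_scaleR br_def)
  have gs: "g \<one> (\<Sum>m\<in>E. c i j m *\<^sub>R br m k) l = (\<Sum>m\<in>E. c i j m * c m k l)"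
    if "i \<in> E" "j \<in> E" "k \<in> E" "l \<in> E" for i j k l
    using that by (subst inner.ip_comb) (auto simp: br_T E_T c_def)
  have sT: "(\<Sum>m\<in>E. c i j m *\<^sub>R br m k) \<in> T \<one>" if "k \<in> E" for i j k
    using that by (intro T_sum T_scale br_T E_T)
  have "value_at (lie_bracket (lie_bracket (L i) (L j)) (L k) + lie_bracket (lie_bracket (L j) (L k)) (L i)
      + lie_bracket (lie_bracket (L k) (L i)) (L j)) \<one> = 0"
    using True VFE by (simp add: lie_bracket_jacobi value_at_zero)
  then have "(\<Sum>m\<in>E. c i j m *\<^sub>R br m k) + (\<Sum>m\<in>E. c j k m *\<^sub>R br m i) + (\<Sum>m\<in>E. c k i m *\<^sub>R br m j) = 0"
    using True by (simp add: value_at_add t)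
  then have "g \<one> ((\<Sum>m\<in>E. c i j m *\<^sub>R br m k) + (\<Sum>m\<in>E. c j k m *\<^sub>R br m i) + (\<Sum>m\<in>E. c k i m *\<^sub>R br m j)) l = 0"
    using True by (simp add: inner.ip_zero E_T)
  then show ?thesis
    using True by (simp add: inner.ip_add T_add sT E_T gs sum.distrib)
qed (auto simp: c_def)

sublocale framed_manifold A E c g L
proof unfold_locales
  show "finite E" by (rule E(1))
  show "c i j k = - c j i k" for i j k by (rule c_antisym)
  show "c i j k + c j k i + c k i j = 0" for i j k by (rule c_cyclic)
  show "(\<Sum>m\<in>E. c i j m * c m k l + c j k m * c m i l + c k i m * c m j l) = 0" for i j k l by (rule c_jacobi)
  show "riemannian_metric A g" by (rule g_metric)
  show "L i \<in> VF" if "i \<in> E" for i by (rule left_field_VF[OF E_T[OF that]])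
  show "g p (value_at (L i) p) (value_at (L j) p) = (if i = j then 1 else 0)" if "i \<in> E" "j \<in> E" for i j p
    using that by (simp add: L_inner E_T E_inner)
  show "v = (\<Sum>i\<in>E. g p v (value_at (L i) p) *\<^sub>R value_at (L i) p)" if v: "v \<in> T p" for v p
  proof -
    obtain u where u: "u \<in> T \<one>" "v = value_at (L u) p" by (rule T_eq_left_field[OF v])
    have "L u = (\<Sum>i\<in>E. g \<one> u i *\<^sub>R L i)"
      using arg_cong[OF E_expand[OF u(1)], of L]
      by (simp only: linear_sum[OF left_field_linear] linear_scale[OF left_field_linear])
    from arg_cong[OF this, of "\<lambda>X. value_at X p"]
    have "v = (\<Sum>i\<in>E. g \<one> u i *\<^sub>R value_at (L i) p)" by (simp only: u(2) value_at_sum value_at_scaleR)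
    also have "\<dots> = (\<Sum>i\<in>E. g p v (value_at (L i) p) *\<^sub>R value_at (L i) p)"
      by (intro sum.cong refl) (simp add: u(2) L_inner[OF u(1) E_T])
    finally show ?thesis .
  qed
  show "lie_bracket (L i) (L j) = (\<Sum>k\<in>E. c i j k *\<^sub>R L k)" if "i \<in> E" "j \<in> E" for i j
    by (rule L_bracket_expand[OF that])
qed

text \<open>
  The trace of \<open>ad\<close>, computed in the basis of the Lie algebra that corresponds to \<open>E\<close>.
\<close>

lemma unimodular_trace:
  assumes uni: "unimodular G A"
  shows "(\<Sum>k\<in>E. c i k k) = 0"
proof (cases "i \<in> E")
  case i: True
  have injT: "inj_on L (T \<one>)" by (rule inj_on_inverseI[of _ "\<lambda>X. value_at X \<one>"]) (rule value_at_left_field)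
  have ET: "E \<subseteq> T \<one>" using E_T by blast
  have injE: "inj_on L E" by (rule inj_on_subset[OF injT ET])
  have ind: "independent (L ` E)"
    by (rule linear_independent_injective_image[OF left_field_linear inner.orthonormal_independent[OF E(3)]])
       (simp add: injT E(4))
  have sp: "span (L ` E) = LA"
    by (simp add: linear_span_image[OF left_field_linear] E(4) lie_algebra_eq)
  have "trace_on LA (lie_bracket (L i)) = (\<Sum>b\<in>L ` E. representation (L ` E) (lie_bracket (L i) b) b)"
  proof (rule trace_on_eq[OF ind finite_imageI[OF E(1)] sp])
    note Li = left_field_LA[OF E_T[OF i]]
    show "lie_bracket (L i) X \<in> LA" if "X \<in> LA" for X by (rule LA_bracket[OF Li that])
    show "lie_bracket (L i) (X + Y) = lie_bracket (L i) X + lie_bracket (L i) Y" if "X \<in> LA" "Y \<in> LA" for X Y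
      using lie_bracket_add[of X Y "L i"] lie_bracket_swap[of "L i" "X + Y"] lie_bracket_swap[of "L i" X]
        lie_bracket_swap[of "L i" Y] that Li by (simp add: lie_algebraD)
    show "lie_bracket (L i) (s *\<^sub>R X) = s *\<^sub>R lie_bracket (L i) X" if "X \<in> LA" for s X
      using lie_bracket_scale[of X "L i" s] lie_bracket_swap[of "L i" "s *\<^sub>R X"] lie_bracket_swap[of "L i" X]
        that Li by (simp add: lie_algebraD)
  qed
  also have "\<dots> = (\<Sum>k\<in>E. representation (L ` E) (lie_bracket (L i) (L k)) (L k))"
    by (subst sum.reindex[OF injE]) simp
  also have "\<dots> = (\<Sum>k\<in>E. c i k k)"
  proof (rule sum.cong)
    fix k assume k: "k \<in> E"
    have "representation (L ` E) (lie_bracket (L i) (L k)) (L k) = (\<Sum>m\<in>E. c i k m * representation (L ` E) (L m) (L k))"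
      unfolding L_bracket_expand[OF i k]
      by (subst representation_sum[OF ind]) (auto simp: representation_scale[OF ind] span_base span_scale)
    also have "\<dots> = (\<Sum>m\<in>E. c i k m * (if m = k then 1 else 0))"
      by (intro sum.cong refl) (use inj_onD[OF injE] k in \<open>auto simp: representation_basis[OF ind]\<close>)
    also have "\<dots> = c i k k" by (rule sum_times_delta[OF k])
    finally show "representation (L ` E) (lie_bracket (L i) (L k)) (L k) = c i k k" .
  qed simp
  finally show ?thesis using uni left_field_LA[OF E_T[OF i]] by (simp add: unimodular_def)
qed (simp add: c_def)

lemma bracket_vanishes_outside: "k \<in> E - E1 \<Longrightarrow> c i j k = 0"
proof -
  assume k: "k \<in> E - E1"
  have orth: "g \<one> w k = 0" if w: "w \<in> span E1" for w
  proof -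
    have on1: "inner.orthonormal \<one> E1" and f1: "finite E1"
      using E(1-3) unfolding inner.orthonormal_def by (blast intro: finite_subset)+
    have "g \<one> w k = (\<Sum>b\<in>E1. g \<one> w b * g \<one> k b)"
      by (rule inner.parseval[OF on1 f1 w]) (use k E_T in auto)
    also have "\<dots> = 0" using k E(2) by (intro sum.neutral) (auto simp: E_inner subset_iff)
    finally show ?thesis .
  qed
  have "br i j \<in> span E1" if "i \<in> E" "j \<in> E"
    unfolding E1 by (rule span_base) (use that E_T in blast)
  then show ?thesis using orth by (simp add: c_def)
qed

text \<open>
  The vector with components \<open>x\<close> is orthogonal to the brackets of basis vectors, hence by bilinearity to
  the whole derived algebra, which contains \<open>l\<close>.
\<close>

lemma brackets_span_inside:
  assumes x: "\<And>i j. i \<in> E \<Longrightarrow> j \<in> E \<Longrightarrow> (\<Sum>k\<in>E. c i j k * x k) = 0" and l: "l \<in> E1"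
  shows "x l = 0"
proof -
  define \<xi> where "\<xi> = (\<Sum>k\<in>E. x k *\<^sub>R k)"
  have \<xi>T: "\<xi> \<in> T \<one>" unfolding \<xi>_def by (intro T_sum T_scale E_T)
  have \<xi>k: "g \<one> k \<xi> = x k" if "k \<in> E" for k
    using inner.orthonormal_coefficient[OF E(3,1) order_refl that, of x] that inner.ip_commute[OF E_T[OF that] \<xi>T]
    by (simp add: \<xi>_def)
  have bij: "g \<one> (br i j) \<xi> = 0" if "i \<in> E" "j \<in> E" for i j
  proof -
    have "g \<one> (br i j) \<xi> = (\<Sum>k\<in>E. c i j k * g \<one> k \<xi>)"
      unfolding br_expand[OF that] by (rule inner.ip_comb[OF E_T \<xi>T])
    then show ?thesis using x[OF that] by (simp add: \<xi>k)
  qed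
  have buv: "g \<one> (br u v) \<xi> = 0" if u: "u \<in> T \<one>" and v: "v \<in> T \<one>" for u v
  proof -
    have "br u v = br (\<Sum>i\<in>E. g \<one> u i *\<^sub>R i) (\<Sum>j\<in>E. g \<one> v j *\<^sub>R j)"
      by (rule arg_cong2[of _ _ _ _ br, OF E_expand[OF u] E_expand[OF v]])
    also have "\<dots> = (\<Sum>i\<in>E. g \<one> u i *\<^sub>R (\<Sum>j\<in>E. g \<one> v j *\<^sub>R br i j))"
    proof -
      have sv: "(\<Sum>j\<in>E. g \<one> v j *\<^sub>R j) \<in> T \<one>" by (intro T_sum T_scale E_T)
      have "br i (\<Sum>j\<in>E. g \<one> v j *\<^sub>R j) = (\<Sum>j\<in>E. g \<one> v j *\<^sub>R br i j)" if "i \<in> E" for i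
        by (rule br_comb2[OF E(1) E_T E_T[OF that]])
      then show ?thesis by (simp add: br_comb[OF E(1) E_T sv])
    qed
    finally have e: "br u v = \<dots>" .
    show ?thesis
      unfolding e
      by (simp add: inner.ip_comb \<xi>T T_sum T_scale br_T E_T bij)
  qed
  let ?W = "{w \<in> T \<one>. g \<one> w \<xi> = 0}"
  have "subspace ?W"
    by (auto simp: subspace_def T_zero T_add T_scale inner.ip_zero inner.ip_add inner.ip_scale \<xi>T)
  then have "span {br u v | u v. u \<in> T \<one> \<and> v \<in> T \<one>} \<subseteq> ?W"
    by (intro span_minimal) (auto simp: br_T buv)
  then have "l \<in> ?W" using span_base[OF l] E1 by blast
  then show ?thesis using \<xi>k[of l] l E(2) by auto
qed

end

section \<open>A vanishing bracket makes a connected group abelian\<close>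

lemma smooth_on_locally_lipschitz:
  fixes F :: "'a::euclidean_space \<Rightarrow> real"
  assumes F: "smooth_on S F" and S: "open S" "x \<in> S"
  shows "\<exists>r>0. \<exists>K\<ge>0. \<forall>y\<in>ball x r. \<forall>z\<in>ball x r. \<bar>F y - F z\<bar> \<le> K * norm (y - z)"
proof -
  obtain r where r: "r > 0" "cball x r \<subseteq> S" using S open_contains_cball by blast
  let ?D = "\<lambda>y. frechet_derivative F (at y)"
  have "\<forall>i. \<exists>B. \<forall>y\<in>cball x r. \<bar>?D y i\<bar> \<le> B"
  proof
    fix i
    have "compact ((\<lambda>y. ?D y i) ` cball x r)"
      by (rule compact_continuous_image[OF continuous_on_subset[OF smooth_on_continuous_on[OF smooth_on_frechet_derivative[OF F]] r(2)] compact_cball])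
    then have "bounded ((\<lambda>y. ?D y i) ` cball x r)" by (rule compact_imp_bounded)
    then show "\<exists>B. \<forall>y\<in>cball x r. \<bar>?D y i\<bar> \<le> B" by (simp add: bounded_iff)
  qed
  from choice[OF this] obtain B where B: "\<And>i y. y \<in> cball x r \<Longrightarrow> \<bar>?D y i\<bar> \<le> B i" by blast
  define K where "K = (\<Sum>i\<in>Basis. B i)"
  have B0: "B i \<ge> 0" for i
    by (rule order_trans[OF abs_ge_zero B[of x i]]) (use r in simp)
  have K0: "K \<ge> 0" unfolding K_def by (intro sum_nonneg B0)
  have bound: "norm (?D y w) \<le> K * norm w" if y: "y \<in> ball x r" for y w
  proof -
    have y': "y \<in> cball x r" "y \<in> S" using y r by auto
    have "?D y w = (\<Sum>i\<in>Basis. (w \<bullet> i) *\<^sub>R ?D y i)"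
      by (rule frechet_derivative_expand[OF smooth_on_differentiable[OF F y'(2)]])
    also have "norm \<dots> \<le> (\<Sum>i\<in>Basis. norm ((w \<bullet> i) *\<^sub>R ?D y i))" by (rule norm_sum)
    also have "\<dots> \<le> (\<Sum>i\<in>Basis. norm w * B i)"
    proof (rule sum_mono)
      fix i :: 'a assume "i \<in> Basis"
      then show "norm ((w \<bullet> i) *\<^sub>R ?D y i) \<le> norm w * B i"
        using Basis_le_norm[of i w] B[OF y'(1), of i] by (simp add: abs_mult mult_mono)
    qed
    finally show ?thesis by (simp add: K_def sum_distrib_left mult.commute)
  qed
  have "norm (F y - F z) \<le> K * norm (y - z)" if "y \<in> ball x r" "z \<in> ball x r" for y z
  proof (rule differentiable_bound[OF convex_ball _ _ that])
    fix u assume u: "u \<in> ball x r"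
    then have "u \<in> S" using r by auto
    then show "(F has_derivative ?D u) (at u within ball x r)"
      by (rule has_derivative_at_withinI[OF smooth_on_has_derivative[OF F]])
    show "onorm (?D u) \<le> K" by (rule onorm_le) (rule bound[OF u])
  qed
  then have "\<forall>y\<in>ball x r. \<forall>z\<in>ball x r. \<bar>F y - F z\<bar> \<le> K * norm (y - z)" by simp
  then show ?thesis using r(1) K0 by blast
qed

text \<open>
  A Gronwall argument without differential equations: with \<open>B\<close> made nonnegative, on a ball of radius at most
  \<open>1 / (2 (B + 1))\<close> the mean value inequality bounds the maximum of \<open>norm f\<close> by half of itself.
\<close>

lemma vanishes_near_zero_of_linear_bound:
  fixes f :: "'a::euclidean_space \<Rightarrow> 'b::euclidean_space"
  assumes r: "r > 0" and d: "\<And>x. x \<in> ball x0 r \<Longrightarrow> (f has_derivative f' x) (at x)"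
    and bound: "\<And>x w. x \<in> ball x0 r \<Longrightarrow> norm (f' x w) \<le> B * norm (f x) * norm w"
    and f0: "f x0 = 0"
  shows "\<exists>s>0. s \<le> r \<and> (\<forall>x\<in>ball x0 s. f x = 0)"
proof -
  define B' where "B' = max B 0"
  define s where "s = min (r / 2) (1 / (2 * (B' + 1)))"
  have B': "B' \<ge> 0" "B \<le> B'" by (auto simp: B'_def)
  have s: "s > 0" "s < r" using r B' by (auto simp: s_def)
  have sub: "cball x0 s \<subseteq> ball x0 r" using s by auto
  have "isCont f x" if "x \<in> cball x0 s" for x
    by (rule has_derivative_continuous[OF d[OF subsetD[OF sub that]]])
  then have "continuous_on (cball x0 s) (\<lambda>x. norm (f x))"
    by (intro continuous_on_norm continuous_at_imp_continuous_on ballI)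
  then obtain y where y: "y \<in> cball x0 s" "\<And>x. x \<in> cball x0 s \<Longrightarrow> norm (f x) \<le> norm (f y)"
    using continuous_attains_sup[of "cball x0 s" "\<lambda>x. norm (f x)"] s by auto
  have "norm (f y - f x0) \<le> (B' * norm (f y)) * norm (y - x0)"
  proof (rule differentiable_bound[OF convex_cball])
    fix x assume x: "x \<in> cball x0 s"
    with sub have xr: "x \<in> ball x0 r" by auto
    show "(f has_derivative f' x) (at x within cball x0 s)" by (rule has_derivative_at_withinI[OF d[OF xr]])
    show "onorm (f' x) \<le> B' * norm (f y)"
    proof (rule onorm_le)
      fix w
      have "norm (f' x w) \<le> B * norm (f x) * norm w" by (rule bound[OF xr])
      also have "\<dots> \<le> B' * norm (f y) * norm w"
        using y(2)[OF x] B' by (intro mult_right_mono mult_mono) auto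
      finally show "norm (f' x w) \<le> B' * norm (f y) * norm w" .
    qed
  qed (use y s in auto)
  also have "\<dots> \<le> (B' * norm (f y)) * (1 / (2 * (B' + 1)))"
    using y(1) B' by (intro mult_left_mono) (auto simp: s_def dist_norm norm_minus_commute)
  also have "\<dots> \<le> norm (f y) / 2"
  proof -
    have "B' / (B' + 1) \<le> 1" using B' by simp
    then have "norm (f y) / 2 * (B' / (B' + 1)) \<le> norm (f y) / 2 * 1" by (intro mult_left_mono) auto
    moreover have "(B' * norm (f y)) * (1 / (2 * (B' + 1))) = norm (f y) / 2 * (B' / (B' + 1))"
      using B' by (simp add: field_simps)
    ultimately show ?thesis by linarith
  qed
  finally have "norm (f y) = 0" using f0 by simp
  then have "f x = 0" if "x \<in> ball x0 s" for x
    using y(2)[OF subsetD[OF ball_subset_cball that]] by simp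
  then show ?thesis using s less_imp_le by blast
qed

context smooth_manifold begin

text \<open>
  The function is locally constant by the chart-wise statement; then connectedness applies.
\<close>

lemma zero_derivative_constant:
  assumes conn: "connected (UNIV :: 'm set)" and f: "f \<in> C" and z: "\<And>p w. w \<in> T p \<Longrightarrow> w f = 0"
  shows "f p = f q"
proof -
  let ?S = "{p. f p = f q}"
  have "open ?S"
  proof (rule topological_space_class.openI)
    fix p assume p: "p \<in> ?S"
    obtain U \<phi> where c: "(U, \<phi>) \<in> A" "p \<in> U" by (rule chart_at)
    obtain r where r: "r > 0" "ball (\<phi> p) r \<subseteq> \<phi> ` U"
      using chart_open(2)[OF c(1)] c(2) by (meson imageI openE)
    let ?F = "local_rep (U, \<phi>) f"
    have "\<exists>k. \<forall>x\<in>ball (\<phi> p) r. ?F x = k"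
    proof (rule has_derivative_zero_constant[OF convex_ball])
      fix x assume x: "x \<in> ball (\<phi> p) r"
      with r have xU: "x \<in> \<phi> ` U" by auto
      define q where "q = inv_into U \<phi> x"
      have q: "q \<in> U" "\<phi> q = x" using chart_inv_mem[OF c(1) xU] chart_inv'[OF c(1) xU] by (auto simp: q_def)
      have "frechet_derivative ?F (at x) w = 0" for w
        using z[OF chart_tangent_in_T[OF c(1) q(1), of w]] f q(2) by (simp add: chart_tangent_def)
      then have "frechet_derivative ?F (at x) = (\<lambda>w. 0)" by blast
      then show "(?F has_derivative (\<lambda>h. 0)) (at x within ball (\<phi> p) r)"
        using has_derivative_at_withinI[OF local_rep_has_derivative[OF f c(1) q(1)]] q(2) by simp
    qed
    then obtain k where k: "\<And>x. x \<in> ball (\<phi> p) r \<Longrightarrow> ?F x = k" by blast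
    let ?N = "U \<inter> \<phi> -` ball (\<phi> p) r"
    have fk: "f y = k" if "y \<in> ?N" for y
      using k[of "\<phi> y"] that by (simp add: local_rep_def chart_inv[OF c(1)])
    have "open ?N" by (rule chart_preimage_open[OF c(1) open_ball])
    moreover have "p \<in> ?N" using c r by simp
    moreover have "?N \<subseteq> ?S" using fk fk[OF \<open>p \<in> ?N\<close>] p by auto
    ultimately show "\<exists>T. open T \<and> p \<in> T \<and> T \<subseteq> ?S" by blast
  qed
  moreover have "closed ?S" by (rule closed_Collect_eq[OF C_continuous[OF f] continuous_on_const])
  ultimately have "?S = UNIV" using conn unfolding connected_clopen by auto
  then show ?thesis by (metis (mono_tags, lifting) UNIV_I mem_Collect_eq)
qed

end

context adapted_basis begin

text \<open>
  The right field commutes with the left frame fields, and these commute with each other. So the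
  components of the right field in the frame have zero derivative; they are constant and may be compared at
  the unit.
\<close>

lemma right_field_eq_left_field:
  assumes conn: "connected (UNIV :: 'g set)" and c0: "\<And>i j k. i \<in> E \<Longrightarrow> j \<in> E \<Longrightarrow> k \<in> E \<Longrightarrow> c i j k = 0"
    and u: "u \<in> T \<one>"
  shows "right_field u = L u"
proof (rule VF_eq_coef[OF right_field_VF[OF u] left_field_VF[OF u]], rule ext)
  fix k p assume k: "k \<in> E"
  note R = right_field_VF[OF u]
  have d: "L i (coef (right_field u) k) q = 0" if i: "i \<in> E" for i q
  proof -
    have "coef (lie_bracket (L i) (right_field u)) k q = 0"
      using inner.ip_zero[OF Xp_T[OF k]] by (simp add: left_right_commute[OF E_T[OF i] u] coef_at value_at_zero)
    moreover have "(\<Sum>i\<in>E. \<Sum>j\<in>E. c i j k * y i * z j) = 0" for y z :: "'g tangent \<Rightarrow> real"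
      using c0 k by simp
    ultimately show ?thesis
      using coef_bracket[OF X_VF[OF i] R k, of q] VF_const[OF R] by (simp add: coef_X[OF i k])
  qed
  have dw: "w (coef (right_field u) k) = 0" if w: "w \<in> T q" for w q
  proof -
    have "w (coef (right_field u) k) = (\<Sum>i\<in>E. g q w (value_at (L i) q) * L i (coef (right_field u) k) q)"
      using fun_cong[OF X_span[OF w], of "coef (right_field u) k"]
      by (simp only: sum_fun_apply scaleR_fun_def value_at_def real_scaleR_def)
    then show ?thesis using d by simp
  qed
  have "coef (right_field u) k p = coef (right_field u) k \<one>"
    by (rule zero_derivative_constant[OF conn coef_C[OF R k]]) (rule dw)
  also have "\<dots> = g \<one> u k" by (simp add: coef_at value_at_right_field value_at_left_field)
  also have "\<dots> = coef (L u) k p" by (simp add: coef_at L_inner[OF u E_T[OF k]])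
  finally show "coef (right_field u) k p = coef (L u) k p" .
qed

text \<open>
  In a chart \<open>\<psi>\<close> around \<open>p0 \<otimes> a\<close> consider \<open>\<delta> p = \<psi> (p \<otimes> a) - \<psi> (a \<otimes> p)\<close>. A field that is both left and right
  invariant maps the components of \<open>\<delta>\<close> to differences of one smooth function at \<open>p \<otimes> a\<close> and \<open>a \<otimes> p\<close>, which
  are bounded by a multiple of \<open>norm \<delta>\<close>. As these fields span, the whole derivative of \<open>\<delta>\<close> is so bounded, and
  \<open>\<delta>\<close> vanishes near \<open>p0\<close>.
\<close>

lemma translations_agree_near:
  assumes RL: "\<And>u. u \<in> T \<one> \<Longrightarrow> right_field u = L u" and p0: "p0 \<otimes> a = a \<otimes> p0"
  shows "\<exists>N. open N \<and> p0 \<in> N \<and> (\<forall>p\<in>N. p \<otimes> a = a \<otimes> p)"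
proof -
  define q0 where "q0 = p0 \<otimes> a"
  obtain U \<phi> where c: "(U, \<phi>) \<in> A" "p0 \<in> U" by (rule chart_at)
  obtain V \<psi> where d: "(V, \<psi>) \<in> A" "q0 \<in> V" by (rule chart_at)
  \<comment> \<open>Global functions \<open>\<xi> i\<close> that are the coordinates of \<open>\<psi>\<close> near \<open>q0\<close>.\<close>
  obtain \<xi> N where \<xi>: "\<And>i. \<xi> i \<in> C" "\<And>i. open (N i)" "\<And>i. q0 \<in> N i" "\<And>i. N i \<subseteq> V"
    "\<And>i q. q \<in> N i \<Longrightarrow> \<xi> i q = \<psi> q \<bullet> i" by (rule extend_coordinates[OF d]) blast
  have hC: "L k (\<xi> i) \<in> C" if "k \<in> E" for k i by (rule VF_C[OF X_VF[OF that] \<xi>(1)])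
  \<comment> \<open>Lipschitz constants \<open>K k i\<close>, on balls of radius \<open>r k i\<close>, for the derivatives of the coordinates along the frame.\<close>
  define lips where "lips = (\<lambda>k i z. fst z > 0 \<and> snd z \<ge> 0 \<and>
    (\<forall>x\<in>ball (\<psi> q0) (fst z). \<forall>y\<in>ball (\<psi> q0) (fst z).
      \<bar>local_rep (V, \<psi>) (L k (\<xi> i)) x - local_rep (V, \<psi>) (L k (\<xi> i)) y\<bar> \<le> snd z * norm (x - y)))"
  define rK where "rK = (\<lambda>k i. SOME z. lips k i z)"
  define r where "r = (\<lambda>k i. fst (rK k i))"
  define K where "K = (\<lambda>k i. snd (rK k i))"
  have "lips k i (rK k i)" if k: "k \<in> E" for k i
  proof -
    have "\<psi> q0 \<in> \<psi> ` V" using d by simp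
    from smooth_on_locally_lipschitz[OF C_local_rep[OF hC[OF k, of i] d(1)] chart_open(2)[OF d(1)] this]
    obtain r K where "lips k i (r, K)" unfolding lips_def by auto
    then show ?thesis unfolding rK_def by (rule someI)
  qed
  then have rK: "\<And>k i. k \<in> E \<Longrightarrow> r k i > 0" "\<And>k i. k \<in> E \<Longrightarrow> K k i \<ge> 0"
    "\<And>k i y z. k \<in> E \<Longrightarrow> y \<in> ball (\<psi> q0) (r k i) \<Longrightarrow> z \<in> ball (\<psi> q0) (r k i) \<Longrightarrow>
      \<bar>local_rep (V, \<psi>) (L k (\<xi> i)) y - local_rep (V, \<psi>) (L k (\<xi> i)) z\<bar> \<le> K k i * norm (y - z)"
    unfolding lips_def r_def K_def by blast+
  define M where "M = (\<Inter>i\<in>(Basis::'e set). N i) \<inter> (\<Inter>k\<in>E. \<Inter>i\<in>(Basis::'e set). V \<inter> \<psi> -` ball (\<psi> q0) (r k i))"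
  have M: "open M" "q0 \<in> M"
  proof -
    show "open M" unfolding M_def
      by (intro open_Int open_INT ballI finite_Basis E(1) \<xi>(2) chart_preimage_open[OF d(1)] open_ball)
    show "q0 \<in> M" using \<xi>(3) rK(1) d by (auto simp: M_def)
  qed
  have MV: "q \<in> V" if "q \<in> M" for q
  proof -
    obtain i0 :: 'e where "i0 \<in> Basis" using nonempty_Basis by blast
    then have "q \<in> N i0" by (rule INT_D[OF IntD1[OF that[unfolded M_def]]])
    then show ?thesis using \<xi>(4) by blast
  qed
  have lip: "\<bar>L k (\<xi> i) q - L k (\<xi> i) q'\<bar> \<le> K k i * norm (\<psi> q - \<psi> q')"
    if "q \<in> M" "q' \<in> M" "k \<in> E" "i \<in> Basis" for q q' k i
  proof -
    have "\<psi> y \<in> ball (\<psi> q0) (r k i)" if y: "y \<in> M" for y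
      using INT_D[OF INT_D[OF IntD2[OF y[unfolded M_def]] \<open>k \<in> E\<close>] \<open>i \<in> Basis\<close>] by simp
    from rK(3)[OF that(3) this[OF that(1)] this[OF that(2)]] show ?thesis
      by (simp add: local_rep_def chart_inv[OF d(1) MV[OF that(1)]] chart_inv[OF d(1) MV[OF that(2)]])
  qed
  \<comment> \<open>Global fields \<open>\<beta> j\<close> that are the coordinate fields of \<open>\<phi>\<close> near \<open>p0\<close>; their frame components are continuous, hence bounded by \<open>B j k\<close> near \<open>p0\<close>.\<close>
  have "\<exists>X N. X \<in> VF \<and> open N \<and> p0 \<in> N \<and> N \<subseteq> U \<and> (\<forall>q\<in>N. value_at X q = chart_tangent (U, \<phi>) q j)" for j
    by (rule local_chart_field[OF c, of j]) blast
  then obtain \<beta> Q where \<beta>: "\<And>j. \<beta> j \<in> VF" "\<And>j. open (Q j)" "\<And>j. p0 \<in> Q j" "\<And>j. Q j \<subseteq> U"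
    "\<And>j q. q \<in> Q j \<Longrightarrow> value_at (\<beta> j) q = chart_tangent (U, \<phi>) q j" by metis
  define B where "B = (\<lambda>j k. \<bar>coef (\<beta> j) k p0\<bar> + 1)"
  define P where "P = (\<Inter>j\<in>(Basis::'e set). Q j)
     \<inter> (\<Inter>j\<in>(Basis::'e set). \<Inter>k\<in>E. coef (\<beta> j) k -` {coef (\<beta> j) k p0 - 1<..<coef (\<beta> j) k p0 + 1})
     \<inter> ((\<lambda>p. p \<otimes> a) -` M \<inter> (\<lambda>p. a \<otimes> p) -` M)"
  have P: "open P" "p0 \<in> P"
  proof -
    show "open P" unfolding P_def
      by (intro open_Int open_INT ballI finite_Basis E(1) \<beta>(2) open_vimage open_greaterThanLessThan
          C_continuous[OF coef_C[OF \<beta>(1)]] continuous_translations M(1))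
    show "p0 \<in> P" using \<beta>(3) M(2) p0 by (auto simp: P_def q0_def)
  qed
  have Bb: "\<bar>coef (\<beta> j) k p\<bar> \<le> B j k" if "p \<in> P" "j \<in> Basis" "k \<in> E" for p j k
  proof -
    note INT_D[OF INT_D[OF IntD2[OF IntD1[OF that(1)[unfolded P_def]]] that(2)] that(3)]
    then show ?thesis by (auto simp: B_def)
  qed
  have PM: "p \<otimes> a \<in> M" "a \<otimes> p \<in> M" if "p \<in> P" for p
    using IntD2[OF that[unfolded P_def]] by auto
  have "open (\<phi> ` (U \<inter> P))" "\<phi> p0 \<in> \<phi> ` (U \<inter> P)" using chart_image_open[OF c(1) P(1)] c P by auto
  then obtain r0 where r0: "r0 > 0" "ball (\<phi> p0) r0 \<subseteq> \<phi> ` (U \<inter> P)" by (meson openE)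
  define u where "u = (\<lambda>i. (\<lambda>p. \<xi> i (p \<otimes> a)) - (\<lambda>p. \<xi> i (a \<otimes> p)))"
  have uC: "u i \<in> C" for i unfolding u_def by (intro C_diff right_translate_C left_translate_C \<xi>(1))
  define \<delta> where "\<delta> = (\<lambda>x. \<Sum>i\<in>Basis. local_rep (U, \<phi>) (u i) x *\<^sub>R i)"
  have \<delta>p: "\<delta> (\<phi> p) = \<psi> (p \<otimes> a) - \<psi> (a \<otimes> p)" if p: "p \<in> P" "p \<in> U" for p
  proof -
    have "\<delta> (\<phi> p) = (\<Sum>i\<in>Basis. ((\<psi> (p \<otimes> a) - \<psi> (a \<otimes> p)) \<bullet> i) *\<^sub>R i)"
      unfolding \<delta>_def
    proof (intro sum.cong refl)
      fix i :: 'e assume i: "i \<in> Basis"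
      have "y \<in> N i" if y: "y \<in> M" for y by (rule INT_D[OF IntD1[OF y[unfolded M_def]] i])
      note this[OF PM(1)[OF p(1)]] this[OF PM(2)[OF p(1)]]
      then show "local_rep (U, \<phi>) (u i) (\<phi> p) *\<^sub>R i = ((\<psi> (p \<otimes> a) - \<psi> (a \<otimes> p)) \<bullet> i) *\<^sub>R i"
        by (simp add: local_rep_def chart_inv[OF c(1) p(2)] u_def \<xi>(5) inner_diff_left)
    qed
    then show ?thesis by (simp add: euclidean_representation)
  qed
  have Lu: "L k (u i) p = L k (\<xi> i) (p \<otimes> a) - L k (\<xi> i) (a \<otimes> p)" if k: "k \<in> E" for k i p
  proof -
    have "L k (u i) p = L k (\<lambda>p. \<xi> i (p \<otimes> a)) p - L k (\<lambda>p. \<xi> i (a \<otimes> p)) p"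
      unfolding u_def by (simp add: VF_diff[OF X_VF[OF k] right_translate_C left_translate_C] \<xi>(1))
    also have "L k (\<lambda>p. \<xi> i (p \<otimes> a)) p = L k (\<xi> i) (p \<otimes> a)"
      using right_field_translate[of k "\<xi> i" a p] by (simp add: RL[OF E_T[OF k]])
    also have "L k (\<lambda>p. \<xi> i (a \<otimes> p)) p = L k (\<xi> i) (a \<otimes> p)" by (rule left_field_translate)
    finally show ?thesis .
  qed
  let ?D = "\<lambda>i x. frechet_derivative (local_rep (U, \<phi>) (u i)) (at x)"
  define Bt where "Bt = (\<Sum>i\<in>(Basis::'e set). \<Sum>j\<in>(Basis::'e set). \<Sum>k\<in>E. B j k * K k i)"
  have "\<exists>s>0. s \<le> r0 \<and> (\<forall>x\<in>ball (\<phi> p0) s. \<delta> x = 0)"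
  proof (rule vanishes_near_zero_of_linear_bound[OF r0(1)])
    fix x assume "x \<in> ball (\<phi> p0) r0"
    then obtain p where p: "p \<in> U" "p \<in> P" "\<phi> p = x" using r0(2) by auto
    show "(\<delta> has_derivative (\<lambda>w. \<Sum>i\<in>Basis. ?D i x w *\<^sub>R i)) (at x)"
      unfolding \<delta>_def using local_rep_has_derivative[OF uC c(1) p(1)] p(3)
      by (intro has_derivative_sum has_derivative_scaleR_left) auto
    fix w
    have Dj: "\<bar>?D i x j\<bar> \<le> (\<Sum>k\<in>E. B j k * K k i) * norm (\<delta> x)" if i: "i \<in> Basis" and j: "j \<in> Basis" for i j
    proof -
      have "p \<in> Q j" by (rule INT_D[OF IntD1[OF IntD1[OF p(2)[unfolded P_def]]] j])
      from \<beta>(5)[OF this] have "?D i x j = \<beta> j (u i) p"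
        using uC[of i] p(3) by (simp add: value_at_def chart_tangent_def fun_eq_iff)
      also have "\<dots> = (\<Sum>k\<in>E. coef (\<beta> j) k p * L k (u i) p)" by (rule apply_expand[OF \<beta>(1)])
      finally have "\<bar>?D i x j\<bar> \<le> (\<Sum>k\<in>E. \<bar>coef (\<beta> j) k p * L k (u i) p\<bar>)" by simp
      also have "\<dots> \<le> (\<Sum>k\<in>E. B j k * (K k i * norm (\<delta> x)))"
      proof (rule sum_mono)
        fix k assume k: "k \<in> E"
        have "\<bar>L k (u i) p\<bar> \<le> K k i * norm (\<delta> x)"
          using lip[OF PM[OF p(2)] k i] \<delta>p[OF p(2,1)] p(3) by (simp add: Lu[OF k])
        then show "\<bar>coef (\<beta> j) k p * L k (u i) p\<bar> \<le> B j k * (K k i * norm (\<delta> x))"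
          unfolding abs_mult using Bb[OF p(2) j k] by (intro mult_mono) auto
      qed
      finally show ?thesis by (simp add: sum_distrib_right mult.assoc)
    qed
    have Dw: "\<bar>?D i x w\<bar> \<le> (\<Sum>j\<in>Basis. \<Sum>k\<in>E. B j k * K k i) * norm (\<delta> x) * norm w" if i: "i \<in> Basis" for i
    proof -
      have "?D i x w = (\<Sum>j\<in>Basis. (w \<bullet> j) *\<^sub>R ?D i x j)"
        using local_rep_has_derivative[OF uC c(1) p(1), of i] p(3)
        by (intro frechet_derivative_expand differentiableI) auto
      then have "\<bar>?D i x w\<bar> \<le> (\<Sum>j\<in>Basis. \<bar>(w \<bullet> j) * ?D i x j\<bar>)" by simp
      also have "\<dots> \<le> (\<Sum>j\<in>Basis. norm w * ((\<Sum>k\<in>E. B j k * K k i) * norm (\<delta> x)))"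
        unfolding abs_mult using Dj[OF i] Basis_le_norm by (intro sum_mono mult_mono) auto
      finally show ?thesis by (simp add: sum_distrib_left sum_distrib_right mult_ac)
    qed
    have "norm (\<Sum>i\<in>Basis. ?D i x w *\<^sub>R i) \<le> (\<Sum>i\<in>(Basis::'e set). norm (?D i x w *\<^sub>R i))" by (rule norm_sum)
    also have "\<dots> \<le> (\<Sum>i\<in>(Basis::'e set). (\<Sum>j\<in>Basis. \<Sum>k\<in>E. B j k * K k i) * norm (\<delta> x) * norm w)"
      by (rule sum_mono) (use Dw in simp)
    also have "\<dots> = Bt * norm (\<delta> x) * norm w" by (simp add: Bt_def sum_distrib_right)
    finally show "norm (\<Sum>i\<in>Basis. ?D i x w *\<^sub>R i) \<le> Bt * norm (\<delta> x) * norm w" .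
  next
    show "\<delta> (\<phi> p0) = 0" using \<delta>p[OF P(2) c(2)] p0 by simp
  qed
  then obtain s where s: "s > 0" "s \<le> r0" "\<And>x. x \<in> ball (\<phi> p0) s \<Longrightarrow> \<delta> x = 0" by blast
  let ?N = "U \<inter> \<phi> -` ball (\<phi> p0) s"
  have agree: "p \<otimes> a = a \<otimes> p" if p: "p \<in> ?N" for p
  proof -
    have "\<phi> p \<in> \<phi> ` (U \<inter> P)" using p s r0 by auto
    then obtain p' where p': "p' \<in> U" "p' \<in> P" "\<phi> p = \<phi> p'" by auto
    then have pP: "p \<in> P" using chart_inv[OF c(1), of p] chart_inv[OF c(1), of p'] p by auto
    have pU: "p \<in> U" "\<phi> p \<in> ball (\<phi> p0) s" using p by auto
    have "\<psi> (p \<otimes> a) - \<psi> (a \<otimes> p) = 0"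
      using s(3)[OF pU(2)] by (simp only: \<delta>p[OF pP pU(1)])
    then have "\<psi> (p \<otimes> a) = \<psi> (a \<otimes> p)" by simp
    then show ?thesis
      by (metis chart_inv[OF d(1) MV[OF PM(1)[OF pP]]] chart_inv[OF d(1) MV[OF PM(2)[OF pP]]])
  qed
  show ?thesis
  proof (intro exI[of _ ?N] conjI ballI)
    show "open ?N" by (rule chart_preimage_open[OF c(1) open_ball])
    show "p0 \<in> ?N" using c s by simp
  qed (rule agree)
qed

lemma zero_bracket_imp_commutative:
  assumes conn: "connected (UNIV :: 'g set)" and c0: "\<And>i j k. i \<in> E \<Longrightarrow> j \<in> E \<Longrightarrow> k \<in> E \<Longrightarrow> c i j k = 0"
  shows "comm_group G"
proof (rule group_comm_groupI)
  fix p a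
  let ?S = "{p. p \<otimes> a = a \<otimes> p}"
  have "open ?S"
  proof (rule topological_space_class.openI)
    fix p0 assume "p0 \<in> ?S"
    then have "p0 \<otimes> a = a \<otimes> p0" by simp
    from translations_agree_near[OF right_field_eq_left_field[OF conn c0] this]
    obtain N where "open N" "p0 \<in> N" "\<forall>p\<in>N. p \<otimes> a = a \<otimes> p" by blast
    then show "\<exists>N. open N \<and> p0 \<in> N \<and> N \<subseteq> ?S" by (intro exI[of _ N]) auto
  qed
  moreover have "closed ?S" by (rule closed_Collect_eq[OF continuous_translations])
  moreover have "\<one> \<in> ?S" by simp
  ultimately have "?S = UNIV" using conn unfolding connected_clopen by auto
  then have "p \<in> ?S" by (simp only: UNIV_I)
  then show "p \<otimes> a = a \<otimes> p" by simp
qed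

end

section \<open>Signs of the curvature\<close>

context adapted_basis begin

lemma exists_negative_curvature:
  assumes "str.S > 0"
  shows "\<exists>p u v. plane_basis A p u v \<and> sectional_curvature A g p u v < 0"
proof -
  have "(\<Sum>i\<in>E. \<Sum>j\<in>E. str.R i j j i) < 0"
    using assms sum_nonneg[of E "\<lambda>m. (\<Sum>i\<in>E. c m i i)\<^sup>2"] by (simp add: str.scalar_curvature_sum)
  then have "\<exists>i\<in>E. \<exists>j\<in>E. str.R i j j i < 0"
    using sum_nonneg[of E "\<lambda>i. \<Sum>j\<in>E. str.R i j j i"] sum_nonneg[of E "\<lambda>j. str.R i j j i" for i]
    by (meson not_le)
  then obtain i j where ij: "i \<in> E" "j \<in> E" "str.R i j j i < 0" by blast
  have ne: "i \<noteq> j"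
  proof
    assume "i = j" then show False using str.R_skew[of i i i i] ij(3) by simp
  qed
  show ?thesis
    by (intro exI conjI, rule frame_sectional_curvature(1)[OF ij(1,2) ne, of \<one>])
       (simp only: frame_sectional_curvature(2)[OF ij(1,2) ne] ij(3))
qed

lemma exists_positive_curvature:
  assumes uni: "unimodular G A" and S: "str.S \<noteq> 0"
  shows "\<exists>p u v. plane_basis A p u v \<and> sectional_curvature A g p u v > 0"
proof (rule ccontr)
  assume none: "\<not> ?thesis"
  have neg: "sectional_curvature A g \<one> u v \<le> 0" if "plane_basis A \<one> u v" for u v
  proof (rule ccontr)
    assume "\<not> sectional_curvature A g \<one> u v \<le> 0"
    then have "plane_basis A \<one> u v \<and> sectional_curvature A g \<one> u v > 0" using that by simp
    with none show False by blast
  qed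
  \<comment> \<open>Dependent pairs do not span a plane; for them the curvature form vanishes.\<close>
  have form: "g \<one> (curvature_at A g \<one> u v v) u \<le> 0" if u: "u \<in> T \<one>" and v: "v \<in> T \<one>" for u v
  proof (cases "u \<noteq> v \<and> independent {u, v}")
    case True
    then have "plane_basis A \<one> u v" using u v by (simp add: plane_basis_def)
    from neg[OF this] inner.gram_determinant_pos[OF u v] True show ?thesis
      by (auto simp: sectional_curvature_def divide_le_0_iff)
  next
    case False
    then obtain t where "v = t *\<^sub>R u \<or> u = t *\<^sub>R v" using dependent_pair by blast
    from curvature_form_dependent[OF u v this] show ?thesis by simp
  qed
  have "str.S = 0"
  proof (rule str.nonpositive_curvature_imp_abelian)
    show "(\<Sum>k\<in>E. c i k k) = 0" for i by (rule unimodular_trace[OF uni])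
    show "E1 \<subseteq> E" by (rule E(2))
    show "c i j k = 0" if "k \<in> E - E1" for i j k by (rule bracket_vanishes_outside[OF that])
    show "\<forall>x. (\<forall>i\<in>E. \<forall>j\<in>E. (\<Sum>k\<in>E. c i j k * x k) = 0) \<longrightarrow> (\<forall>l\<in>E1. x l = 0)"
      using brackets_span_inside by blast
    fix x y :: "'g tangent \<Rightarrow> real"
    define vec where "vec = (\<lambda>z::'g tangent \<Rightarrow> real. \<Sum>k\<in>E. z k *\<^sub>R k)"
    have vT: "vec z \<in> T \<one>" for z unfolding vec_def by (intro T_sum T_scale E_T)
    have vc: "co \<one> (vec z) k = z k" if "k \<in> E" for z k
      using inner.orthonormal_coefficient[OF E(3,1) order_refl that, of z] that
      by (simp add: vec_def value_at_left_field)
    have "(\<Sum>i\<in>E. \<Sum>j\<in>E. \<Sum>k\<in>E. \<Sum>l\<in>E. x i * y j * y k * x l * str.R i j k l)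
        = g \<one> (curvature_at A g \<one> (vec x) (vec y) (vec y)) (vec x)"
      unfolding curvature_form[OF vT vT] by (intro sum.cong refl) (simp add: vc)
    then show "(\<Sum>i\<in>E. \<Sum>j\<in>E. \<Sum>k\<in>E. \<Sum>l\<in>E. x i * y j * y k * x l * str.R i j k l) \<le> 0"
      using form[OF vT vT] by simp
  qed
  with S show False by simp
qed

end

theorem proposition3p5:
  fixes G :: "('g::{t2_space, second_countable_topology}) monoid"
    and A :: "('g, 'e::euclidean_space) chart set"
    and g :: "'g \<Rightarrow> 'g tangent \<Rightarrow> 'g tangent \<Rightarrow> real"
  assumes "metric_lie_group G A g"
    and "connected (UNIV :: 'g set)"
    and "\<not> comm_group G"
    and "cyclic_metric G A g"
  shows
    "(solvable G \<longrightarrow> (\<forall>p. scalar_curvature A g p < 0)) \<and>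
     (unimodular G A \<longrightarrow>
        (\<exists>p u v. plane_basis A p u v \<and> sectional_curvature A g p u v > 0) \<and>
        (solvable G \<longrightarrow>
          (\<exists>p u v. plane_basis A p u v \<and> sectional_curvature A g p u v > 0) \<and>
          (\<exists>p u v. plane_basis A p u v \<and> sectional_curvature A g p u v < 0))) \<and>
     (\<not> unimodular G A \<longrightarrow>
        (\<exists>p u v. plane_basis A p u v \<and> sectional_curvature A g p u v < 0))"
proof -
  interpret cyclic_metric_lie_group A G g
    using assms by unfold_locales (auto simp: metric_lie_group_def lie_group_def)
  obtain E1 E where E: "finite E" "E1 \<subseteq> E" "inner.orthonormal \<one>\<^bsub>G\<^esub> E" "span E = T \<one>\<^bsub>G\<^esub>"
    "span E1 = span {br u v | u v. u \<in> T \<one>\<^bsub>G\<^esub> \<and> v \<in> T \<one>\<^bsub>G\<^esub>}"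
    by (rule adapted_orthonormal_basis)
  interpret adapted_basis A G g E E1
    by unfold_locales (rule E)+
  have S: "str.S \<noteq> 0"
  proof
    assume "str.S = 0"
    then have "comm_group G" by (intro zero_bracket_imp_commutative[OF assms(2)] str.S_eq_0)
    with assms(3) show False ..
  qed
  then have Spos: "str.S > 0" using str.S_nonneg by simp
  have "scalar_curvature A g p < 0" for p
    unfolding scalar_curvature_formula str.scalar_curvature_sum
    using Spos sum_nonneg[of E "\<lambda>m. (\<Sum>i\<in>E. c m i i)\<^sup>2"] by simp
  with exists_negative_curvature[OF Spos] exists_positive_curvature[OF _ S] show ?thesis
    by (intro conjI impI allI) assumption+
qed

end
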